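(* For every positive integer $k$, the quotient space $S_{k,1}(\Gamma_0(T))/S^2_{k,1}(\Gamma_0(T))$ has a basis consisting of simultaneous eigenvectors for all Hecke operators $\mathbb{T}_\mathfrak{p}$ with $\mathfrak{p}\neq(T)$. Each element of this basis has eigenvalue $\lambda_\mathfrak{p}=\wp$ under $\mathbb{T}_\mathfrak{p}$, for every nonzero prime $\mathfrak{p}=(\wp)\neq(T)$ with $\wp$ monic.
   Context: Let $q$ be a prime power, $A=\mathbb{F}_q[T]$, $\mathbb{C}_\infty$ the completion of an algebraic closure of $K_\infty=\mathbb{F}_q((1/T))$, and $\Omega=\mathbb{C}_\infty\setminus K_\infty$, with $\mathrm{GL}_2(A)$ acting by Möbius transformations. Fix a Carlitz period $\widetilde{\pi}$. For a nonzero ideal $\mathfrak{a}\subseteq A$ put $e_{\widetilde{\pi}\mathfrak{a}}(z)=z\prod_{0\ne\lambda\in\widetilde{\pi}\mathfrak{a}}(1-z/\lambda)$ and $t_{\mathfrak{a}}(z)=1/e_{\widetilde{\pi}\mathfrak{a}}(\widetilde{\pi}z)$. Let $\Gamma_0(T)=\left\{\begin{pmatrix}a&b\\c&d\end{pmatrix}\in\mathrm{GL}_2(A): c\equiv0\bmod T\right\}$. For $\delta=\begin{pmatrix}a&b\\c&d\end{pmatrix}\in\mathrm{GL}_2(A)$ and $f:\Omega\to\mathbb{C}_\infty$, put $(f|_{k,m}\delta)(z)=(\det\delta)^m(cz+d)^{-k}f(\delta z)$. A Drinfeld modular form of weight $k$ and type $m\in\mathbb{Z}/(q-1)$ for $\Gamma=\Gamma_0(T)$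 is a rigid analytic $f:\Omega\to\mathbb{C}_\infty$ such that: - $f|_{k,m}\gamma=f$ for all $\gamma\in\Gamma$; - for every $\delta\in\mathrm{GL}_2(A)$, letting $\mathfrak{a}_\delta=\{b\in A:\begin{pmatrix}1&b\\0&1\end{pmatrix}\in\delta^{-1}\Gamma\delta\}$, the function $f|_{k,m}\delta$ has an expansion $\sum_{i\ge0}a_i(\delta)\,t_{\mathfrak{a}_\delta}^i$ valid near infinity. The space of such forms is $M_{k,m}(\Gamma)$. Its subspaces are: - $S_{k,m}(\Gamma)$, the cusp forms: $a_0(\delta)=0$ for all $\delta$; - $S^2_{k,m}(\Gamma)$, the double-cuspidal forms: $a_0(\delta)=a_1(\delta)=0$ for all $\delta$. For a nonzero prime $\mathfrak{p}=(\wp)\ne(T)$, $\wp$ monic, the Hecke operator is \[ \mathbb{T}_\mathfrak{p}f(z)=\wp^kf(\wp z)+\sum_{\beta\in A,\ \deg\beta<\deg\wp}f\!\left(\tfrac{z+\beta}{\wp}\right). \] It preserves $S_{k,m}(\Gamma)$ and $S^2_{k,m}(\Gamma)$, and so acts on the quotient. *)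

theory Defs
  imports
    "HOL-Analysis.Analysis"
    "HOL-Computational_Algebra.Computational_Algebra"
    "HOL-Algebra.AbelCoset"
    "Jordan_Normal_Form.Missing_VectorSpace"
begin

section \<open>The field \<open>\<complex>\<^sub>\<infinity>\<close>\<close>

text \<open>
  Throughout, \<open>'a\<close> is the finite field with \<open>q = CARD('a)\<close> elements, \<open>A\<close> is \<open>'a poly\<close>, and the
  completion of its fraction field at infinity is the field \<open>'a fls\<close> of formal Laurent series
  in the uniformizer \<open>1/T = fls_X\<close>. The field \<open>\<complex>\<^sub>\<infinity>\<close> is a type \<open>'c\<close> with an embedding
  \<open>\<iota> :: 'a fls \<Rightarrow> 'c\<close>, characterised (uniquely up to isometric isomorphism) below.
\<close>

class complete_ultrametric_field = field + complete_space +
  assumes dist_diff: "dist x y = dist (x - y) 0"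
    and dist_0_mult: "dist (x * y) 0 = dist x 0 * dist y 0"
    and dist_0_add_ultrametric: "dist (x + y) 0 \<le> max (dist x 0) (dist y 0)"

definition absval :: "'c::complete_ultrametric_field \<Rightarrow> real" where
  "absval x = dist x 0"

definition algebraic_elements :: "('a::field fls \<Rightarrow> 'c::field) \<Rightarrow> 'c set" where
  "algebraic_elements \<iota> = {x. \<exists>p. p \<noteq> 0 \<and> poly (map_poly \<iota> p) x = 0}"

text \<open>
  The algebraic elements form an algebraic closure of \<open>K\<^sub>\<infinity>\<close>, of which \<open>'c\<close> is the completion.
  The absolute value is normalised by \<open>\<bar>T\<bar> = q\<close>.
\<close>

definition is_C_infinity ::
    "('a::{field,finite} fls \<Rightarrow> 'c::complete_ultrametric_field) \<Rightarrow> bool" where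
  "is_C_infinity \<iota> \<longleftrightarrow>
     \<iota> 1 = 1 \<and>
     (\<forall>x y. \<iota> (x + y) = \<iota> x + \<iota> y) \<and>
     (\<forall>x y. \<iota> (x * y) = \<iota> x * \<iota> y) \<and>
     (\<forall>x. x \<noteq> 0 \<longrightarrow> absval (\<iota> x) = real CARD('a) powi (- fls_subdegree x)) \<and>
     (\<forall>p. degree p > 0 \<and> (\<forall>i. coeff p i \<in> algebraic_elements \<iota>) \<longrightarrow>
        (\<exists>x \<in> algebraic_elements \<iota>. poly p x = 0)) \<and>
     closure (algebraic_elements \<iota>) = UNIV"

definition emb :: "('a::field fls \<Rightarrow> 'c) \<Rightarrow> 'a poly \<Rightarrow> 'c" where
  "emb \<iota> a = \<iota> (poly (map_poly fls_const a) fls_X_inv)"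

definition Omega :: "('a::field fls \<Rightarrow> 'c) \<Rightarrow> 'c set" where
  "Omega \<iota> = - range \<iota>"


section \<open>Carlitz periods and the parameter at infinity\<close>

text \<open>
  The exponential of the Carlitz module \<open>T \<mapsto> T X + X^q\<close>; it satisfies
  \<open>e(T z) = T e(z) + e(z)^q\<close>.
\<close>

definition carlitz_D :: "('a::{field,finite} fls \<Rightarrow> 'c::field) \<Rightarrow> nat \<Rightarrow> 'c" where
  "carlitz_D \<iota> i =
     (\<Prod>j<i. emb \<iota> [:0, 1:] ^ (CARD('a) ^ i) - emb \<iota> [:0, 1:] ^ (CARD('a) ^ j))"

definition carlitz_exp ::
    "('a::{field,finite} fls \<Rightarrow> 'c::complete_ultrametric_field) \<Rightarrow> 'c \<Rightarrow> 'c" where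
  "carlitz_exp \<iota> z = (\<Sum>i. z ^ (CARD('a) ^ i) / carlitz_D \<iota> i)"

definition carlitz_period ::
    "('a::{field,finite} fls \<Rightarrow> 'c::complete_ultrametric_field) \<Rightarrow> 'c \<Rightarrow> bool" where
  "carlitz_period \<iota> \<pi> \<longleftrightarrow> \<pi> \<noteq> 0 \<and> {z. carlitz_exp \<iota> z = 0} = (\<lambda>a. \<pi> * emb \<iota> a) ` UNIV"

text \<open>The infinite product is the limit over the directed set of finite subproducts.\<close>

definition lattice_exp :: "'c::complete_ultrametric_field set \<Rightarrow> 'c \<Rightarrow> 'c" where
  "lattice_exp \<Lambda> z =
     z * Lim (finite_subsets_at_top (\<Lambda> - {0})) (\<lambda>F. \<Prod>\<omega>\<in>F. 1 - z / \<omega>)"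

definition t_param ::
    "('a::{field,finite} fls \<Rightarrow> 'c::complete_ultrametric_field) \<Rightarrow> 'c \<Rightarrow> 'a poly set \<Rightarrow> 'c \<Rightarrow> 'c"
  where
  "t_param \<iota> \<pi> I z = 1 / lattice_exp ((\<lambda>a. \<pi> * emb \<iota> a) ` I) (\<pi> * z)"


section \<open>Rigid analytic functions on \<open>\<Omega>\<close>\<close>

text \<open>
  The connected affinoids \<open>\<Omega>\<^sub>n\<close> form an admissible covering of \<open>\<Omega>\<close>. A function on such a
  subset of the projective line is rigid analytic iff it is a uniform limit of rational
  functions without poles there.
\<close>

definition Omega_affinoid ::
    "('a::{field,finite} fls \<Rightarrow> 'c::complete_ultrametric_field) \<Rightarrow> nat \<Rightarrow> 'c set" where
  "Omega_affinoid \<iota> n =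
     {z. absval z \<le> real CARD('a) ^ n \<and> (\<forall>x \<in> range \<iota>. absval (z - x) \<ge> 1 / real CARD('a) ^ n)}"

definition rigid_analytic ::
    "('a::{field,finite} fls \<Rightarrow> 'c::complete_ultrametric_field) \<Rightarrow> ('c \<Rightarrow> 'c) \<Rightarrow> bool" where
  "rigid_analytic \<iota> f \<longleftrightarrow>
     (\<forall>n. \<forall>\<epsilon>>0. \<exists>P Q. \<forall>z \<in> Omega_affinoid \<iota> n.
        poly Q z \<noteq> 0 \<and> absval (f z - poly P z / poly Q z) < \<epsilon>)"


section \<open>Drinfeld modular forms\<close>

definition GL2_A :: "('a::field poly ^ 2 ^ 2) set" where
  "GL2_A = {\<delta>. invertible \<delta>}"

definition Gamma0_T :: "('a::field poly ^ 2 ^ 2) set" where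
  "Gamma0_T = {\<gamma> \<in> GL2_A. [:0, 1:] dvd \<gamma> $ 2 $ 1}"

definition moebius ::
    "('a::field fls \<Rightarrow> 'c::field) \<Rightarrow> 'a poly ^ 2 ^ 2 \<Rightarrow> 'c \<Rightarrow> 'c" where
  "moebius \<iota> \<delta> z =
     (emb \<iota> (\<delta> $ 1 $ 1) * z + emb \<iota> (\<delta> $ 1 $ 2)) / (emb \<iota> (\<delta> $ 2 $ 1) * z + emb \<iota> (\<delta> $ 2 $ 2))"

text \<open>
  Types in \<open>\<int>/(q - 1)\<close> are given by representatives in \<open>nat\<close>: for \<open>\<delta> \<in> GL2_A\<close>, \<open>det \<delta>\<close> is a
  nonzero constant, so its \<open>m\<close>-th power depends only on \<open>m\<close> modulo \<open>q - 1\<close>.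
\<close>

definition slash ::
    "('a::field fls \<Rightarrow> 'c::field) \<Rightarrow> nat \<Rightarrow> nat \<Rightarrow> ('c \<Rightarrow> 'c) \<Rightarrow> 'a poly ^ 2 ^ 2 \<Rightarrow> 'c \<Rightarrow> 'c" where
  "slash \<iota> k m f \<delta> z =
     emb \<iota> (det \<delta>) ^ m / (emb \<iota> (\<delta> $ 2 $ 1) * z + emb \<iota> (\<delta> $ 2 $ 2)) ^ k * f (moebius \<iota> \<delta> z)"

definition translation :: "'a::field poly \<Rightarrow> 'a poly ^ 2 ^ 2" where
  "translation b = vector [vector [1, b], vector [0, 1]]"

definition cusp_ideal ::
    "('a::field poly ^ 2 ^ 2) set \<Rightarrow> 'a poly ^ 2 ^ 2 \<Rightarrow> 'a poly set" where
  "cusp_ideal \<Gamma> \<delta> = {b. translation b \<in> (\<lambda>\<gamma>. matrix_inv \<delta> ** \<gamma> ** \<delta>) ` \<Gamma>}"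

text \<open>
  ``Near infinity'' means for all \<open>z\<close> of sufficiently large imaginary part, the latter being the
  distance of \<open>z\<close> to \<open>K\<^sub>\<infinity>\<close>. The coefficients are uniquely determined by the function.
\<close>

definition has_t_expansion ::
    "('a::{field,finite} fls \<Rightarrow> 'c::complete_ultrametric_field) \<Rightarrow> 'c \<Rightarrow> 'a poly set \<Rightarrow>
     ('c \<Rightarrow> 'c) \<Rightarrow> (nat \<Rightarrow> 'c) \<Rightarrow> bool" where
  "has_t_expansion \<iota> \<pi> I g a \<longleftrightarrow>
     (\<exists>R>0. \<forall>z. (\<forall>x \<in> range \<iota>. absval (z - x) \<ge> R) \<longrightarrow> (\<lambda>i. a i * t_param \<iota> \<pi> I z ^ i) sums g z)"

text \<open>
  Functions \<open>\<Omega> \<rightarrow> \<complex>\<^sub>\<infinity>\<close> are represented by their extension by zero to \<open>'c\<close>.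
\<close>

definition modular_forms ::
    "('a::{field,finite} fls \<Rightarrow> 'c::complete_ultrametric_field) \<Rightarrow> 'c \<Rightarrow>
     ('a poly ^ 2 ^ 2) set \<Rightarrow> nat \<Rightarrow> nat \<Rightarrow> ('c \<Rightarrow> 'c) set" where
  "modular_forms \<iota> \<pi> \<Gamma> k m =
     {f. (\<forall>z. z \<notin> Omega \<iota> \<longrightarrow> f z = 0) \<and>
         rigid_analytic \<iota> f \<and>
         (\<forall>\<gamma> \<in> \<Gamma>. \<forall>z \<in> Omega \<iota>. slash \<iota> k m f \<gamma> z = f z) \<and>
         (\<forall>\<delta> \<in> GL2_A. \<exists>a. has_t_expansion \<iota> \<pi> (cusp_ideal \<Gamma> \<delta>) (slash \<iota> k m f \<delta>) a)}"

definition cusp_forms ::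
    "('a::{field,finite} fls \<Rightarrow> 'c::complete_ultrametric_field) \<Rightarrow> 'c \<Rightarrow>
     ('a poly ^ 2 ^ 2) set \<Rightarrow> nat \<Rightarrow> nat \<Rightarrow> ('c \<Rightarrow> 'c) set" where
  "cusp_forms \<iota> \<pi> \<Gamma> k m =
     {f \<in> modular_forms \<iota> \<pi> \<Gamma> k m.
        \<forall>\<delta> \<in> GL2_A. \<exists>a. has_t_expansion \<iota> \<pi> (cusp_ideal \<Gamma> \<delta>) (slash \<iota> k m f \<delta>) a \<and> a 0 = 0}"

definition double_cusp_forms ::
    "('a::{field,finite} fls \<Rightarrow> 'c::complete_ultrametric_field) \<Rightarrow> 'c \<Rightarrow>
     ('a poly ^ 2 ^ 2) set \<Rightarrow> nat \<Rightarrow> nat \<Rightarrow> ('c \<Rightarrow> 'c) set" where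
  "double_cusp_forms \<iota> \<pi> \<Gamma> k m =
     {f \<in> modular_forms \<iota> \<pi> \<Gamma> k m.
        \<forall>\<delta> \<in> GL2_A. \<exists>a. has_t_expansion \<iota> \<pi> (cusp_ideal \<Gamma> \<delta>) (slash \<iota> k m f \<delta>) a \<and>
          a 0 = 0 \<and> a 1 = 0}"

definition hecke ::
    "('a::{field,finite} fls \<Rightarrow> 'c::field) \<Rightarrow> nat \<Rightarrow> 'a poly \<Rightarrow> ('c \<Rightarrow> 'c) \<Rightarrow> 'c \<Rightarrow> 'c" where
  "hecke \<iota> k p f z =
     emb \<iota> p ^ k * f (emb \<iota> p * z) +
     (\<Sum>\<beta> | degree \<beta> < degree p. f ((z + emb \<iota> \<beta>) / emb \<iota> p))"


section \<open>Quotient spaces\<close>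

definition scalar_field :: "'c::field ring" where
  "scalar_field = \<lparr>carrier = UNIV, mult = (*), one = 1, zero = 0, add = (+)\<rparr>"

text \<open>
  Module records extend ring records, hence the irrelevant fields \<open>mult\<close> and \<open>one\<close>.
\<close>

definition function_space :: "('c \<Rightarrow> 'c::field) set \<Rightarrow> ('c, 'c \<Rightarrow> 'c) module" where
  "function_space S =
     \<lparr>carrier = S, mult = undefined, one = undefined,
      zero = (\<lambda>z. 0), add = (\<lambda>f g z. f z + g z), smult = (\<lambda>c f z. c * f z)\<rparr>"

text \<open>
  In the following two definitions, the union is over all representatives \<open>x\<close> of the coset \<open>X\<close>;
  it is a single coset precisely when the operation is well-defined on \<open>X\<close>.
\<close>

definition quotient_space :: "('r, 'v, 'e) module_scheme \<Rightarrow> 'v set \<Rightarrow> ('r, 'v set) module" where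
  "quotient_space V W =
     \<lparr>carrier = a_rcosets\<^bsub>V\<^esub> W, mult = undefined, one = undefined,
      zero = W, add = set_add V, smult = (\<lambda>c X. \<Union>x\<in>X. W +>\<^bsub>V\<^esub> (c \<odot>\<^bsub>V\<^esub> x))\<rparr>"

definition quotient_map ::
    "('r, 'v, 'e) module_scheme \<Rightarrow> 'v set \<Rightarrow> ('v \<Rightarrow> 'v) \<Rightarrow> 'v set \<Rightarrow> 'v set" where
  "quotient_map V W T X = (\<Union>x\<in>X. W +>\<^bsub>V\<^esub> T x)"

definition is_eigenvector ::
    "('r, 'v, 'e) module_scheme \<Rightarrow> ('v \<Rightarrow> 'v) \<Rightarrow> 'r \<Rightarrow> 'v \<Rightarrow> bool" where
  "is_eigenvector V T c v \<longleftrightarrow> v \<in> carrier V \<and> v \<noteq> \<zero>\<^bsub>V\<^esub> \<and> T v = c \<odot>\<^bsub>V\<^esub> v"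

definition cusp_quotient ::
    "('a::{field,finite} fls \<Rightarrow> 'c::complete_ultrametric_field) \<Rightarrow> 'c \<Rightarrow>
     ('a poly ^ 2 ^ 2) set \<Rightarrow> nat \<Rightarrow> nat \<Rightarrow> ('c, ('c \<Rightarrow> 'c) set) module" where
  "cusp_quotient \<iota> \<pi> \<Gamma> k m =
     quotient_space (function_space (cusp_forms \<iota> \<pi> \<Gamma> k m)) (double_cusp_forms \<iota> \<pi> \<Gamma> k m)"

definition hecke_quotient ::
    "('a::{field,finite} fls \<Rightarrow> 'c::complete_ultrametric_field) \<Rightarrow> 'c \<Rightarrow>
     ('a poly ^ 2 ^ 2) set \<Rightarrow> nat \<Rightarrow> nat \<Rightarrow> 'a poly \<Rightarrow> ('c \<Rightarrow> 'c) set \<Rightarrow> ('c \<Rightarrow> 'c) set" where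
  "hecke_quotient \<iota> \<pi> \<Gamma> k m p =
     quotient_map (function_space (cusp_forms \<iota> \<pi> \<Gamma> k m)) (double_cusp_forms \<iota> \<pi> \<Gamma> k m)
       (hecke \<iota> k p)"

end

(*
  On the quotient S / S^2 every Hecke operator T_p acts as the scalar p, so any basis will do.
  A cusp form f has an expansion in t = 1 / E(z), where E is the exponential function of the
  lattice A, and modulo S^2 only the coefficient of t matters. The term p^k f(p z) does not
  contribute to it, because E(p z) is a polynomial in E(z) of degree q^(deg p) > 1. In the sum over
  the (z + b) / p, the values E((z + b) / p) are the roots X of P(X) = P(x), where x = E(z / p) and
  P is an additive polynomial, so that P' is a constant c. The generating function of the sums of
  the inverse i-th powers of these roots is therefore c / (P(x) - P(X)) as a power series in X.
  With tau = 1 / P(x), a multiple of t, this is c tau + O(tau^2 X): the sum for i = 1 equals p t,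
  and the sums for i > 1 are divisible by t^2. The cusp 0 reduces to the cusp infinity, since
  f |-> f | W_T with the matrix W_T of determinant T exchanges the cusps and commutes with T_p.
*)

theory Submission
  imports Defs
begin

section \<open>Ultrametric fields\<close>

text \<open>A statement modulo t^2 needs one coefficient sequence that serves all z near infinity at
  once. The two substitution lemmas for series therefore fix the new coefficients and a radius
  before the point is given. They are fed by two estimates: convergence at a single point bounds the
  coefficients geometrically, and \<open>absval (E z)\<close> is at least the distance of z to
  \<open>K_\<infinity>\<close>, which makes 1/E uniformly small. The eigenvalue is the product of
  two constants. With c the derivative of P, that is, the product of the negated nonzero values E(b
  / p), the power sums contribute c, and E(z) = (p / c) P(E(z / p)) contributes p / c when 1 / P(x)
  is rewritten in terms of 1 / E(z). The derivative of P is constant because P arises by repeatedly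
  passing from L to L^q - w L with w constant, and q-th powers have derivative 0 in this
  characteristic. That T_p preserves invariance and commutes with W_T has one common reason: the sum
  over representatives of determinant p may be taken over any system of distinct cosets.\<close>

lemma absval_nonneg [simp]: "0 \<le> absval x"
  by (simp add: absval_def)

lemma absval_0 [simp]: "absval 0 = 0"
  by (simp add: absval_def)

lemma absval_eq_0_iff [simp]: "absval x = 0 \<longleftrightarrow> x = 0"
  by (simp add: absval_def)

lemma absval_pos_iff [simp]: "0 < absval x \<longleftrightarrow> x \<noteq> 0"
  by (simp add: absval_def)

lemma absval_mult: "absval (x * y) = absval x * absval y"
  by (simp add: absval_def dist_0_mult)

lemma absval_1 [simp]: "absval 1 = 1"
  using absval_mult[of 1 1] by simp

lemma absval_power: "absval (x ^ n) = absval x ^ n"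
  by (induction n) (auto simp: absval_mult)

lemma absval_prod: "absval (prod f S) = (\<Prod>i\<in>S. absval (f i))"
  by (induction S rule: infinite_finite_induct) (auto simp: absval_mult)

lemma absval_inverse: "absval (inverse x) = inverse (absval x)"
proof (cases "x = 0")
  case False
  then have "absval x * absval (inverse x) = 1"
    by (simp flip: absval_mult)
  then show ?thesis
    by (metis inverse_unique)
qed simp

lemma absval_divide: "absval (x / y) = absval x / absval y"
  by (simp add: divide_inverse absval_mult absval_inverse)

lemma absval_minus_cancel [simp]: "absval (- x) = absval x"
proof -
  have "absval (- 1 :: 'a) ^ 2 = 1"
    by (simp flip: absval_power)
  then have "absval (- 1 :: 'a) = 1"
    using absval_nonneg[of "- 1 :: 'a"] by (simp add: power2_eq_1_iff)
  then show ?thesis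
    using absval_mult[of "- 1" x] by simp
qed

lemma absval_minus_commute: "absval (x - y) = absval (y - x)"
  by (metis absval_minus_cancel minus_diff_eq)

lemma dist_absval: "dist x y = absval (x - y)"
  by (metis absval_def dist_diff)

lemma absval_add: "absval (x + y) \<le> max (absval x) (absval y)"
  by (simp add: absval_def dist_0_add_ultrametric)

lemma absval_diff: "absval (x - y) \<le> max (absval x) (absval y)"
  using absval_add[of x "- y"] by simp

lemma absval_add_eq:
  assumes "absval y < absval x"
  shows "absval (x + y) = absval x"
  using absval_add[of x y] absval_diff[of "x + y" y] assms by auto

lemma absval_diff_eq:
  assumes "absval y < absval x"
  shows "absval (x - y) = absval x"
  using absval_add_eq[of "- y" x] assms by simp

lemma absval_sum_le:
  assumes "\<And>i. i \<in> S \<Longrightarrow> absval (f i) \<le> B" "0 \<le> B"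
  shows "absval (sum f S) \<le> B"
  using assms(1)
proof (induction S rule: infinite_finite_induct)
  case (insert x F)
  then show ?case
    using absval_add[of "f x" "sum f F"] by (auto intro: order_trans)
qed (use assms in auto)

lemma tendsto_absval_iff:
  fixes f :: "'b \<Rightarrow> 'c::complete_ultrametric_field"
  shows "(f \<longlongrightarrow> l) F \<longleftrightarrow> ((\<lambda>x. absval (f x - l)) \<longlongrightarrow> 0) F"
  by (subst tendsto_dist_iff) (simp add: dist_absval)

text \<open>The class provides only a metric and field axioms; this instance and the next give
  access to the general limit and summation rules for sums and products.\<close>

instance complete_ultrametric_field \<subseteq> topological_ab_group_add
proof
  fix a b :: 'a
  have "\<forall>\<^sub>F x in nhds a \<times>\<^sub>F nhds b. dist (fst x + snd x) (a + b) < e" if "e > 0" for e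
  proof -
    have "\<forall>\<^sub>F x in nhds a \<times>\<^sub>F nhds b. dist (fst x) a < e \<and> dist (snd x) b < e"
      unfolding eventually_prod_filter
      using that by (intro exI[of _ "\<lambda>x. dist x a < e"] exI[of _ "\<lambda>x. dist x b < e"])
        (auto simp: eventually_nhds_metric)
    then show ?thesis
    proof eventually_elim
      case (elim x)
      have "absval (fst x + snd x - (a + b)) \<le> max (absval (fst x - a)) (absval (snd x - b))"
        using absval_add[of "fst x - a" "snd x - b"] by (simp add: algebra_simps)
      then show ?case
        using elim by (auto simp: dist_absval)
    qed
  qed
  then show "((\<lambda>x. fst x + snd x) \<longlongrightarrow> a + b) (nhds a \<times>\<^sub>F nhds b)"
    by (auto simp: tendsto_iff)
next
  fix a :: 'a
  have "dist (- x) (- a) = dist x a" for x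
    by (simp add: dist_absval absval_minus_commute)
  then show "(uminus \<longlongrightarrow> - a) (nhds a)"
    by (auto simp: tendsto_iff eventually_nhds_metric)
qed

instance complete_ultrametric_field \<subseteq> topological_comm_monoid_mult
proof
  fix a b :: 'a
  define M where "M = max (absval a) (absval b) + 1"
  have M: "M > 0"
    using absval_nonneg[of a] unfolding M_def by linarith
  have "\<forall>\<^sub>F x in nhds a \<times>\<^sub>F nhds b. dist (fst x * snd x) (a * b) < e" if "e > 0" for e
  proof -
    define d where "d = min 1 (e / M)"
    have d: "d > 0"
      using that M by (auto simp: d_def)
    have "\<forall>\<^sub>F x in nhds a \<times>\<^sub>F nhds b. dist (fst x) a < d \<and> dist (snd x) b < d"
      unfolding eventually_prod_filter
      using d by (intro exI[of _ "\<lambda>x. dist x a < d"] exI[of _ "\<lambda>x. dist x b < d"])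
        (auto simp: eventually_nhds_metric)
    then show ?thesis
    proof eventually_elim
      case (elim x)
      have 1: "absval (fst x - a) < d" "absval (snd x - b) < d"
        using elim by (auto simp: dist_absval)
      have 2: "absval (fst x) \<le> M"
      proof -
        have "absval (fst x) \<le> max (absval (fst x - a)) (absval a)"
          using absval_add[of "fst x - a" a] by simp
        moreover have "absval (fst x - a) < 1"
          using 1 by (simp add: d_def)
        ultimately show ?thesis
          using absval_nonneg[of a] unfolding M_def by linarith
      qed
      have "absval (fst x * (snd x - b)) < e"
      proof -
        have "absval (fst x) * absval (snd x - b) \<le> M * absval (snd x - b)"
          using 2 by (intro mult_right_mono) auto
        also have "\<dots> < e"
          using 1(2) M by (simp add: d_def pos_less_divide_eq mult.commute)
        finally show ?thesis
          by (simp add: absval_mult)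
      qed
      moreover have "absval ((fst x - a) * b) < e"
      proof -
        have "absval (fst x - a) * absval b \<le> absval (fst x - a) * M"
          by (intro mult_left_mono) (auto simp: M_def)
        also have "\<dots> < e"
          using 1(1) M by (simp add: d_def pos_less_divide_eq)
        finally show ?thesis
          by (simp add: absval_mult)
      qed
      moreover have "fst x * snd x - a * b = fst x * (snd x - b) + (fst x - a) * b"
        by (simp add: algebra_simps)
      ultimately show ?case
        using absval_add[of "fst x * (snd x - b)" "(fst x - a) * b"] by (simp add: dist_absval)
    qed
  qed
  then show "((\<lambda>x. fst x * snd x) \<longlongrightarrow> a * b) (nhds a \<times>\<^sub>F nhds b)"
    by (auto simp: tendsto_iff)
qed

text \<open>Within distance less than \<open>absval a\<close> of \<open>a\<close> the absolute value
  is constant, so the error of the inverse is exactly the error of \<open>f\<close> divided by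
  \<open>(absval a)^2\<close>.\<close>

lemma tendsto_inverse_ultrametric:
  fixes a :: "'c::complete_ultrametric_field"
  assumes "(f \<longlongrightarrow> a) F" "a \<noteq> 0"
  shows "((\<lambda>x. inverse (f x)) \<longlongrightarrow> inverse a) F"
proof -
  have "\<forall>\<^sub>F x in F. absval (f x - a) < absval a"
    using assms by (auto simp: tendsto_iff dist_absval)
  then have ev: "\<forall>\<^sub>F x in F. absval (inverse (f x) - inverse a) = absval (f x - a) / (absval a)\<^sup>2"
  proof eventually_elim
    case (elim x)
    have 1: "absval (f x) = absval a"
      using absval_add_eq[OF elim] by simp
    then have "f x \<noteq> 0"
      using assms by (metis absval_eq_0_iff)
    then have "inverse (f x) - inverse a = - ((f x - a) / (f x * a))"
      using assms by (simp add: field_simps)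
    then show ?case
      by (simp add: absval_divide absval_mult 1 power2_eq_square del: minus_divide_left)
  qed
  have "((\<lambda>x. absval (f x - a) / (absval a)\<^sup>2) \<longlongrightarrow> 0 / (absval a)\<^sup>2) F"
    using assms by (intro tendsto_divide) (auto simp: tendsto_absval_iff[symmetric])
  then show ?thesis
    using ev by (simp add: tendsto_absval_iff tendsto_cong)
qed

lemma tendsto_divide_ultrametric:
  fixes a :: "'c::complete_ultrametric_field"
  assumes "(f \<longlongrightarrow> b) F" "(g \<longlongrightarrow> a) F" "a \<noteq> 0"
  shows "((\<lambda>x. f x / g x) \<longlongrightarrow> b / a) F"
  using tendsto_mult[OF assms(1) tendsto_inverse_ultrametric[OF assms(2,3)]]
  by (simp add: divide_inverse)

section \<open>Null sequences and convergent series\<close>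

lemma tendsto_absval:
  fixes a :: "'c::complete_ultrametric_field"
  assumes "(f \<longlongrightarrow> a) F"
  shows "((\<lambda>x. absval (f x)) \<longlongrightarrow> absval a) F"
  unfolding absval_def by (rule tendsto_dist[OF assms tendsto_const])

text \<open>A block of consecutive terms is no larger than its largest term, so null terms already
  make the partial sums Cauchy.\<close>

lemma summable_ultrametric:
  fixes f :: "nat \<Rightarrow> 'c::complete_ultrametric_field"
  assumes "f \<longlonglongrightarrow> 0"
  shows "summable f"
proof -
  have "Cauchy (\<lambda>n. \<Sum>i<n. f i)"
    unfolding metric_Cauchy_iff2 dist_absval
  proof (intro allI)
    fix j :: nat
    \<comment> \<open>One index beyond \<open>Suc j\<close>: \<open>absval_sum_le\<close> yields a
      weak inequality, while the Cauchy criterion asks for a strict one.\<close>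
    obtain M where M: "\<And>n. n \<ge> M \<Longrightarrow> absval (f n) < inverse (real (Suc (Suc j)))"
      using assms LIMSEQ_D[of "\<lambda>n. absval (f n)" 0 "inverse (real (Suc (Suc j)))"]
      by (auto simp: tendsto_absval_iff)
    have *: "absval ((\<Sum>i<n. f i) - (\<Sum>i<m. f i)) < inverse (real (Suc j))" if "M \<le> m" "m \<le> n" for m n
    proof -
      have "(\<Sum>i<n. f i) - (\<Sum>i<m. f i) = (\<Sum>i=m..<n. f i)"
        using that by (simp add: lessThan_atLeast0 sum_diff_nat_ivl)
      also have "absval \<dots> \<le> inverse (real (Suc (Suc j)))"
        using that M by (intro absval_sum_le) (auto simp: less_eq_real_def)
      also have "\<dots> < inverse (real (Suc j))"
        by simp
      finally show ?thesis .
    qed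
    show "\<exists>M. \<forall>m\<ge>M. \<forall>n\<ge>M. absval ((\<Sum>i<m. f i) - (\<Sum>i<n. f i)) < inverse (real (Suc j))"
    proof (intro exI allI impI)
      fix m n assume "M \<le> m" "M \<le> n"
      then show "absval ((\<Sum>i<m. f i) - (\<Sum>i<n. f i)) < inverse (real (Suc j))"
        using *[of m n] *[of n m] by (cases "m \<le> n") (auto simp: absval_minus_commute)
    qed
  qed
  then show ?thesis
    by (simp add: summable_iff_convergent Cauchy_convergent_iff)
qed

lemma sums_mult_ultrametric:
  fixes f :: "nat \<Rightarrow> 'c::complete_ultrametric_field"
  assumes "f sums a"
  shows "(\<lambda>n. c * f n) sums (c * a)"
  using tendsto_mult[OF tendsto_const assms[unfolded sums_def], of c]
  unfolding sums_def sum_distrib_left .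

lemma sums_imp_tendsto_0:
  fixes f :: "nat \<Rightarrow> 'c::complete_ultrametric_field"
  assumes "f sums a"
  shows "f \<longlonglongrightarrow> 0"
proof -
  have "(\<lambda>n. (\<Sum>i<Suc n. f i) - (\<Sum>i<n. f i)) \<longlonglongrightarrow> a - a"
    using assms unfolding sums_def
    by (intro tendsto_diff LIMSEQ_Suc[of "\<lambda>n. \<Sum>i<n. f i"])
  then show ?thesis
    by simp
qed

lemma absval_sums_le:
  fixes f :: "nat \<Rightarrow> 'c::complete_ultrametric_field"
  assumes "f sums a" "\<And>n. absval (f n) \<le> B"
  shows "absval a \<le> B"
proof (rule LIMSEQ_le_const2)
  show "(\<lambda>n. absval (\<Sum>i<n. f i)) \<longlonglongrightarrow> absval a"
    using assms(1) unfolding sums_def by (rule tendsto_absval)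
  show "\<exists>N. \<forall>n\<ge>N. absval (\<Sum>i<n. f i) \<le> B"
    using assms(2) order_trans[OF absval_nonneg assms(2)] by (auto intro!: absval_sum_le)
qed

lemma tendsto_0_absval_comparison:
  fixes f :: "nat \<Rightarrow> 'c::complete_ultrametric_field"
  assumes "g \<longlonglongrightarrow> 0" "\<And>n. absval (f n) \<le> g n"
  shows "f \<longlonglongrightarrow> 0"
  unfolding tendsto_absval_iff
  by (rule tendsto_sandwich[OF _ _ tendsto_const assms(1)]) (use assms(2) in auto)

text \<open>
  The support condition makes every column of the array finite, so that rearranging the double
  series needs no summability in the other variable.
\<close>

lemma sums_swap_ultrametric:
  fixes d :: "nat \<Rightarrow> nat \<Rightarrow> 'c::complete_ultrametric_field"
  assumes supp: "\<And>i j. d i j \<noteq> 0 \<Longrightarrow> i \<le> N * j"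
    and bound: "\<And>i j. absval (d i j) \<le> C * \<theta> ^ j" "0 \<le> \<theta>" "\<theta> < 1" "0 \<le> C"
    and rows: "\<And>i. d i sums s i"
    and total: "s sums g"
  shows "(\<lambda>j. \<Sum>i\<le>N * j. d i j) sums g"
proof -
  define col where "col j = (\<Sum>i\<le>N * j. d i j)" for j
  have geo: "(\<lambda>j. C * \<theta> ^ j) \<longlonglongrightarrow> 0"
    using bound by (auto intro!: tendsto_mult_right_zero LIMSEQ_realpow_zero)
  have col_bound: "absval (col j) \<le> C * \<theta> ^ j" for j
    unfolding col_def using bound by (intro absval_sum_le) auto
  then have "summable col"
    by (intro summable_ultrametric tendsto_0_absval_comparison[OF geo])
  then obtain L where L: "col sums L"
    by (auto simp: summable_def)
  \<comment> \<open>By the support condition the first \<open>N * m + 1\<close> rows contain every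
    nonzero entry of the columns up to \<open>m\<close>, so only later columns contribute to this
    difference.\<close>
  have *: "absval (L - (\<Sum>i<N * m + 1. s i)) \<le> C * \<theta> ^ m" for m
  proof -
    have "(\<lambda>j. col j - (\<Sum>i<N * m + 1. d i j)) sums (L - (\<Sum>i<N * m + 1. s i))"
      unfolding sums_def sum_subtractf
      using L sums_sum[of "{..<N * m + 1}" d s] rows unfolding sums_def by (intro tendsto_diff) auto
    moreover have "absval (col j - (\<Sum>i<N * m + 1. d i j)) \<le> C * \<theta> ^ m" for j
    proof (cases "j \<le> m")
      case True
      then have "(\<Sum>i<N * m + 1. d i j) = col j"
        unfolding col_def using supp[of _ j] order_trans[OF _ mult_le_mono2[OF True, of N]]
        by (intro sum.mono_neutral_right) (auto simp: less_Suc_eq_le)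
      then show ?thesis
        using bound by simp
    next
      case False
      have "absval (col j - (\<Sum>i<N * m + 1. d i j)) \<le> max (absval (col j)) (absval (\<Sum>i<N * m + 1. d i j))"
        by (rule absval_diff)
      also have "\<dots> \<le> C * \<theta> ^ j"
        using bound by (intro max.boundedI absval_sum_le col_bound) auto
      also have "\<dots> \<le> C * \<theta> ^ m"
        using False bound by (intro mult_left_mono power_decreasing) auto
      finally show ?thesis .
    qed
    ultimately show ?thesis
      by (rule absval_sums_le)
  qed
  have "(\<lambda>m. L - (\<Sum>i<N * m + 1. s i)) \<longlonglongrightarrow> 0"
    using tendsto_0_absval_comparison[OF geo *] .
  then have "(\<lambda>m. L - (L - (\<Sum>i<N * m + 1. s i))) \<longlonglongrightarrow> L - 0"
    by (intro tendsto_intros)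
  then have 1: "(\<lambda>m. \<Sum>i<N * m + 1. s i) \<longlonglongrightarrow> L"
    by simp
  show ?thesis
  proof (cases "N = 0")
    \<comment> \<open>For \<open>N = 0\<close> the row counts \<open>N * m + 1\<close> do not tend
      to infinity, but the support condition then leaves row 0 alone.\<close>
    case True
    then have "s i = 0" if "i > 0" for i
    proof -
      have "d i = (\<lambda>j. 0)"
        using supp[of i] that True by force
      then show ?thesis
        using rows[of i] sums_unique2[OF _ sums_zero] by metis
    qed
    then have "s sums (\<Sum>i\<in>{0}. s i)"
      by (intro sums_finite) auto
    then have "g = s 0"
      using total sums_unique2 by fastforce
    moreover have "L = s 0"
      using 1 True by (simp add: LIMSEQ_const_iff)
    ultimately show ?thesis
      using L by (simp add: col_def[abs_def])
  next
    case False
    then have "m \<le> N * m + 1" for m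
      by (cases N) auto
    then have "filterlim (\<lambda>m. N * m + 1) at_top sequentially"
      by (intro filterlim_at_top_mono[OF filterlim_ident always_eventually]) simp
    from filterlim_compose[OF total[unfolded sums_def] this]
    have "(\<lambda>m. \<Sum>i<N * m + 1. s i) \<longlonglongrightarrow> g" .
    then have "g = L"
      using 1 LIMSEQ_unique by blast
    then show ?thesis
      using L by (simp add: col_def[abs_def])
  qed
qed

section \<open>Substitutions in power series over ultrametric fields\<close>

text \<open>A quantitative form of convergence on \<open>M * absval t < 1\<close>. The ultrametric
  inequality keeps \<open>M\<close> unchanged under products; only the constants \<open>C\<close>
  multiply.\<close>

definition geom_bounded :: "real \<Rightarrow> real \<Rightarrow> 'c::complete_ultrametric_field fps \<Rightarrow> bool" where
  "geom_bounded C M f \<longleftrightarrow> (\<forall>n. absval (fps_nth f n) \<le> C * M ^ n)"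

definition fps_value :: "'c::complete_ultrametric_field fps \<Rightarrow> 'c \<Rightarrow> 'c" where
  "fps_value f t = (\<Sum>n. fps_nth f n * t ^ n)"

lemma geom_boundedD: "geom_bounded C M f \<Longrightarrow> absval (fps_nth f n) \<le> C * M ^ n"
  by (simp add: geom_bounded_def)

lemma geom_bounded_nonneg: "geom_bounded C M f \<Longrightarrow> 0 \<le> C"
  using order_trans[OF absval_nonneg geom_boundedD, of C M f 0] by simp

lemma geom_bounded_mono:
  assumes "geom_bounded C M f" "C \<le> C'" "M \<le> M'" "0 \<le> M"
  shows "geom_bounded C' M' f"
  unfolding geom_bounded_def
proof
  fix n
  have "C * M ^ n \<le> C' * M' ^ n"
    using assms geom_bounded_nonneg[OF assms(1)] by (intro mult_mono power_mono) auto
  then show "absval (fps_nth f n) \<le> C' * M' ^ n"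
    using geom_boundedD[OF assms(1), of n] by linarith
qed

lemma geom_bounded_sums:
  assumes "geom_bounded C M f" "0 \<le> M" "M * absval t < 1"
  shows "(\<lambda>n. fps_nth f n * t ^ n) sums fps_value f t"
  unfolding fps_value_def
proof (rule summable_sums, rule summable_ultrametric, rule tendsto_0_absval_comparison)
  show "(\<lambda>n. C * (M * absval t) ^ n) \<longlonglongrightarrow> 0"
    using assms by (intro tendsto_mult_right_zero LIMSEQ_realpow_zero) auto
  show "absval (fps_nth f n * t ^ n) \<le> C * (M * absval t) ^ n" for n
    using mult_right_mono[OF geom_boundedD[OF assms(1), of n], of "absval t ^ n"]
    by (simp add: absval_mult absval_power power_mult_distrib mult_ac)
qed

lemma geom_bounded_1: "0 \<le> M \<Longrightarrow> geom_bounded 1 M 1"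
  by (simp add: geom_bounded_def)

lemma geom_bounded_mult:
  assumes f: "geom_bounded C M f" and g: "geom_bounded D M g" and M: "0 \<le> M"
  shows "geom_bounded (C * D) M (f * g)"
  unfolding geom_bounded_def fps_mult_nth
proof (intro allI absval_sum_le)
  note nonneg = geom_bounded_nonneg[OF f] geom_bounded_nonneg[OF g]
  fix n i :: nat
  assume i: "i \<in> {0..n}"
  have "absval (fps_nth f i) * absval (fps_nth g (n - i)) \<le> (C * M ^ i) * (D * M ^ (n - i))"
    using nonneg M by (intro mult_mono geom_boundedD[OF f] geom_boundedD[OF g]) auto
  also have "\<dots> = C * D * (M ^ i * M ^ (n - i))"
    by simp
  also have "\<dots> = C * D * M ^ n"
    using i by (simp flip: power_add)
  finally show "absval (fps_nth f i * fps_nth g (n - i)) \<le> C * D * M ^ n"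
    by (simp add: absval_mult)
next
  show "0 \<le> C * D * M ^ n" for n
    using geom_bounded_nonneg[OF f] geom_bounded_nonneg[OF g] M by simp
qed

lemma geom_bounded_power:
  assumes "geom_bounded C M f" "0 \<le> M"
  shows "geom_bounded (C ^ n) M (f ^ n)"
  using assms by (induction n) (auto intro: geom_bounded_1 geom_bounded_mult)

text \<open>In the array with entry \<open>f_i g_(j-i) t^j\<close> the rows sum to
  \<open>f_i t^i\<close> times the value of \<open>g\<close>, and the columns are the terms of the
  Cauchy product.\<close>

lemma fps_value_mult:
  assumes f: "geom_bounded C M f" and g: "geom_bounded D M g" and M: "0 \<le> M" "M * absval t < 1"
  shows "fps_value (f * g) t = fps_value f t * fps_value g t"
proof -
  define d where "d i j = (if i \<le> j then fps_nth f i * fps_nth g (j - i) * t ^ j else 0)" for i j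
  have "(\<lambda>j. \<Sum>i\<le>1 * j. d i j) sums (fps_value f t * fps_value g t)"
  proof (rule sums_swap_ultrametric)
    show "d i j \<noteq> 0 \<Longrightarrow> i \<le> 1 * j" for i j
      by (auto simp: d_def split: if_splits)
    show "absval (d i j) \<le> C * D * (M * absval t) ^ j" for i j
    proof (cases "i \<le> j")
      case True
      have "absval (fps_nth f i) * absval (fps_nth g (j - i)) \<le> (C * M ^ i) * (D * M ^ (j - i))"
        using geom_bounded_nonneg[OF f] geom_bounded_nonneg[OF g] M
        by (intro mult_mono geom_boundedD[OF f] geom_boundedD[OF g]) auto
      also have "\<dots> = C * D * (M ^ i * M ^ (j - i))"
        by simp
      also have "\<dots> = C * D * M ^ j"
        using True by (simp flip: power_add)
      finally show ?thesis
        using True by (simp add: d_def absval_mult absval_power power_mult_distrib mult_right_mono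
            flip: mult.assoc)
    next
      case False
      then show ?thesis
        using geom_bounded_nonneg[OF f] geom_bounded_nonneg[OF g] M by (simp add: d_def)
    qed
    show "d i sums (fps_nth f i * t ^ i * fps_value g t)" for i
    proof -
      have "(\<lambda>j. d i (j + i)) sums (fps_nth f i * t ^ i * fps_value g t)"
        using sums_mult_ultrametric[OF geom_bounded_sums[OF g M], of "fps_nth f i * t ^ i"]
        by (simp add: d_def power_add mult_ac)
      moreover have "(\<Sum>j<n + i. d i j) = (\<Sum>j<n. d i (j + i))" for n
        by (induction n) (auto simp: d_def)
      ultimately show ?thesis
        unfolding sums_def by - (rule LIMSEQ_offset[of _ i], simp)
    qed
    show "(\<lambda>i. fps_nth f i * t ^ i * fps_value g t) sums (fps_value f t * fps_value g t)"
      using sums_mult_ultrametric[OF geom_bounded_sums[OF f M], of "fps_value g t"]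
      by (simp add: mult_ac)
  qed (use M geom_bounded_nonneg[OF f] geom_bounded_nonneg[OF g] in auto)
  moreover have "(\<Sum>i\<le>1 * j. d i j) = fps_nth (f * g) j * t ^ j" for j
    by (simp add: d_def fps_mult_nth sum_distrib_right atLeast0AtMost)
  ultimately have "(\<lambda>j. fps_nth (f * g) j * t ^ j) sums (fps_value f t * fps_value g t)"
    by simp
  then show ?thesis
    unfolding fps_value_def[of "f * g"] by (rule sums_unique[symmetric])
qed

lemma fps_value_1 [simp]: "fps_value 1 t = 1"
proof -
  have "(\<lambda>n. fps_nth 1 n * t ^ n) sums (\<Sum>n\<in>{0}. fps_nth 1 n * t ^ n)"
    by (intro sums_finite) auto
  then show ?thesis
    by (simp add: fps_value_def sums_iff)
qed

lemma fps_value_power: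
  assumes "geom_bounded C M f" "0 \<le> M" "M * absval t < 1"
  shows "fps_value (f ^ n) t = fps_value f t ^ n"
  by (induction n) (auto simp: fps_value_mult[OF assms(1) geom_bounded_power[OF assms(1,2)] assms(2,3)])

lemma fps_value_of_poly: "fps_value (fps_of_poly p) t = poly p t"
proof -
  have "(\<lambda>n. coeff p n * t ^ n) sums (\<Sum>n\<le>degree p. coeff p n * t ^ n)"
    by (intro sums_finite) (auto simp: coeff_eq_0)
  then show ?thesis
    by (simp add: fps_value_def sums_iff poly_altdef)
qed

text \<open>The constant of the bound must be exactly the absolute value of the constant term: then
  the recursion for the coefficients of the inverse divides out precisely what it multiplies in, and
  no factor accumulates.\<close>

lemma geom_bounded_inverse:
  assumes f: "geom_bounded (absval (fps_nth f 0)) M f" and M: "0 \<le> M" and f0: "fps_nth f 0 \<noteq> 0"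
  shows "geom_bounded (1 / absval (fps_nth f 0)) M (inverse f)"
proof -
  define C where "C = absval (fps_nth f 0)"
  define g where "g = inverse f"
  have C: "C > 0"
    using f0 by (simp add: C_def)
  have fg: "f * g = 1"
    using f0 inverse_mult_eq_1'[of f] by (simp add: g_def)
  have "absval (fps_nth g n) \<le> 1 / C * M ^ n" for n
  proof (induction n rule: less_induct)
    case (less n)
    show ?case
    proof (cases "n = 0")
      case True
      then show ?thesis
        by (simp add: g_def C_def absval_inverse divide_inverse)
    next
      case False
      have "0 = fps_nth (f * g) n"
        using fg False by simp
      also have "\<dots> = fps_nth f 0 * fps_nth g n + (\<Sum>i = 1..n. fps_nth f i * fps_nth g (n - i))"
        by (simp add: fps_mult_nth sum.atLeast_Suc_atMost)
      finally have "C * absval (fps_nth g n) = absval (\<Sum>i = 1..n. fps_nth f i * fps_nth g (n - i))"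
        by (metis C_def absval_minus_cancel absval_mult add_eq_0_iff2)
      also have "\<dots> \<le> M ^ n"
      proof (rule absval_sum_le)
        fix i assume i: "i \<in> {1..n}"
        have "absval (fps_nth f i) * absval (fps_nth g (n - i)) \<le> (C * M ^ i) * (1 / C * M ^ (n - i))"
          using i C M less by (intro mult_mono geom_boundedD[OF f, folded C_def]) auto
        also have "\<dots> = M ^ n"
          using C i by (simp flip: power_add)
        finally show "absval (fps_nth f i * fps_nth g (n - i)) \<le> M ^ n"
          by (simp add: absval_mult)
      qed (use M in auto)
      finally show ?thesis
        using C by (simp add: field_simps)
    qed
  qed
  then show ?thesis
    by (simp add: geom_bounded_def C_def g_def)
qed

text \<open>Everything is absorbed into \<open>M\<close>, so that the constant has the exact form
  required by \<open>geom_bounded_inverse\<close>.\<close>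

lemma geom_bounded_of_poly:
  assumes "coeff p 0 \<noteq> (0::'c::complete_ultrametric_field)"
  obtains M where "1 \<le> M" "geom_bounded (absval (coeff p 0)) M (fps_of_poly p)"
proof -
  define C where "C = absval (coeff p 0)"
  define M where "M = Max (insert 1 ((\<lambda>n. absval (coeff p n) / C) ` {..degree p}))"
  have C: "C > 0"
    using assms by (simp add: C_def)
  have M1: "1 \<le> M"
    unfolding M_def by (intro Max_ge) auto
  have "absval (coeff p n) \<le> C * M ^ n" for n
  proof (cases "n \<le> degree p \<and> n \<noteq> 0")
    case True
    have "absval (coeff p n) / C \<le> M"
      unfolding M_def using True by (intro Max_ge) auto
    also have "M ^ 1 \<le> M ^ n"
      using True M1 by (intro power_increasing) auto
    finally show ?thesis
      using C by (simp add: field_simps)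
  next
    case False
    then show ?thesis
      using C M1 by (cases "n = 0") (auto simp: C_def coeff_eq_0)
  qed
  then show ?thesis
    using M1 by (intro that[of M]) (auto simp: geom_bounded_def C_def)
qed

text \<open>With t = 1 / x and n the degree of Q, 1 / Q(x) equals t^n divided by the reversed
  polynomial at t, a power series in t that starts in degree n. Inserting it and rearranging gives
  coefficients that do not depend on x.\<close>

lemma sums_subst_inverse_poly:
  fixes Q :: "'c::complete_ultrametric_field poly"
  assumes a: "\<And>i. absval (a i) \<le> B * \<rho> ^ i" "0 \<le> \<rho>"
    and Q: "0 < degree Q" and a0: "a 0 = 0" and a1: "a 1 = 0 \<or> 2 \<le> degree Q"
  shows "\<exists>b r. 0 < r \<and> b 0 = 0 \<and> b 1 = 0 \<and>
    (\<forall>x g. absval x > r \<longrightarrow> (\<lambda>i. a i * (1 / poly Q x) ^ i) sums g \<longrightarrow>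
       (\<lambda>j. b j * (1 / x) ^ j) sums g)"
proof -
  define n where "n = degree Q"
  define u where "u = fps_of_poly (reflect_poly Q)"
  have u0: "fps_nth u 0 = lead_coeff Q" "fps_nth u 0 \<noteq> 0"
    using Q by (auto simp: u_def)
  obtain M where M: "1 \<le> M" "geom_bounded (absval (fps_nth u 0)) M u"
    using geom_bounded_of_poly[of "reflect_poly Q"] Q by (force simp: u_def)
  define K where "K = max 1 (1 / absval (fps_nth u 0))"
  have inv_u: "geom_bounded K M (inverse u)"
    using geom_bounded_mono[OF geom_bounded_inverse[OF M(2)]] M(1) u0 by (auto simp: K_def)
  have Xn: "geom_bounded 1 M (fps_X ^ n)"
    using M(1) by (simp add: geom_bounded_def fps_X_power_nth)
  define \<phi> where "\<phi> = fps_X ^ n * inverse u"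
  have phi: "geom_bounded K M \<phi>"
    using geom_bounded_mult[OF Xn inv_u] M by (simp add: \<phi>_def)
  \<comment> \<open>Vanishing to order \<open>n * i\<close> is the support condition of the
    rearrangement; it also makes each new coefficient a finite sum.\<close>
  have phi_nth: "fps_nth (\<phi> ^ i) j = 0" if "j < n * i" for i j
    using that by (simp add: \<phi>_def power_mult_distrib fps_X_power_mult_nth flip: power_mult)
  \<comment> \<open>The bases \<open>\<rho>'\<close>, \<open>K\<close> and \<open>M\<close> are at
    least 1, so that for \<open>i \<le> j\<close> the exponents \<open>i\<close> may be raised to
    \<open>j\<close>; the three factors then combine into \<open>r ^ j\<close>.\<close>
  define \<rho>' where "\<rho>' = max 1 \<rho>"
  define r where "r = \<rho>' * K * M"
  have ge1: "1 \<le> \<rho>'" "1 \<le> K"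
    by (auto simp: \<rho>'_def K_def)
  have r1: "M \<le> r"
    using mult_mono[OF mult_mono[OF ge1], of M M] M(1) ge1 by (simp add: r_def)
  have B: "0 \<le> B"
    using order_trans[OF absval_nonneg a(1)[of 0]] by simp
  define b where "b j = (\<Sum>i\<le>1 * j. a i * fps_nth (\<phi> ^ i) j)" for j
  show ?thesis
  proof (intro exI[of _ b] exI[of _ r] conjI allI impI)
    show "0 < r"
      using r1 M(1) by simp
    show "b 0 = 0"
      using a0 by (simp add: b_def)
    \<comment> \<open>If the degree of \<open>Q\<close> is at least 2, \<open>\<phi>\<close> has no
      linear term; otherwise \<open>a 1\<close> vanishes.\<close>
    have "a 1 * fps_nth \<phi> 1 = 0"
      using a1 phi_nth[of 1 1] by (auto simp: n_def)
    then show "b 1 = 0"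
      using a0 by (simp add: b_def atMost_Suc)
    fix x g
    assume x: "absval x > r" and g: "(\<lambda>i. a i * (1 / poly Q x) ^ i) sums g"
    define t where "t = 1 / x"
    have x0: "x \<noteq> 0"
      using x r1 M(1) by auto
    have t: "absval t = 1 / absval x"
      by (simp add: t_def absval_divide)
    have x_pos: "0 < absval x"
      using x0 by simp
    have Mt: "M * absval t < 1"
      using x r1 x_pos by (simp add: t divide_less_eq)
    have "fps_value u t = t ^ n * poly Q x"
      using poly_reflect_poly_nz[of t Q] x0 by (simp add: t_def n_def u_def fps_value_of_poly)
    moreover have "t ^ n * x ^ n = 1"
      using x0 by (simp add: t_def flip: power_mult_distrib)
    ultimately have value_u: "fps_value u t * x ^ n = poly Q x"
      by (metis mult.assoc mult.commute mult_1)
    have inv: "fps_value u t * fps_value (inverse u) t = 1"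
      using fps_value_mult[OF M(2) inv_u _ Mt] M(1) u0 by (simp add: inverse_mult_eq_1')
    then have "fps_value u t \<noteq> 0"
      by auto
    then have "fps_value (inverse u) t = x ^ n / poly Q x"
      using inv x0 by (simp add: value_u[symmetric] field_simps)
    moreover have "fps_value (fps_X ^ n) t = t ^ n"
      using fps_value_of_poly[of "monom 1 n" t] by (simp add: fps_of_poly_monom' poly_monom)
    ultimately have value_phi: "fps_value \<phi> t = 1 / poly Q x"
      using fps_value_mult[OF Xn inv_u _ Mt] M(1) x0 by (simp add: \<phi>_def t_def power_divide)
    have "(\<lambda>j. \<Sum>i\<le>1 * j. a i * (fps_nth (\<phi> ^ i) j * t ^ j)) sums g"
    proof (rule sums_swap_ultrametric)
      show i_le: "i \<le> 1 * j" if "a i * (fps_nth (\<phi> ^ i) j * t ^ j) \<noteq> 0" for i j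
      proof (rule ccontr)
        assume "\<not> i \<le> 1 * j"
        moreover have "1 * i \<le> n * i"
          using Q unfolding n_def by (intro mult_le_mono1) simp
        ultimately have "j < n * i"
          by linarith
        then show False
          using that phi_nth by simp
      qed
      show "absval (a i * (fps_nth (\<phi> ^ i) j * t ^ j)) \<le> B * (r * absval t) ^ j" for i j
      proof (cases "a i * (fps_nth (\<phi> ^ i) j * t ^ j) = 0")
        case True
        then show ?thesis
          using B r1 M(1) by (simp only: absval_0) simp
      next
        case False
        have "absval (a i) \<le> B * \<rho> ^ i"
          by (rule a)
        also have "B * \<rho> ^ i \<le> B * \<rho>' ^ i"
          using B a by (intro mult_left_mono power_mono) (auto simp: \<rho>'_def)
        also have "\<dots> \<le> B * \<rho>' ^ j"
          using i_le[OF False] ge1 B by (intro mult_left_mono power_increasing) auto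
        finally have 1: "absval (a i) \<le> B * \<rho>' ^ j" .
        have "absval (fps_nth (\<phi> ^ i) j) \<le> K ^ i * M ^ j"
          using geom_boundedD[OF geom_bounded_power[OF phi]] M by simp
        also have "\<dots> \<le> K ^ j * M ^ j"
          using i_le[OF False] ge1 M by (intro mult_right_mono power_increasing) auto
        finally have 2: "absval (fps_nth (\<phi> ^ i) j) \<le> K ^ j * M ^ j" .
        have "absval (a i) * absval (fps_nth (\<phi> ^ i) j) \<le> (B * \<rho>' ^ j) * (K ^ j * M ^ j)"
          using 1 2 B ge1 by (intro mult_mono) auto
        from mult_right_mono[OF this, of "absval t ^ j"]
        show ?thesis
          by (simp add: absval_mult absval_power r_def power_mult_distrib mult_ac)
      qed
      show "(\<lambda>j. a i * (fps_nth (\<phi> ^ i) j * t ^ j)) sums (a i * (1 / poly Q x) ^ i)" for i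
        using sums_mult_ultrametric[OF geom_bounded_sums[OF geom_bounded_power[OF phi, of i] _ Mt]]
          fps_value_power[OF phi _ Mt, of i] M(1) value_phi
        by (simp add: mult_ac)
      show "r * absval t < 1"
        using x x_pos by (simp add: t divide_less_eq)
    qed (use B r1 M g in auto)
    then show "(\<lambda>j. b j * (1 / x) ^ j) sums g"
      by (simp add: b_def t_def sum_distrib_right mult.assoc)
  qed
qed

section \<open>Power sums of inverse roots\<close>

lemma inverse_const_minus_X_nth:
  fixes y :: "'c::field"
  assumes "y \<noteq> 0"
  shows "fps_nth (inverse (fps_const y - fps_X)) n = 1 / y ^ Suc n"
proof -
  have "(fps_const y - fps_X) * Abs_fps (\<lambda>n. 1 / y ^ Suc n) = 1"
  proof (rule fps_ext)
    show "fps_nth ((fps_const y - fps_X) * Abs_fps (\<lambda>n. 1 / y ^ Suc n)) n = fps_nth 1 n" for n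
      by (cases n) (use assms in \<open>simp_all add: left_diff_distrib fps_X_mult_nth\<close>)
  qed
  then have "inverse (fps_const y - fps_X) = Abs_fps (\<lambda>n. 1 / y ^ Suc n)"
    using fps_inverse_unique by blast
  then show ?thesis
    by simp
qed

text \<open>
  The generating function of the power sums of the \<open>1 / y b\<close> is the logarithmic derivative of
  \<open>\<Prod>b. y b - X\<close>, and the numerator of the latter is constant.
\<close>

lemma power_sum_inverse:
  fixes y :: "'b \<Rightarrow> 'c::field" and P :: "'c fps"
  assumes prod: "(\<Prod>b\<in>W. fps_const (y b) - fps_X) = fps_const s - P"
    and W: "finite W" "\<And>b. b \<in> W \<Longrightarrow> y b \<noteq> 0"
    and P: "fps_nth P 0 = 0" "fps_deriv P = fps_const c" and s: "s \<noteq> 0"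
  shows "(\<Sum>b\<in>W. 1 / y b ^ Suc m) = (\<Sum>n\<le>m. c * fps_nth (P ^ n) m * (1 / s) ^ Suc n)"
proof -
  define D where "D = fps_const s - P"
  have D0: "fps_nth D 0 \<noteq> 0"
    using s P by (simp add: D_def)
  have yX: "inverse (fps_const (y b) - fps_X) * (fps_const (y b) - fps_X) = 1" if "b \<in> W" for b
    using W(2)[OF that] by (intro inverse_mult_eq_1) simp
  have "fps_const c = - fps_deriv D"
    by (simp add: D_def P)
  also have "\<dots> = (\<Sum>b\<in>W. \<Prod>b'\<in>W - {b}. fps_const (y b') - fps_X)"
    unfolding D_def prod[symmetric] using W(1)
  proof (induction W rule: finite_induct)
    case (insert x F)
    have "(\<Sum>b\<in>F. \<Prod>b'\<in>insert x F - {b}. fps_const (y b') - fps_X) =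
        (\<Sum>b\<in>F. (fps_const (y x) - fps_X) * (\<Prod>b'\<in>F - {b}. fps_const (y b') - fps_X))"
    proof (rule sum.cong)
      fix b assume "b \<in> F"
      then have "insert x F - {b} = insert x (F - {b})"
        using insert by auto
      then show "(\<Prod>b'\<in>insert x F - {b}. fps_const (y b') - fps_X) =
          (fps_const (y x) - fps_X) * (\<Prod>b'\<in>F - {b}. fps_const (y b') - fps_X)"
        using insert by simp
    qed simp
    also have "\<dots> = (fps_const (y x) - fps_X) * - fps_deriv (\<Prod>b\<in>F. fps_const (y b) - fps_X)"
      by (simp only: insert.IH sum_distrib_left)
    finally show ?case
      using insert.hyps by simp
  qed simp
  also have "\<dots> = (\<Sum>b\<in>W. inverse (fps_const (y b) - fps_X) * D)"
  proof (rule sum.cong)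
    fix b assume b: "b \<in> W"
    have "D = (fps_const (y b) - fps_X) * (\<Prod>b'\<in>W - {b}. fps_const (y b') - fps_X)"
      unfolding D_def prod[symmetric] using b W(1) by (simp add: prod.remove)
    then show "(\<Prod>b'\<in>W - {b}. fps_const (y b') - fps_X) = inverse (fps_const (y b) - fps_X) * D"
      using yX[OF b] by (simp flip: mult.assoc)
  qed simp
  finally have "fps_const c = (\<Sum>b\<in>W. inverse (fps_const (y b) - fps_X)) * D"
    by (simp add: sum_distrib_right)
  then have lhs: "(\<Sum>b\<in>W. inverse (fps_const (y b) - fps_X)) = fps_const c * inverse D"
    using inverse_mult_eq_1'[OF D0] by (simp add: mult.assoc)
  \<comment> \<open>The inverse of \<open>s - P\<close> is a geometric series in
    \<open>R = P / s\<close>. Truncation after \<open>R ^ m\<close> does not affect the coefficient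
    \<open>m\<close>, because \<open>R\<close> has no constant term.\<close>
  define \<sigma> where "\<sigma> = 1 / s"
  define R where "R = fps_const \<sigma> * P"
  define G where "G = (\<Sum>n\<le>m. fps_const \<sigma> * R ^ n)"
  have "D * fps_const \<sigma> = 1 - R"
    using s by (simp add: D_def \<sigma>_def R_def algebra_simps flip: fps_const_mult)
  then have "D * G = (1 - R) * (\<Sum>n<Suc m. R ^ n)"
    by (simp add: G_def lessThan_Suc_atMost sum_distrib_left flip: mult.assoc)
  also have "\<dots> = 1 - R ^ Suc m"
    by (simp only: one_diff_power_eq)
  finally have "inverse D * (D * G) = inverse D - inverse D * R ^ Suc m"
    by (simp only: right_diff_distrib mult_1_right)
  moreover have "inverse D * (D * G) = G"
    using inverse_mult_eq_1[OF D0] by (metis mult.assoc mult_1)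
  ultimately have "inverse D = G + inverse D * R ^ Suc m"
    by (simp only: eq_diff_eq)
  moreover have "fps_nth (inverse D * R ^ Suc m) m = 0"
  proof -
    have "fps_nth (R ^ Suc m) j = 0" if "j \<le> m" for j
      using that startsby_zero_power_prefix[of R "Suc m"] P(1) by (auto simp: R_def)
    then show ?thesis
      by (simp add: fps_mult_nth del: power_Suc)
  qed
  ultimately have "fps_nth (inverse D) m = fps_nth G m"
    by (metis add.right_neutral fps_add_nth)
  also have "\<dots> = (\<Sum>n\<le>m. fps_nth (P ^ n) m * (1 / s) ^ Suc n)"
    by (simp add: G_def R_def fps_sum_nth power_mult_distrib \<sigma>_def mult_ac fps_const_power)
  finally have rhs: "fps_nth (inverse D) m = (\<Sum>n\<le>m. fps_nth (P ^ n) m * (1 / s) ^ Suc n)" .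
  have "(\<Sum>b\<in>W. 1 / y b ^ Suc m) = fps_nth (\<Sum>b\<in>W. inverse (fps_const (y b) - fps_X)) m"
    using W(2) by (simp add: fps_sum_nth inverse_const_minus_X_nth)
  also have "\<dots> = c * fps_nth (inverse D) m"
    by (simp add: lhs)
  finally show ?thesis
    by (simp add: rhs sum_distrib_left mult_ac)
qed

lemma fps_nth_power_eq_0:
  assumes "\<And>k. k > N \<Longrightarrow> fps_nth f k = 0" "k > N * n"
  shows "fps_nth (f ^ n) k = 0"
  using assms(2)
proof (induction n arbitrary: k)
  case (Suc n)
  have "fps_nth f i * fps_nth (f ^ n) (k - i) = 0" if "i \<le> k" for i
    using that assms(1)[of i] Suc.IH[of "k - i"] Suc.prems by (cases "i > N") auto
  then show ?case
    by (simp add: fps_mult_nth)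
qed simp

text \<open>By \<open>power_sum_inverse\<close> the coefficient of \<open>(1 / s)^j\<close> in the
  i-th power sum is c times the coefficient of X^(i-1) in P^(j-1). For j = 1 this is nonzero at most
  for i = 1, whence \<open>b 1 = c * a 1\<close>. Neither \<open>b\<close> nor \<open>r\<close>
  depends on the roots \<open>y\<close> or on \<open>s\<close>.\<close>

lemma sums_subst_power_sum:
  fixes P :: "'c::complete_ultrametric_field fps"
  assumes a: "\<And>i. absval (a i) \<le> B * \<rho> ^ i" "0 \<le> \<rho>" "a 0 = 0"
    and P: "fps_nth P 0 = 0" "fps_deriv P = fps_const c" "\<And>k. k > N \<Longrightarrow> fps_nth P k = 0"
  shows "\<exists>b r. 0 < r \<and> b 0 = 0 \<and> b 1 = c * a 1 \<and>
    (\<forall>(W :: 'b set) y s g. finite W \<longrightarrow> (\<forall>w\<in>W. y w \<noteq> 0) \<longrightarrow>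
       (\<Prod>w\<in>W. fps_const (y w) - fps_X) = fps_const s - P \<longrightarrow> absval s > r \<longrightarrow>
       (\<lambda>i. a i * (\<Sum>w\<in>W. 1 / y w ^ i)) sums g \<longrightarrow> (\<lambda>j. b j * (1 / s) ^ j) sums g)"
proof -
  define M where "M = Max (insert 1 ((\<lambda>k. absval (fps_nth P k)) ` {..N}))"
  have M1: "1 \<le> M"
    unfolding M_def by (intro Max_ge) auto
  have "absval (fps_nth P k) \<le> M" for k
  proof (cases "k \<le> N")
    case True
    then show ?thesis
      unfolding M_def by (intro Max_ge) auto
  qed (use P M1 in auto)
  then have P_bound: "geom_bounded M 1 P"
    by (simp add: geom_bounded_def)
  define \<rho>' where "\<rho>' = max 1 \<rho>"
  \<comment> \<open>A nonzero entry has i - 1 at most N (j - 1); \<open>Suc N\<close> turns this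
    into \<open>i \<le> N' * j\<close>, also for \<open>N = 0\<close>.\<close>
  define N' where "N' = Suc N"
  define r where "r = \<rho>' ^ N' * M"
  have ge1: "1 \<le> \<rho>'" "1 \<le> \<rho>' ^ N'"
    by (auto simp: \<rho>'_def one_le_power)
  have r: "1 \<le> r"
    using mult_mono[OF ge1(2) M1] ge1 by (simp add: r_def)
  have B: "0 \<le> B"
    using order_trans[OF absval_nonneg a(1)[of 0]] by simp
  \<comment> \<open>Column 0 is empty since every power sum of positive index starts with
    \<open>1 / s\<close>; row 0 may be set to zero since \<open>a 0 = 0\<close>. The truncated
    subtractions then occur only at positive arguments.\<close>
  define e where "e i j = (if i = 0 \<or> j = 0 then 0 else c * fps_nth (P ^ (j - 1)) (i - 1))" for i j
  define b where "b j = (\<Sum>i\<le>N' * j. a i * e i j)" for j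
  show ?thesis
  proof (intro exI[of _ b] exI[of _ r] conjI allI impI)
    show "0 < r"
      using r by simp
    show "b 0 = 0"
      by (simp add: b_def e_def)
    have "b 1 = (\<Sum>i\<in>{1}. a i * e i 1)"
      unfolding b_def by (intro sum.mono_neutral_right) (auto simp: e_def N'_def)
    then show "b 1 = c * a 1"
      by (simp add: e_def)
    fix W :: "'b set" and y s g
    assume W: "finite W" "\<forall>w\<in>W. y w \<noteq> 0"
      and prod: "(\<Prod>w\<in>W. fps_const (y w) - fps_X) = fps_const s - P"
      and s: "absval s > r" and g: "(\<lambda>i. a i * (\<Sum>w\<in>W. 1 / y w ^ i)) sums g"
    define t where "t = 1 / s"
    have s0: "s \<noteq> 0"
      using s r by auto
    have t: "absval t = 1 / absval s"
      by (simp add: t_def absval_divide)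
    have "(\<lambda>j. \<Sum>i\<le>N' * j. a i * (e i j * t ^ j)) sums g"
    proof (rule sums_swap_ultrametric)
      show i_le: "i \<le> N' * j" if "a i * (e i j * t ^ j) \<noteq> 0" for i j
      proof (rule ccontr)
        assume "\<not> i \<le> N' * j"
        then have "i - 1 > N * (j - 1)" if "j > 0"
          using that by (cases j) (auto simp: N'_def)
        then show False
          using that fps_nth_power_eq_0[OF P(3), where k = "i - 1" and n = "j - 1"] by (auto simp: e_def split: if_splits)
      qed
      show "absval (a i * (e i j * t ^ j)) \<le> B * absval c * (r * absval t) ^ j" for i j
      proof (cases "a i * (e i j * t ^ j) = 0")
        case True
        then show ?thesis
          using B r by (simp only: absval_0) simp
      next
        case False
        have "absval (a i) \<le> B * \<rho> ^ i"
          by (rule a)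
        also have "B * \<rho> ^ i \<le> B * \<rho>' ^ i"
          using B a by (intro mult_left_mono power_mono) (auto simp: \<rho>'_def)
        also have "\<dots> \<le> B * \<rho>' ^ (N' * j)"
          using i_le[OF False] ge1 B by (intro mult_left_mono power_increasing) auto
        finally have 1: "absval (a i) \<le> B * (\<rho>' ^ N') ^ j"
          by (simp add: power_mult)
        have "absval (fps_nth (P ^ (j - 1)) (i - 1)) \<le> M ^ (j - 1)"
          using geom_boundedD[OF geom_bounded_power[OF P_bound]] by simp
        also have "\<dots> \<le> M ^ j"
          using M1 by (intro power_increasing) auto
        finally have 2: "absval (e i j) \<le> absval c * M ^ j"
          using M1 by (auto simp: e_def absval_mult mult_left_mono)
        have "absval (a i) * absval (e i j) \<le> (B * (\<rho>' ^ N') ^ j) * (absval c * M ^ j)"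
          using 1 2 B ge1 by (intro mult_mono) auto
        from mult_right_mono[OF this, of "absval t ^ j"]
        show ?thesis
          by (simp add: absval_mult absval_power r_def power_mult_distrib mult_ac)
      qed
      show "(\<lambda>j. a i * (e i j * t ^ j)) sums (a i * (\<Sum>w\<in>W. 1 / y w ^ i))" for i
      proof (cases "i = 0")
        case False
        then obtain m where i: "i = Suc m"
          by (cases i) auto
        have "(\<Sum>w\<in>W. 1 / y w ^ i) = (\<Sum>n\<le>m. e i (Suc n) * t ^ Suc n)"
          unfolding i using power_sum_inverse[OF prod W(1) W(2)[rule_format] P(1,2) s0, of m]
          by (simp add: e_def t_def del: power_Suc)
        also have "\<dots> = (\<Sum>j = 1..Suc m. e i j * t ^ j)"
          by (rule sum.reindex_bij_witness[of _ "\<lambda>j. j - 1" Suc]) auto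
        finally have "a i * (\<Sum>w\<in>W. 1 / y w ^ i) = (\<Sum>j = 1..Suc m. a i * (e i j * t ^ j))"
          by (simp only: sum_distrib_left)
        moreover have "(\<lambda>j. a i * (e i j * t ^ j)) sums (\<Sum>j = 1..Suc m. a i * (e i j * t ^ j))"
        proof (rule sums_finite)
          fix j assume j: "j \<notin> {1..Suc m}"
          have "fps_nth (P ^ (j - 1)) (i - 1) = 0" if "j \<noteq> 0"
            using that j i startsby_zero_power_prefix[OF P(1), of "j - 1"] by auto
          then show "a i * (e i j * t ^ j) = 0"
            by (auto simp: e_def)
        qed auto
        ultimately show ?thesis
          by simp
      qed (simp add: a)
      show "r * absval t < 1"
        using s r by (simp add: t divide_less_eq)
    qed (use B r g in auto)
    then show "(\<lambda>j. b j * (1 / s) ^ j) sums g"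
      by (simp add: b_def t_def sum_distrib_right mult.assoc)
  qed
qed

section \<open>Linear polynomials over a finite field\<close>

text \<open>A plain predicate, since scalars are mapped to several targets: the field, its power
  series ring and evaluations of polynomials.\<close>

definition unital_hom :: "('a::comm_ring_1 \<Rightarrow> 'r::comm_ring_1) \<Rightarrow> bool" where
  "unital_hom \<kappa> \<longleftrightarrow> \<kappa> 1 = 1 \<and> (\<forall>x y. \<kappa> (x + y) = \<kappa> x + \<kappa> y) \<and> (\<forall>x y. \<kappa> (x * y) = \<kappa> x * \<kappa> y)"

lemma unital_homD:
  assumes "unital_hom \<kappa>"
  shows "\<kappa> 1 = 1" "\<kappa> (x + y) = \<kappa> x + \<kappa> y" "\<kappa> (x * y) = \<kappa> x * \<kappa> y"
    "\<kappa> 0 = 0" "\<kappa> (- x) = - \<kappa> x" "\<kappa> (x - y) = \<kappa> x - \<kappa> y" "\<kappa> (x ^ n) = \<kappa> x ^ n"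
    "\<kappa> (of_nat n) = of_nat n"
proof -
  show 1: "\<kappa> 1 = 1" and 2: "\<kappa> (x + y) = \<kappa> x + \<kappa> y" and 3: "\<kappa> (x * y) = \<kappa> x * \<kappa> y" for x y
    using assms by (auto simp: unital_hom_def)
  show 4: "\<kappa> 0 = 0"
    using 2[of 0 0] by simp
  show 5: "\<kappa> (- x) = - \<kappa> x" for x
    using 2[of x "- x"] 4 by (simp add: eq_neg_iff_add_eq_0 add.commute)
  show "\<kappa> (x - y) = \<kappa> x - \<kappa> y"
    using 2[of x "- y"] 5 by simp
  show "\<kappa> (x ^ n) = \<kappa> x ^ n"
    by (induction n) (auto simp: 1 3)
  show "\<kappa> (of_nat n) = of_nat n"
    by (induction n) (auto simp: 1 2 4)
qed

lemma poly_map_poly_hom: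
  assumes "unital_hom \<kappa>"
  shows "unital_hom (\<lambda>p. poly (map_poly \<kappa> p) y)"
proof -
  define ev where "ev p = poly (map_poly \<kappa> p) y" for p
  note \<kappa> = unital_homD[OF assms]
  have pCons: "ev (pCons c p) = \<kappa> c + y * ev p" for c p
    by (cases "c = 0 \<and> p = 0") (auto simp: ev_def map_poly_pCons \<kappa>)
  have add: "ev (p + r) = ev p + ev r" for p r
    by (induction p r rule: poly_induct2) (auto simp: pCons \<kappa> algebra_simps ev_def[of 0])
  have smult: "ev (Polynomial.smult c p) = \<kappa> c * ev p" for c p
    by (induction p) (auto simp: pCons \<kappa> algebra_simps ev_def[of 0])
  have "ev (p * r) = ev p * ev r" for p r
    by (induction p) (auto simp: pCons \<kappa> add smult algebra_simps ev_def[of 0])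
  moreover have "ev 1 = 1"
    using pCons[of 1 0] by (simp add: \<kappa> ev_def[of 0] one_pCons)
  ultimately show ?thesis
    using add by (simp add: unital_hom_def ev_def)
qed

lemma unital_hom_prod:
  "unital_hom \<kappa> \<Longrightarrow> \<kappa> (prod f S) = (\<Prod>i\<in>S. \<kappa> (f i))"
  by (induction S rule: infinite_finite_induct) (auto simp: unital_homD)

section \<open>Identities over a field with q elements\<close>

lemma card_finite_field_gt_1: "1 < CARD('a::{field,finite})"
proof -
  have "card {0, 1 :: 'a} \<le> CARD('a)"
    by (intro card_mono) auto
  then show ?thesis
    by simp
qed

text \<open>Multiplication by a nonzero \<open>x\<close> permutes the units, so their product is
  unchanged by the factor \<open>x ^ (q - 1)\<close>.\<close>

lemma power_card_finite_field:
  fixes x :: "'a::{field,finite}"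
  shows "x ^ CARD('a) = x"
proof (cases "x = 0")
  case False
  define U where "U = (UNIV - {0} :: 'a set)"
  have "bij_betw ((*) x) U U"
    using False by (intro bij_betwI[of _ _ _ "\<lambda>y. y / x"]) (auto simp: U_def)
  then have "prod (\<lambda>y. y) U = (\<Prod>y\<in>U. x * y)"
    by (rule prod.reindex_bij_betw[symmetric])
  then have "x ^ card U * prod (\<lambda>y. y) U = prod (\<lambda>y. y) U"
    by (simp add: prod.distrib)
  then have "x ^ card U = 1"
    by (simp add: U_def)
  moreover have "CARD('a) = Suc (card U)"
    by (simp add: U_def card_Diff_singleton)
  ultimately show ?thesis
    by simp
qed (use card_finite_field_gt_1 in \<open>auto simp: zero_power\<close>)

lemma poly_eq_0_finite_field:
  fixes p :: "'a::{field,finite} poly"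
  assumes "degree p < CARD('a)" "\<And>c. poly p c = 0"
  shows "p = 0"
proof (rule ccontr)
  assume "p \<noteq> 0"
  then have "card {c. poly p c = 0} \<le> degree p"
    by (rule card_poly_roots_bound)
  then show False
    using assms by simp
qed

lemma degree_less_of_coeff_0:
  assumes "degree p \<le> n" "coeff p n = 0" "0 < n"
  shows "degree p < n"
proof (rule ccontr)
  assume "\<not> degree p < n"
  then have "degree p = n"
    using assms by simp
  then have "p = 0"
    using assms by (metis leading_coeff_0_iff)
  then show False
    using \<open>degree p = n\<close> assms by simp
qed

text \<open>Two monic polynomials of degree q that both vanish on the whole field differ by a
  polynomial of degree below q with q zeros.\<close>

lemma prod_monic_linear_finite_field:
  "(\<Prod>c\<in>UNIV. [:- c, 1:]) = monom (1 :: 'a::{field,finite}) CARD('a) - [:0, 1:]"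
proof -
  define q where "q = CARD('a)"
  define p where "p = (\<Prod>c\<in>UNIV. [:- c, 1 :: 'a:])"
  have deg: "degree p = q"
    unfolding p_def q_def by (subst degree_prod_sum_eq) auto
  have lead: "lead_coeff p = 1"
    by (simp add: p_def lead_coeff_prod)
  have "degree (p - (monom 1 q - [:0, 1:])) < q"
  proof -
    have "degree (p - (monom 1 q - [:0, 1:])) \<le> q"
      using deg card_finite_field_gt_1[where 'a = 'a]
      by (intro degree_diff_le) (auto simp: degree_monom_eq q_def)
    moreover have "coeff (p - (monom 1 q - [:0, 1:])) q = 0"
      using lead deg card_finite_field_gt_1[where 'a = 'a] by (simp add: q_def coeff_pCons split: nat.splits)
    ultimately show ?thesis
      using card_finite_field_gt_1[where 'a = 'a] by (intro degree_less_of_coeff_0) (auto simp: q_def)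
  qed
  moreover have "poly (p - (monom 1 q - [:0, 1:])) c = 0" for c
  proof -
    have "poly p c = 0"
      by (auto simp: p_def poly_prod prod_zero_iff intro!: bexI[of _ c])
    then show ?thesis
      by (simp add: poly_monom q_def power_card_finite_field)
  qed
  ultimately have "p - (monom 1 q - [:0, 1:]) = 0"
    unfolding q_def by (intro poly_eq_0_finite_field)
  then show ?thesis
    by (simp add: p_def q_def)
qed

text \<open>The polynomial identity above, specialised at an element \<open>y\<close> of an
  arbitrary commutative ring by the evaluation homomorphism.\<close>

lemma prod_minus_finite_field:
  fixes \<kappa> :: "'a::{field,finite} \<Rightarrow> 'r::comm_ring_1"
  assumes "unital_hom \<kappa>"
  shows "(\<Prod>c\<in>UNIV. y - \<kappa> c) = y ^ CARD('a) - y"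
proof -
  note hom = poly_map_poly_hom[OF assms, of y]
  note \<kappa> = unital_homD[OF assms]
  have X: "poly (map_poly \<kappa> [:c, 1:]) y = \<kappa> c + y" for c
    by (simp add: map_poly_pCons \<kappa>)
  have "(\<Prod>c\<in>UNIV. y - \<kappa> c) = poly (map_poly \<kappa> (\<Prod>c\<in>UNIV. [:- c, 1:])) y"
    by (simp add: unital_hom_prod[OF hom] X \<kappa>)
  also have "\<dots> = poly (map_poly \<kappa> (monom 1 CARD('a))) y - poly (map_poly \<kappa> [:0, 1:]) y"
    unfolding prod_monic_linear_finite_field by (rule unital_homD(6)[OF hom])
  also have "\<dots> = y ^ CARD('a) - y"
    by (simp add: map_poly_monom \<kappa> poly_monom X)
  finally show ?thesis .
qed

text \<open>The inner binomial coefficients are the coefficients of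
  \<open>(1 + X)^q - X^q - 1\<close>, which has degree below q and vanishes at every field
  element.\<close>

lemma of_nat_choose_finite_field:
  assumes "0 < i" "i < CARD('a::{field,finite})"
  shows "of_nat (CARD('a) choose i) = (0 :: 'a)"
proof -
  define q where "q = CARD('a)"
  define p where "p = [:1, 1 :: 'a:] ^ q - monom 1 q - 1"
  have "degree p < q"
  proof -
    have "degree ([:1, 1 :: 'a:] ^ q) = q"
      by (simp add: degree_power_eq)
    then have "degree p \<le> q"
      unfolding p_def by (intro degree_diff_le) (auto simp: degree_monom_eq)
    moreover have "coeff p q = 0"
      using assms by (simp add: p_def q_def coeff_linear_poly_power)
    ultimately show ?thesis
      using assms by (intro degree_less_of_coeff_0) (auto simp: q_def)
  qed
  moreover have "poly p c = 0" for c
    by (simp add: p_def q_def poly_monom power_card_finite_field)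
  ultimately have "p = 0"
    unfolding q_def by (intro poly_eq_0_finite_field)
  then have "coeff p i = 0"
    by simp
  then show ?thesis
    using assms by (simp add: p_def q_def coeff_linear_poly_power)
qed

lemma frobenius_add:
  fixes \<kappa> :: "'a::{field,finite} \<Rightarrow> 'r::comm_ring_1" and x y :: 'r
  assumes "unital_hom \<kappa>"
  shows "(x + y) ^ CARD('a) = x ^ CARD('a) + y ^ CARD('a)"
proof -
  define q where "q = CARD('a)"
  have zero: "of_nat (q choose i) = (0 :: 'r)" if "0 < i" "i < q" for i
    using of_nat_choose_finite_field[of i, where 'a = 'a] that unital_homD(4,8)[OF assms]
    unfolding q_def by metis
  have "(x + y) ^ q = (\<Sum>i\<le>q. of_nat (q choose i) * x ^ i * y ^ (q - i))"
    by (rule binomial_ring)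
  also have "\<dots> = (\<Sum>i\<in>{0, q}. of_nat (q choose i) * x ^ i * y ^ (q - i))"
    using zero by (intro sum.mono_neutral_right) auto
  also have "\<dots> = x ^ q + y ^ q"
    using card_finite_field_gt_1[where 'a = 'a] by (simp add: q_def)
  finally show ?thesis
    by (simp add: q_def)
qed

text \<open>The case \<open>i = 1\<close> of the binomial coefficients; it makes derivatives of q-th
  powers vanish.\<close>

lemma of_nat_card_finite_field:
  fixes \<kappa> :: "'a::{field,finite} \<Rightarrow> 'r::comm_ring_1"
  assumes "unital_hom \<kappa>"
  shows "of_nat CARD('a) = (0 :: 'r)"
proof -
  have "of_nat CARD('a) = (0 :: 'a)"
    using of_nat_choose_finite_field[of 1, where 'a = 'a] card_finite_field_gt_1[where 'a = 'a] by simp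
  then show ?thesis
    using unital_homD(4,8)[OF assms] by metis
qed

text \<open>Bounding coefficients rather than the degree gives \<open>polys_below 0 = {0}\<close>,
  whereas \<open>degree b < 0\<close> has no solution; inductions can start from this one-element
  set.\<close>

definition polys_below :: "nat \<Rightarrow> 'a::zero poly set" where
  "polys_below n = {b. \<forall>i\<ge>n. coeff b i = 0}"

lemma polys_below_0 [simp]: "polys_below 0 = {0}"
  by (auto simp: polys_below_def poly_eq_iff)

lemma zero_in_polys_below [simp]: "0 \<in> polys_below n"
  by (simp add: polys_below_def)

lemma polys_below_degree: "0 < n \<Longrightarrow> polys_below n = {b. degree b < n}"
  by (auto simp: polys_below_def coeff_eq_0 intro: degree_lessI)

lemma polys_below_iff: "b \<in> polys_below n \<longleftrightarrow> b = 0 \<or> degree b < n"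
  by (cases "n = 0") (auto simp: polys_below_degree)

lemma bij_betw_polys_below_Suc:
  "bij_betw (\<lambda>(c, b). b + monom c n) (UNIV \<times> polys_below n) (polys_below (Suc n) :: 'a::ab_group_add poly set)"
proof (rule bij_betwI[of _ _ _ "\<lambda>b. (coeff b n, b - monom (coeff b n) n)"])
  show "(\<lambda>(c, b). b + monom c n) \<in> UNIV \<times> polys_below n \<rightarrow> polys_below (Suc n)"
    by (auto simp: polys_below_def)
  show "(\<lambda>b. (coeff b n, b - monom (coeff b n) n)) \<in> polys_below (Suc n) \<rightarrow> UNIV \<times> polys_below n"
    by (auto simp: polys_below_def le_Suc_eq not_less_eq_eq)
qed (auto simp: polys_below_def)

lemma finite_polys_below [simp]: "finite (polys_below n :: 'a::{ab_group_add,finite} poly set)"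
proof (induction n)
  case (Suc n)
  then show ?case
    using bij_betw_finite[OF bij_betw_polys_below_Suc[of n, where 'a = 'a]] by simp
qed simp

lemma card_polys_below: "card (polys_below n :: 'a::{ab_group_add,finite} poly set) = CARD('a) ^ n"
proof (induction n)
  case (Suc n)
  then show ?case
    using bij_betw_same_card[OF bij_betw_polys_below_Suc[of n, where 'a = 'a]]
    by (simp add: card_cartesian_product)
qed simp

text \<open>The target is a ring so that the constructions apply to a field and to the power series
  over it alike. \<open>\<Phi>_unit\<close> replaces the division that a field would allow.\<close>

locale scalar_linear =
  fixes \<kappa> :: "'a::{field,finite} \<Rightarrow> 'r::comm_ring_1" and \<Phi> :: "'a poly \<Rightarrow> 'r"
  assumes hom: "unital_hom \<kappa>"
    and \<Phi>_add: "\<And>a b. \<Phi> (a + b) = \<Phi> a + \<Phi> b"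
    and \<Phi>_smult: "\<And>c a. \<Phi> (Polynomial.smult c a) = \<kappa> c * \<Phi> a"
    and \<Phi>_unit: "\<And>a. \<Phi> a = 0 \<or> \<Phi> a dvd 1"
begin

text \<open>For \<open>\<Phi> = emb \<iota>\<close> this is the Carlitz polynomial, the product of x
  - b over all b of degree below n; in general it is the additive polynomial of a finite vector
  space over the finite field.\<close>

definition L :: "nat \<Rightarrow> 'r \<Rightarrow> 'r" where
  "L n x = (\<Prod>b\<in>polys_below n. x - \<Phi> b)"

lemma \<Phi>_0 [simp]: "\<Phi> 0 = 0"
  using \<Phi>_add[of 0 0] by simp

lemma \<Phi>_diff: "\<Phi> (a - b) = \<Phi> a - \<Phi> b"
  using \<Phi>_add[of "a - b" b] by simp

text \<open>Splitting off the top coefficient writes the index set as all \<open>b + c T^n\<close>.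
  By linearity of \<open>L n\<close> the factor for c is \<open>L n x - c Z\<close>, and the product
  of Y - c Z over all c is \<open>Y^q - Z^(q-1) Y\<close>.\<close>

lemma L_step:
  assumes "\<And>x y. L n (x + y) = L n x + L n y" "\<And>c x. L n (\<kappa> c * x) = \<kappa> c * L n x"
  shows "L (Suc n) x = L n x ^ CARD('a) - L n (\<Phi> (monom 1 n)) ^ (CARD('a) - 1) * L n x"
proof -
  define q where "q = CARD('a)"
  define u where "u = \<Phi> (monom 1 n)"
  define Z where "Z = L n u"
  have q: "0 < q"
    by (simp add: q_def)
  have L_diff: "L n (x - \<kappa> c * u) = L n x - \<kappa> c * Z" for c
    using assms(1)[of "x - \<kappa> c * u" "\<kappa> c * u"] assms(2)[of c u] by (simp add: Z_def algebra_simps)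
  have "L (Suc n) x = (\<Prod>(c, b)\<in>UNIV \<times> polys_below n. x - \<Phi> (b + monom c n))"
    unfolding L_def by (subst prod.reindex_bij_betw[OF bij_betw_polys_below_Suc, symmetric])
      (simp add: case_prod_unfold)
  also have "\<dots> = (\<Prod>c\<in>UNIV. \<Prod>b\<in>polys_below n. (x - \<kappa> c * u) - \<Phi> b)"
  proof -
    have "\<Phi> (b + monom c n) = \<Phi> b + \<kappa> c * u" for b c
      using \<Phi>_smult[of c "monom 1 n"] by (simp add: \<Phi>_add u_def smult_monom)
    then show ?thesis
      by (simp add: prod.cartesian_product algebra_simps)
  qed
  also have "\<dots> = (\<Prod>c\<in>UNIV. L n x - \<kappa> c * Z)"
    by (simp add: L_diff flip: L_def)
  also have "\<dots> = L n x ^ q - Z ^ (q - 1) * L n x"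
  proof -
    have "Z = (\<Prod>b\<in>polys_below n. \<Phi> (monom 1 n - b))"
      by (simp add: Z_def L_def u_def \<Phi>_diff)
    \<comment> \<open>\<open>Z\<close> is a product of values of \<open>\<Phi>\<close>, each zero or
      a unit, so either the claim is trivial or \<open>Z\<close> can be divided out.\<close>
    then consider "Z = 0" | "Z dvd 1"
      using prod_dvd_prod[of "polys_below n" "\<lambda>b. \<Phi> (monom 1 n - b)" "\<lambda>_. 1"]
        prod_zero[OF finite_polys_below, of n "\<lambda>b. \<Phi> (monom 1 n - b)"] \<Phi>_unit
      by auto
    then show ?thesis
    proof cases
      case 1
      then show ?thesis
        using card_finite_field_gt_1[where 'a = 'a] by (simp add: q_def zero_power)
    next
      case 2
      then obtain Z' where Z': "Z * Z' = 1"
        by (metis dvd_def)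
      have "(\<Prod>c\<in>UNIV. L n x - \<kappa> c * Z) = (\<Prod>c\<in>UNIV. Z * (L n x * Z' - \<kappa> c))"
      proof (rule prod.cong)
        fix c
        have "L n x = Z * Z' * L n x"
          by (simp add: Z')
        then show "L n x - \<kappa> c * Z = Z * (L n x * Z' - \<kappa> c)"
          by (simp add: algebra_simps)
      qed simp
      also have "\<dots> = Z ^ q * ((L n x * Z') ^ q - L n x * Z')"
        by (simp add: prod.distrib prod_minus_finite_field[OF hom] q_def)
      also have "\<dots> = (Z * Z' * L n x) ^ q - Z ^ (q - 1) * (Z * Z') * L n x"
        using q by (simp add: power_mult_distrib algebra_simps power_eq_if[of Z q])
      finally show ?thesis
        by (simp add: Z')
    qed
  qed
  finally show ?thesis
    by (simp add: q_def Z_def u_def)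
qed

text \<open>Additivity and homogeneity are proved by one induction, because the recursion for
  \<open>L (Suc n)\<close> presupposes both for \<open>L n\<close>.\<close>

lemma L_linear_aux: "L n (x + y) = L n x + L n y \<and> L n (\<kappa> c * x) = \<kappa> c * L n x"
proof (induction n arbitrary: x y c)
  case (Suc n)
  then have IH: "L n (x + y) = L n x + L n y" "L n (\<kappa> c * x) = \<kappa> c * L n x" for x y c
    by auto
  note step = L_step[OF IH]
  have "L (Suc n) (x + y) = L (Suc n) x + L (Suc n) y"
    by (simp add: step IH(1) frobenius_add[OF hom] algebra_simps)
  moreover have "\<kappa> c ^ CARD('a) = \<kappa> c"
    using unital_homD(7)[OF hom, of c "CARD('a)"] by (simp add: power_card_finite_field)
  then have "L (Suc n) (\<kappa> c * x) = \<kappa> c * L (Suc n) x"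
    by (simp add: step IH(2) power_mult_distrib right_diff_distrib mult.left_commute)
  ultimately show ?case
    by blast
qed (simp add: L_def)

lemma L_add: "L n (x + y) = L n x + L n y" and L_scale: "L n (\<kappa> c * x) = \<kappa> c * L n x"
  using L_linear_aux by auto

lemmas L_Suc = L_step[OF L_add L_scale]

lemma L_diff: "L n (x - y) = L n x - L n y"
  using L_add[of n "x - y" y] by simp

end

text \<open>
  Taking coefficients in the power series ring turns the pointwise additivity of \<open>L\<close> into an
  identity between power series.
\<close>

lemma scalar_linear_fps:
  fixes \<kappa> :: "'a::{field,finite} \<Rightarrow> 'c::field"
  assumes "scalar_linear \<kappa> \<Phi>"
  shows "scalar_linear (\<lambda>c. fps_const (\<kappa> c)) (\<lambda>b. fps_const (\<Phi> b))"
proof -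
  interpret scalar_linear \<kappa> \<Phi> by fact
  show ?thesis
  proof
    show "unital_hom (\<lambda>c. fps_const (\<kappa> c))"
      using unital_homD[OF hom] by (auto simp: unital_hom_def)
    show "fps_const (\<Phi> a) = 0 \<or> fps_const (\<Phi> a) dvd 1" for a
      by (cases "\<Phi> a = 0") (auto intro!: dvdI[of _ _ "fps_const (inverse (\<Phi> a))"])
  qed (auto simp: \<Phi>_add \<Phi>_smult)
qed

text \<open>\<open>P n\<close> is \<open>L n\<close> taken at the variable X of the power series
  ring. Additivity at \<open>x - X\<close> then gives the first claim, and the recursion for
  \<open>L\<close> governs the derivative.\<close>

lemma fps_linear_prod:
  fixes \<kappa> :: "'a::{field,finite} \<Rightarrow> 'c::field"
  assumes "scalar_linear \<kappa> \<Phi>"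
  defines "P n \<equiv> \<Prod>b\<in>polys_below n. fps_X - fps_const (\<Phi> b)"
  shows "(\<Prod>b\<in>polys_below n. fps_const (x - \<Phi> b) - fps_X) =
      fps_const (\<Prod>b\<in>polys_below n. x - \<Phi> b) - P n"
    and "fps_nth (P n) 0 = 0"
    and "fps_deriv (P n) = fps_const (\<Prod>b\<in>polys_below n - {0}. - \<Phi> b)"
    and "k > CARD('a) ^ n \<Longrightarrow> fps_nth (P n) k = 0"
proof -
  interpret scalar_linear \<kappa> \<Phi> by fact
  interpret F: scalar_linear "\<lambda>c. fps_const (\<kappa> c)" "\<lambda>b. fps_const (\<Phi> b)"
    by (rule scalar_linear_fps) fact
  have P: "P n = F.L n fps_X" for n
    by (simp add: P_def F.L_def)
  have const_prod: "fps_const (prod f S) = (\<Prod>i\<in>S. fps_const (f i))" for f :: "'d \<Rightarrow> 'c" and S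
    by (induction S rule: infinite_finite_induct) (auto simp flip: fps_const_mult)
  have L_const: "F.L n (fps_const x) = fps_const (\<Prod>b\<in>polys_below n. x - \<Phi> b)" for n x
    by (simp add: F.L_def const_prod)
  have "F.L n (fps_const x - fps_X) = (\<Prod>b\<in>polys_below n. fps_const (x - \<Phi> b) - fps_X)"
    unfolding F.L_def by (intro prod.cong) (auto simp: algebra_simps simp flip: fps_const_sub)
  then show "(\<Prod>b\<in>polys_below n. fps_const (x - \<Phi> b) - fps_X) =
      fps_const (\<Prod>b\<in>polys_below n. x - \<Phi> b) - P n"
    by (simp add: F.L_diff L_const P)
  have P_split: "P n = fps_X * (\<Prod>b\<in>polys_below n - {0}. fps_X - fps_const (\<Phi> b))" for n
    unfolding P_def by (subst prod.remove[of _ 0]) auto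
  then show "fps_nth (P n) 0 = 0"
    by simp
  \<comment> \<open>The induction only shows that the derivative is some constant: the q-th power in
    the recursion has derivative zero. The value is read off afterwards from the linear
    coefficient.\<close>
  have "\<exists>c. fps_deriv (P n) = fps_const c"
  proof (induction n)
    case (Suc n)
    then obtain c where c: "fps_deriv (P n) = fps_const c"
      by blast
    obtain z where z: "F.L n (fps_const (\<Phi> (monom 1 n))) = fps_const z"
      using L_const by blast
    have "fps_deriv (P n ^ CARD('a)) = 0"
      using of_nat_card_finite_field[OF F.hom]
      by (simp add: fps_deriv_power fps_of_nat of_nat_card_finite_field[OF hom])
    then have "fps_deriv (P (Suc n)) = fps_const (- (z ^ (CARD('a) - 1) * c))"
      using F.L_Suc[of n fps_X] by (simp add: z c P[symmetric])
    then show ?case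
      by blast
  qed (simp add: P_def)
  then obtain c where c: "fps_deriv (P n) = fps_const c"
    by blast
  have nth0: "fps_nth (prod f S) 0 = (\<Prod>i\<in>S. fps_nth (f i) 0)" for f :: "'d \<Rightarrow> 'c fps" and S
    by (induction S rule: infinite_finite_induct) auto
  have "c = fps_nth (P n) 1"
    using arg_cong[OF c, of "\<lambda>f. fps_nth f 0"] by simp
  also have "\<dots> = (\<Prod>b\<in>polys_below n - {0}. - \<Phi> b)"
    by (simp add: P_split fps_X_mult_nth nth0)
  finally show "fps_deriv (P n) = fps_const (\<Prod>b\<in>polys_below n - {0}. - \<Phi> b)"
    using c by simp
  have "P n = fps_of_poly (\<Prod>b\<in>polys_below n. [:- \<Phi> b, 1:])"
    by (simp add: P_def fps_of_poly_prod fps_of_poly_pCons algebra_simps flip: fps_const_neg)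
  moreover have "degree (\<Prod>b\<in>polys_below n. [:- \<Phi> b, 1:]) = CARD('a) ^ n"
    by (subst degree_prod_sum_eq) (auto simp: card_polys_below)
  ultimately show "k > CARD('a) ^ n \<Longrightarrow> fps_nth (P n) k = 0"
    by (simp add: coeff_eq_0)
qed

section \<open>The exponential function of \<open>A\<close>\<close>

locale C_infinity =
  fixes \<iota> :: "'a::{field,finite} fls \<Rightarrow> 'c::complete_ultrametric_field"
    and q :: real
  assumes C_inf: "is_C_infinity \<iota>"
  defines q_def: "q \<equiv> real CARD('a)"
begin

abbreviation \<kappa> :: "'a \<Rightarrow> 'c" where
  "\<kappa> c \<equiv> emb \<iota> [:c:]"

text \<open>The condition of \<open>has_t_expansion\<close> on points near infinity: the imaginary
  part of z, its distance to \<open>K_\<infinity>\<close>, is at least R.\<close>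

definition far :: "real \<Rightarrow> 'c \<Rightarrow> bool" where
  "far R z \<longleftrightarrow> (\<forall>x\<in>range \<iota>. absval (z - x) \<ge> R)"

lemma q_gt_1: "1 < q"
  using card_finite_field_gt_1[where 'a = 'a] by (simp add: q_def)

lemma iota_hom: "unital_hom \<iota>"
  using C_inf by (simp add: is_C_infinity_def unital_hom_def)

lemmas iota_simps = unital_homD[OF iota_hom]

lemma absval_iota: "x \<noteq> 0 \<Longrightarrow> absval (\<iota> x) = q powi (- fls_subdegree x)"
  using C_inf by (simp add: is_C_infinity_def q_def)

lemma iota_eq_0_iff [simp]: "\<iota> x = 0 \<longleftrightarrow> x = 0"
proof
  assume "\<iota> x = 0"
  show "x = 0"
  proof (rule ccontr)
    assume "x \<noteq> 0"
    then have "0 < absval (\<iota> x)"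
      using absval_iota[of x] q_gt_1 zero_less_power_int[of q "- fls_subdegree x"] by linarith
    then show False
      using \<open>\<iota> x = 0\<close> by simp
  qed
qed (simp add: iota_simps)

lemma iota_inverse: "\<iota> (inverse x) = inverse (\<iota> x)"
proof (cases "x = 0")
  case False
  then have "\<iota> x * \<iota> (inverse x) = 1"
    by (simp flip: iota_simps)
  then show ?thesis
    by (metis inverse_unique)
qed (simp add: iota_simps)

lemma range_iota_closed:
  assumes "x \<in> range \<iota>" "y \<in> range \<iota>"
  shows "x + y \<in> range \<iota>" "x - y \<in> range \<iota>" "x * y \<in> range \<iota>" "x / y \<in> range \<iota>" "- x \<in> range \<iota>"
  using assms by (auto simp: divide_inverse simp flip: iota_simps iota_inverse)

lemma emb_hom: "unital_hom (emb \<iota>)"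
proof -
  have "unital_hom (fls_const :: 'a \<Rightarrow> 'a fls)"
    by (auto simp: unital_hom_def fls_plus_const)
  from unital_homD[OF poly_map_poly_hom[OF this]] show ?thesis
    by (simp add: unital_hom_def emb_def iota_simps)
qed

lemmas emb_simps = unital_homD[OF emb_hom]

lemma emb_in_range [simp]: "emb \<iota> a \<in> range \<iota>"
  by (simp add: emb_def)

lemma absval_scalar: "c \<noteq> 0 \<Longrightarrow> absval (\<kappa> c) = 1"
  by (simp add: emb_def absval_iota map_poly_pCons)

lemma absval_emb_T: "absval (emb \<iota> [:0, 1:]) = q"
  by (simp add: emb_def absval_iota map_poly_pCons)

lemma absval_emb: "a \<noteq> 0 \<Longrightarrow> absval (emb \<iota> a) = q ^ degree a"
proof (induction a)
  case (pCons c a)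
  have split: "emb \<iota> (pCons c a) = emb \<iota> [:0, 1:] * emb \<iota> a + \<kappa> c"
  proof -
    have "pCons c a = [:0, 1:] * a + [:c:]"
      by simp
    then show ?thesis
      by (metis emb_simps(2,3))
  qed
  show ?case
  proof (cases "a = 0")
    case True
    then show ?thesis
      using pCons by (simp add: absval_scalar)
  next
    case False
    then have 1: "absval (emb \<iota> [:0, 1:] * emb \<iota> a) = q ^ Suc (degree a)"
      using pCons.IH by (simp add: absval_mult absval_emb_T)
    have "absval (\<kappa> c) \<le> 1"
      using absval_scalar[of c] by (cases "c = 0") (auto simp: emb_simps)
    also have "1 < q ^ Suc (degree a)"
      using q_gt_1 by (intro one_less_power) auto
    finally show ?thesis
      unfolding split using 1 False by (subst absval_add_eq) auto
  qed
qed simp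

lemma emb_eq_0_iff [simp]: "emb \<iota> a = 0 \<longleftrightarrow> a = 0"
proof
  assume "emb \<iota> a = 0"
  then have "absval (emb \<iota> a) = 0"
    by simp
  then show "a = 0"
    using absval_emb[of a] q_gt_1 by fastforce
qed (simp add: emb_simps)

lemma inj_emb: "inj (emb \<iota>)"
  by (rule injI) (metis emb_eq_0_iff emb_simps(6) right_minus_eq)

lemma scalar_linear_emb: "scalar_linear \<kappa> (emb \<iota>)"
proof
  show "unital_hom \<kappa>"
    using emb_simps(1) emb_simps(2)[of "[:x:]" "[:y:]" for x y] emb_simps(3)[of "[:x:]" "[:y:]" for x y]
    by (auto simp: unital_hom_def one_pCons)
  show "emb \<iota> (Polynomial.smult c a) = \<kappa> c * emb \<iota> a" for c a
    using emb_simps(3)[of "[:c:]" a] by simp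
  show "emb \<iota> a = 0 \<or> emb \<iota> a dvd 1" for a
    by (cases "a = 0") (auto simp: dvd_field_iff)
qed (auto simp: emb_simps)

sublocale A: scalar_linear \<kappa> "emb \<iota>"
  by (rule scalar_linear_emb)

definition E_part :: "nat \<Rightarrow> 'c \<Rightarrow> 'c" where
  "E_part n z = z * (\<Prod>a\<in>polys_below n - {0}. 1 - z / emb \<iota> a)"

text \<open>The exponential of the lattice A itself. The period is brought in only by scaling, in
  \<open>t_param_conv_E\<close>.\<close>

definition E :: "'c \<Rightarrow> 'c" where
  "E z = lattice_exp (range (emb \<iota>)) z"

text \<open>Every factor differs from 1 by at most \<open>absval z / r\<close>, which is below 1,
  and elements this close to 1 are closed under multiplication.\<close>

lemma absval_prod_minus_1:
  fixes z :: 'c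
  assumes "finite G" "\<And>\<omega>. \<omega> \<in> G \<Longrightarrow> r \<le> absval \<omega>" "absval z < r"
  shows "absval ((\<Prod>\<omega>\<in>G. 1 - z / \<omega>) - 1) \<le> absval z / r"
  using assms(1,2)
proof (induction G rule: finite_induct)
  case empty
  have "0 < r"
    using assms(3) by (rule le_less_trans[OF absval_nonneg])
  then show ?case
    by simp
next
  case (insert \<omega> G)
  have r: "0 < r"
    using assms(3) by (rule le_less_trans[OF absval_nonneg])
  have "absval \<omega> \<ge> r"
    using insert by auto
  then have 1: "absval (z / \<omega>) \<le> absval z / r"
    using r by (simp add: absval_divide frac_le)
  also have "\<dots> < 1"
    using assms(3) r by simp
  finally have "absval (1 - z / \<omega>) = 1"
    by (subst absval_diff_eq) auto
  then have "absval (((\<Prod>\<omega>\<in>G. 1 - z / \<omega>) - 1) * (1 - z / \<omega>)) \<le> absval z / r"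
    using insert by (simp add: absval_mult)
  moreover have "(\<Prod>\<omega>\<in>insert \<omega> G. 1 - z / \<omega>) - 1 = ((\<Prod>\<omega>\<in>G. 1 - z / \<omega>) - 1) * (1 - z / \<omega>) - z / \<omega>"
    using insert by (simp add: algebra_simps)
  ultimately show ?case
    using 1 absval_diff[of "((\<Prod>\<omega>\<in>G. 1 - z / \<omega>) - 1) * (1 - z / \<omega>)" "z / \<omega>"] by simp
qed

lemma exists_power_gt: "\<exists>n. x < q ^ n"
  using real_arch_pow[OF q_gt_1] .

text \<open>Lattice points with absolute value above that of z contribute factors of absolute value
  1. Hence the product over all finite subsets may be evaluated along the discs of degree below n,
  and the absolute value of \<open>E z\<close> is attained at a finite stage.\<close>

lemma E_lim:
  shows "(\<lambda>n. E_part n z) \<longlonglongrightarrow> E z"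
    and "absval z < q ^ m \<Longrightarrow> absval (E z) = absval (E_part m z)"
proof -
  define PR where "PR F = (\<Prod>\<omega>\<in>F. 1 - z / \<omega>)" for F :: "'c set"
  define B where "B n = emb \<iota> ` (polys_below n - {0})" for n
  define FL where "FL = finite_subsets_at_top (range (emb \<iota>) - {0})"
  have B: "finite (B n)" "B n \<subseteq> range (emb \<iota>) - {0}" for n
    by (auto simp: B_def)
  have B_mono: "B m \<subseteq> B n" if "m \<le> n" for m n
    using that by (force simp: B_def polys_below_def)
  have E_part: "E_part n z = z * PR (B n)" for n
    using inj_emb by (simp add: E_part_def PR_def B_def prod.reindex inj_on_def)
  \<comment> \<open>Polynomials outside \<open>polys_below n\<close> have degree at least n, hence
    absolute value at least \<open>q ^ n\<close>.\<close>
  have outside: "absval (PR (F - B n) - 1) \<le> absval z / q ^ n"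
    if "finite F" "F \<subseteq> range (emb \<iota>) - {0}" "absval z < q ^ n" for F n
    unfolding PR_def
  proof (rule absval_prod_minus_1)
    fix \<omega> assume \<omega>: "\<omega> \<in> F - B n"
    then have "\<omega> \<in> range (emb \<iota>)"
      using that(2) by blast
    then obtain a where "\<omega> = emb \<iota> a"
      by blast
    moreover from this have "a \<noteq> 0" "a \<notin> polys_below n"
      using \<omega> that by (auto simp: B_def)
    ultimately have a: "\<omega> = emb \<iota> a" "a \<noteq> 0" "a \<notin> polys_below n"
      by auto
    then have "n \<le> degree a"
      by (auto simp: polys_below_iff)
    then show "q ^ n \<le> absval \<omega>"
      using a q_gt_1 by (simp add: absval_emb)
  qed (use that in auto)
  have split: "PR F = PR (B n) * PR (F - B n)" if "finite F" "B n \<subseteq> F" for F n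
    using that B unfolding PR_def by (metis prod.subset_diff mult.commute)
  obtain n0 where n0: "absval z < q ^ n0"
    using exists_power_gt by blast
  define K where "K = absval (PR (B n0))"
  have K0: "0 \<le> K"
    by (simp add: K_def)
  have less: "absval z < q ^ n" if "m \<le> n" "absval z < q ^ m" for m n
    using that by (meson less_le_trans power_increasing less_imp_le q_gt_1)
  have const: "absval (PR (B n)) = absval (PR (B m))" if "m \<le> n" "absval z < q ^ m" for m n
  proof -
    have "absval (PR (B n - B m) - 1) < absval 1"
      using outside[of "B n" m] B that q_gt_1 less_le_trans[of "absval z" "q ^ m"]
      by (auto simp: le_less_trans[of _ "absval z / q ^ m"])
    from absval_add_eq[OF this] have "absval (PR (B n - B m)) = 1"
      by simp
    then show ?thesis
      using split[of "B n" m] B B_mono that by (simp add: absval_mult)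
  qed
  \<comment> \<open>The bound is uniform in \<open>F\<close>, because the prefactor has the same
    absolute value \<open>K\<close> for all \<open>n\<close> from \<open>n0\<close> on. It yields
    both the Cauchy property along discs and convergence along all finite subsets.\<close>
  have close: "absval (PR F - PR (B n)) \<le> K * absval z / q ^ n"
    if "finite F" "F \<subseteq> range (emb \<iota>) - {0}" "B n \<subseteq> F" "n0 \<le> n" for F n
  proof -
    have "PR F - PR (B n) = PR (B n) * (PR (F - B n) - 1)"
      using split[of F n] that by (simp add: algebra_simps)
    moreover have "absval (PR (B n)) = K"
      using const[of n0 n] that n0 by (simp add: K_def)
    ultimately show ?thesis
      using mult_left_mono[OF outside[OF that(1,2) less[OF that(4) n0]] K0] by (simp add: absval_mult)
  qed
  have geo: "(\<lambda>n. K * absval z / q ^ n) \<longlonglongrightarrow> 0"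
    using LIMSEQ_inverse_realpow_zero[OF q_gt_1] tendsto_mult_right_zero
    by (force simp: divide_inverse)
  have small: "\<exists>n\<ge>n0. K * absval z / q ^ n < e" if e: "e > 0" for e
  proof -
    obtain N where "\<And>n. n \<ge> N \<Longrightarrow> norm (K * absval z / q ^ n - 0) < e"
      using LIMSEQ_D[OF geo e] by blast
    from this[of "max N n0"] have "K * absval z / q ^ max N n0 < e"
      by (simp only: real_norm_def diff_0_right) linarith
    then show ?thesis
      by (intro exI[of _ "max N n0"]) simp
  qed
  have "Cauchy (\<lambda>n. PR (B n))"
  proof (rule metric_CauchyI)
    fix e :: real assume "0 < e"
    then obtain M where M: "n0 \<le> M" "K * absval z / q ^ M < e"
      using small by blast
    show "\<exists>M. \<forall>m\<ge>M. \<forall>n\<ge>M. dist (PR (B m)) (PR (B n)) < e"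
    proof (intro exI allI impI)
      fix m n assume "M \<le> m" "M \<le> n"
      then have "absval (PR (B m) - PR (B M)) < e" "absval (PR (B n) - PR (B M)) < e"
        using close[of "B m" M] close[of "B n" M] M B B_mono by (auto intro: le_less_trans)
      then show "dist (PR (B m)) (PR (B n)) < e"
        using absval_diff[of "PR (B m) - PR (B M)" "PR (B n) - PR (B M)"] by (simp add: dist_absval)
    qed
  qed
  then obtain l where l: "(\<lambda>n. PR (B n)) \<longlonglongrightarrow> l"
    using Cauchy_convergent_iff convergent_def by blast
  have "(PR \<longlongrightarrow> l) FL"
    unfolding tendsto_iff
  proof (intro allI impI)
    fix e :: real assume e: "0 < e"
    then obtain M where M: "n0 \<le> M" "K * absval z / q ^ M < e"
      using small by blast
    have "absval (l - PR (B M)) \<le> K * absval z / q ^ M"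
    proof (rule LIMSEQ_le_const2)
      show "(\<lambda>n. absval (PR (B n) - PR (B M))) \<longlonglongrightarrow> absval (l - PR (B M))"
        using l by (intro tendsto_absval tendsto_diff tendsto_const)
      show "\<exists>N. \<forall>n\<ge>N. absval (PR (B n) - PR (B M)) \<le> K * absval z / q ^ M"
        using close[of "B n" M for n] M B B_mono by (intro exI[of _ M]) auto
    qed
    then have lM: "absval (l - PR (B M)) < e"
      using M by simp
    have "dist (PR F) l < e" if F: "finite F" "B M \<subseteq> F" "F \<subseteq> range (emb \<iota>) - {0}" for F
    proof -
      have "absval (PR F - PR (B M)) < e"
        using close[OF F(1,3,2)] M by auto
      then show ?thesis
        using lM absval_diff[of "PR F - PR (B M)" "l - PR (B M)"] by (simp add: dist_absval)
    qed
    then show "\<forall>\<^sub>F F in FL. dist (PR F) l < e"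
      unfolding FL_def eventually_finite_subsets_at_top using B by (intro exI[of _ "B M"]) auto
  qed
  then have "Lim FL PR = l"
    by (intro tendsto_Lim) (auto simp: FL_def)
  then have E_eq: "E z = z * l"
    by (simp add: E_def lattice_exp_def FL_def PR_def[abs_def])
  then show lim: "(\<lambda>n. E_part n z) \<longlonglongrightarrow> E z"
    using tendsto_mult[OF tendsto_const l] by (simp add: E_part)
  assume m: "absval z < q ^ m"
  have "(\<lambda>n. absval (E_part n z)) \<longlonglongrightarrow> absval (E z)"
    using lim by (rule tendsto_absval)
  moreover have "\<forall>\<^sub>F n in sequentially. absval (E_part n z) = absval (E_part m z)"
  proof (rule eventually_sequentiallyI)
    fix n assume "m \<le> n"
    from const[OF this m] show "absval (E_part n z) = absval (E_part m z)"
      by (simp only: E_part absval_mult)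
  qed
  then have "(\<lambda>n. absval (E_part n z)) \<longlonglongrightarrow> absval (E_part m z)"
    by (rule tendsto_eventually)
  ultimately show "absval (E z) = absval (E_part m z)"
    by (rule LIMSEQ_unique)
qed

text \<open>\<open>E_part n\<close> is the additive polynomial \<open>A.L n\<close> normalised to
  linear coefficient 1; this is how additivity and homogeneity pass to \<open>E\<close> in the
  limit.\<close>

lemma E_part_conv_L: "E_part n z = A.L n z / (\<Prod>b\<in>polys_below n - {0}. - emb \<iota> b)"
proof -
  have "A.L n z = z * (\<Prod>b\<in>polys_below n - {0}. z - emb \<iota> b)"
    unfolding A.L_def by (subst prod.remove[of _ 0]) auto
  moreover have "(\<Prod>b\<in>polys_below n - {0}. 1 - z / emb \<iota> b) =
      (\<Prod>b\<in>polys_below n - {0}. z - emb \<iota> b) / (\<Prod>b\<in>polys_below n - {0}. - emb \<iota> b)"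
    unfolding prod_dividef[symmetric] by (intro prod.cong) (auto simp: field_simps)
  ultimately show ?thesis
    by (simp only: E_part_def times_divide_eq_right)
qed

lemma E_add: "E (x + y) = E x + E y"
proof (rule LIMSEQ_unique[OF E_lim(1)])
  show "(\<lambda>n. E_part n (x + y)) \<longlonglongrightarrow> E x + E y"
    using tendsto_add[OF E_lim(1)[of x] E_lim(1)[of y]]
    by (simp add: E_part_conv_L A.L_add add_divide_distrib)
qed

lemma E_scale: "E (\<kappa> c * x) = \<kappa> c * E x"
proof (rule LIMSEQ_unique[OF E_lim(1)])
  show "(\<lambda>n. E_part n (\<kappa> c * x)) \<longlonglongrightarrow> \<kappa> c * E x"
    using tendsto_mult[OF tendsto_const E_lim(1)[of x], of "\<kappa> c"]
    by (simp add: E_part_conv_L A.L_scale)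
qed

lemma E_diff: "E (x - y) = E x - E y"
  using E_add[of "x - y" y] by simp

lemma E_uminus: "E (- x) = - E x"
  using E_add[of x "- x"] E_diff[of x x] by (simp add: eq_neg_iff_add_eq_0 add.commute)

text \<open>By the second part of \<open>E_lim\<close> a zero of \<open>E\<close> is already a zero
  of a finite product.\<close>

lemma E_eq_0_imp: "E z = 0 \<Longrightarrow> z \<in> range (emb \<iota>)"
proof -
  assume "E z = 0"
  obtain n where "absval z < q ^ n"
    using exists_power_gt by blast
  then have "E_part n z = 0"
    using E_lim(2)[of z n] \<open>E z = 0\<close> by simp
  then consider "z = 0" | b where "b \<noteq> 0" "1 - z / emb \<iota> b = 0"
    by (auto simp: E_part_def)
  then show ?thesis
  proof cases
    case 1
    then show ?thesis
      using emb_simps(4) by (metis rangeI)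
  qed auto
qed

text \<open>Let a be a lattice point nearest to z. Every other b satisfies
  \<open>|z - b| \<ge> |a - b|\<close>, so the finite product is at least \<open>|z - a|\<close>
  times its own normalising constant. The bound makes 1/E small near infinity.\<close>

lemma absval_E_ge:
  assumes "far R z" "0 \<le> R"
  shows "R \<le> absval (E z)"
proof -
  obtain n where n: "absval z < q ^ n"
    using exists_power_gt by blast
  obtain a where a: "a \<in> polys_below n"
    and a_min: "\<And>b. b \<in> polys_below n \<Longrightarrow> absval (z - emb \<iota> a) \<le> absval (z - emb \<iota> b)"
    using ex_is_arg_min_if_finite[of "polys_below n" "\<lambda>b. absval (z - emb \<iota> b)"]
      zero_in_polys_below[of n] unfolding is_arg_min_linorder by fastforce
  have *: "absval (emb \<iota> (a - b)) \<le> absval (z - emb \<iota> b)" if "b \<in> polys_below n" for b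
    using absval_diff[of "z - emb \<iota> b" "z - emb \<iota> a"] a_min[OF that] by (simp add: emb_simps)
  define C where "C = (\<Prod>b\<in>polys_below n - {0}. absval (emb \<iota> b))"
  have C: "0 < C"
    unfolding C_def by (intro prod_pos) auto
  \<comment> \<open>The finite set of polynomials is a group, so b and a - b run through it
    together; nonzero elements correspond to those different from a.\<close>
  have "C = (\<Prod>b\<in>polys_below n - {a}. absval (emb \<iota> (a - b)))"
    unfolding C_def using a
    by (intro prod.reindex_bij_witness[of _ "\<lambda>b. a - b" "\<lambda>b. a - b"]) (auto simp: polys_below_def)
  also have "\<dots> \<le> (\<Prod>b\<in>polys_below n - {a}. absval (z - emb \<iota> b))"
    using * by (intro prod_mono) auto
  finally have "R * C \<le> absval (z - emb \<iota> a) * (\<Prod>b\<in>polys_below n - {a}. absval (z - emb \<iota> b))"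
    using assms C emb_in_range[of a] unfolding far_def by (intro mult_mono) (blast, auto)
  also have "\<dots> = absval (A.L n z)"
    unfolding A.L_def absval_prod using a by (subst (2) prod.remove[of _ a]) auto
  also have "\<dots> = absval (E z) * C"
    using C by (simp add: E_lim(2)[OF n] E_part_conv_L absval_divide absval_prod C_def)
  finally show ?thesis
    using C by simp
qed

section \<open>Division points and the functional equation of the exponential\<close>

lemma bij_betw_polys_below_add:
  fixes p :: "'a poly"
  assumes "p \<noteq> 0"
  shows "bij_betw (\<lambda>(\<beta>, a). p * a + \<beta>) (polys_below (degree p) \<times> polys_below n) (polys_below (n + degree p))"
proof (rule bij_betwI[of _ _ _ "\<lambda>b. (b mod p, b div p)"])
  have deg_mod: "b mod p = 0 \<or> degree (b mod p) < degree p" for b :: "'a poly"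
    by (rule degree_mod_less[OF assms])
  have less: "\<beta> mod p = \<beta> \<and> \<beta> div p = 0" if "\<beta> \<in> polys_below (degree p)" for \<beta> :: "'a poly"
    using that by (auto simp: polys_below_iff div_poly_less mod_poly_less)
  show "(\<lambda>(\<beta>, a). p * a + \<beta>) \<in> polys_below (degree p) \<times> polys_below n \<rightarrow> polys_below (n + degree p)"
  proof (clarsimp)
    fix \<beta> a :: "'a poly" assume *: "\<beta> \<in> polys_below (degree p)" "a \<in> polys_below n"
    have "p * a \<in> polys_below (n + degree p)"
      using * assms by (cases "a = 0") (auto simp: polys_below_iff degree_mult_eq)
    moreover have "\<beta> \<in> polys_below (n + degree p)"
      using * by (auto simp: polys_below_iff)
    ultimately show "p * a + \<beta> \<in> polys_below (n + degree p)"
      by (auto simp: polys_below_def)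
  qed
  show "(\<lambda>b. (b mod p, b div p)) \<in> polys_below (n + degree p) \<rightarrow> polys_below (degree p) \<times> polys_below n"
  proof (clarsimp, safe)
    fix b :: "'a poly" assume b: "b \<in> polys_below (n + degree p)"
    show "b mod p \<in> polys_below (degree p)"
      using deg_mod by (auto simp: polys_below_iff)
    show "b div p \<in> polys_below n"
    proof (cases "b div p = 0")
      case False
      have deg: "degree (p * (b div p)) = degree p + degree (b div p)"
        using False assms by (simp add: degree_mult_eq)
      have "degree (p * (b div p) + b mod p) = degree (p * (b div p))"
        using deg_mod[of b]
      proof
        assume "degree (b mod p) < degree p"
        then show ?thesis
          using deg by (intro degree_add_eq_left) simp
      qed (simp only: add_0_right)
      then have "degree b = degree p + degree (b div p)"
        using deg by simp
      moreover have "b \<noteq> 0"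
        using False by auto
      ultimately show ?thesis
        using b by (auto simp: polys_below_iff)
    qed simp
  qed
  show "(\<lambda>b. (b mod p, b div p)) ((\<lambda>(\<beta>, a). p * a + \<beta>) x) = x"
    if "x \<in> polys_below (degree p) \<times> polys_below n" for x
    using that less assms by auto
qed auto

text \<open>The p-torsion points of the Drinfeld module uniformised by \<open>E\<close>, indexed by
  residues modulo p.\<close>

definition torsion :: "'a poly \<Rightarrow> 'a poly \<Rightarrow> 'c" where
  "torsion p \<beta> = E (emb \<iota> \<beta> / emb \<iota> p)"

lemma torsion_neq_0:
  assumes "p \<noteq> 0" "\<beta> \<in> polys_below (degree p) - {0}"
  shows "torsion p \<beta> \<noteq> 0"
proof
  assume "torsion p \<beta> = 0"
  then obtain a where "emb \<iota> \<beta> / emb \<iota> p = emb \<iota> a"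
    using E_eq_0_imp unfolding torsion_def by blast
  then have "emb \<iota> \<beta> = emb \<iota> (p * a)"
    using assms by (simp add: field_simps emb_simps)
  then have "\<beta> = p * a"
    using inj_emb by (simp add: inj_on_def)
  then show False
    using assms by (auto simp: polys_below_iff degree_mult_eq)
qed

lemma scalar_linear_torsion: "scalar_linear \<kappa> (torsion p)"
proof
  show "unital_hom \<kappa>"
    by (rule A.hom)
  show "torsion p (a + b) = torsion p a + torsion p b" for a b
    by (simp add: torsion_def emb_simps add_divide_distrib E_add)
  show "torsion p (Polynomial.smult c a) = \<kappa> c * torsion p a" for c a
    using E_scale[of c "emb \<iota> a / emb \<iota> p"] by (simp add: torsion_def A.\<Phi>_smult)
  show "torsion p a = 0 \<or> torsion p a dvd 1" for a
    by (cases "torsion p a = 0") (auto simp: dvd_field_iff)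
qed

text \<open>Lattice points of degree below n + deg p are sorted by their residue b modulo p, as p a
  + b. Each nonzero residue class gives a quotient of two values of \<open>A.L n\<close>.\<close>

lemma E_mult_aux:
  assumes "p \<noteq> 0"
  shows "E_part (n + degree p) (emb \<iota> p * z) = emb \<iota> p * E_part n z *
    (\<Prod>\<beta>\<in>polys_below (degree p) - {0}. A.L n (z - emb \<iota> \<beta> / emb \<iota> p) / A.L n (- (emb \<iota> \<beta> / emb \<iota> p)))"
proof -
  \<comment> \<open>The isolated factor z of \<open>E_part\<close> becomes the factor at index 0, so
    that the whole expression is a single product that can be reindexed.\<close>
  define h where "h b = (if b = 0 then emb \<iota> p * z else 1 - emb \<iota> p * z / emb \<iota> b)" for b
  have E_part_h: "E_part m (emb \<iota> p * z) = (\<Prod>b\<in>polys_below m. h b)" for m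
    unfolding E_part_def by (subst (2) prod.remove[of _ 0]) (auto simp: h_def)
  have "E_part (n + degree p) (emb \<iota> p * z) =
      (\<Prod>\<beta>\<in>polys_below (degree p). \<Prod>a\<in>polys_below n. h (p * a + \<beta>))"
    unfolding E_part_h prod.cartesian_product
    by (subst prod.reindex_bij_betw[OF bij_betw_polys_below_add[OF assms], symmetric])
      (simp add: case_prod_unfold)
  also have "\<dots> = (\<Prod>a\<in>polys_below n. h (p * a)) *
      (\<Prod>\<beta>\<in>polys_below (degree p) - {0}. \<Prod>a\<in>polys_below n. h (p * a + \<beta>))"
    by (subst prod.remove[of _ 0]) auto
  also have "(\<Prod>a\<in>polys_below n. h (p * a)) = emb \<iota> p * E_part n z"
    unfolding E_part_def using assms by (subst prod.remove[of _ 0]) (auto simp: h_def emb_simps)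
  also have "(\<Prod>\<beta>\<in>polys_below (degree p) - {0}. \<Prod>a\<in>polys_below n. h (p * a + \<beta>)) =
    (\<Prod>\<beta>\<in>polys_below (degree p) - {0}. A.L n (z - emb \<iota> \<beta> / emb \<iota> p) / A.L n (- (emb \<iota> \<beta> / emb \<iota> p)))"
  proof (rule prod.cong)
    fix \<beta> :: "'a poly" assume \<beta>: "\<beta> \<in> polys_below (degree p) - {0}"
    have "h (p * a + \<beta>) = (z - emb \<iota> \<beta> / emb \<iota> p - emb \<iota> a) / (- (emb \<iota> \<beta> / emb \<iota> p) - emb \<iota> a)" for a
    proof -
      have "p * a + \<beta> \<noteq> 0"
      proof
        assume "p * a + \<beta> = 0"
        then have pa: "p * a = - \<beta>"
          by (simp add: eq_neg_iff_add_eq_0)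
        with \<beta> have "a \<noteq> 0"
          by auto
        then have "degree p \<le> degree (p * a)"
          using assms by (simp add: degree_mult_eq)
        then show False
          using \<beta> by (auto simp: pa polys_below_iff)
      qed
      define s where "s = emb \<iota> a + emb \<iota> \<beta> / emb \<iota> p"
      have ps: "emb \<iota> (p * a + \<beta>) = emb \<iota> p * s"
        using assms by (simp add: s_def emb_simps distrib_left)
      have "s \<noteq> 0"
        using ps \<open>p * a + \<beta> \<noteq> 0\<close> emb_eq_0_iff[of "p * a + \<beta>"] by auto
      have "h (p * a + \<beta>) = 1 - z / s"
        using \<open>p * a + \<beta> \<noteq> 0\<close> assms by (simp add: h_def ps)
      also have "\<dots> = (z - s) / (- s)"
        using \<open>s \<noteq> 0\<close> by (simp add: diff_divide_distrib)
      finally have "h (p * a + \<beta>) = (z - s) / (- s)" .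
      moreover have "z - s = z - emb \<iota> \<beta> / emb \<iota> p - emb \<iota> a" "- s = - (emb \<iota> \<beta> / emb \<iota> p) - emb \<iota> a"
        by (simp_all add: s_def)
      ultimately show ?thesis
        by (simp only:)
    qed
    then show "(\<Prod>a\<in>polys_below n. h (p * a + \<beta>)) =
        A.L n (z - emb \<iota> \<beta> / emb \<iota> p) / A.L n (- (emb \<iota> \<beta> / emb \<iota> p))"
      by (simp add: A.L_def prod_dividef)
  qed simp
  finally show ?thesis .
qed

text \<open>The functional equation: E(p z) is a polynomial in E(z) whose roots are the torsion
  points and whose linear coefficient is p.\<close>

lemma E_mult:
  assumes "p \<noteq> 0"
  shows "E (emb \<iota> p * z) = emb \<iota> p / (\<Prod>\<beta>\<in>polys_below (degree p) - {0}. - torsion p \<beta>) *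
    (\<Prod>\<beta>\<in>polys_below (degree p). E z - torsion p \<beta>)"
proof (rule LIMSEQ_unique)
  show "(\<lambda>n. E_part (n + degree p) (emb \<iota> p * z)) \<longlonglongrightarrow> E (emb \<iota> p * z)"
    using E_lim(1) by (rule LIMSEQ_ignore_initial_segment)
  \<comment> \<open>The normalising constants cancel in quotients, so these have limits although
    \<open>A.L n\<close> itself is not normalised.\<close>
  have ratio: "A.L n x / A.L n y = E_part n x / E_part n y" for n x y
    by (simp add: E_part_conv_L)
  have ratio_prod: "(\<Prod>\<beta>\<in>polys_below (degree p) - {0}. E (z - emb \<iota> \<beta> / emb \<iota> p) / E (- (emb \<iota> \<beta> / emb \<iota> p))) =
      (\<Prod>\<beta>\<in>polys_below (degree p) - {0}. E z - torsion p \<beta>) / (\<Prod>\<beta>\<in>polys_below (degree p) - {0}. - torsion p \<beta>)"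
    unfolding prod_dividef[symmetric] by (simp only: E_diff E_uminus torsion_def)
  have lim: "(\<lambda>n. E_part n (z - emb \<iota> \<beta> / emb \<iota> p) / E_part n (- (emb \<iota> \<beta> / emb \<iota> p)))
      \<longlonglongrightarrow> E (z - emb \<iota> \<beta> / emb \<iota> p) / E (- (emb \<iota> \<beta> / emb \<iota> p))"
    if "\<beta> \<in> polys_below (degree p) - {0}" for \<beta>
    using torsion_neq_0[OF assms that]
    by (intro tendsto_divide_ultrametric E_lim(1)) (simp add: E_uminus torsion_def)
  have "(\<lambda>n. E_part (n + degree p) (emb \<iota> p * z)) \<longlonglongrightarrow> emb \<iota> p * E z *
    (\<Prod>\<beta>\<in>polys_below (degree p) - {0}. E (z - emb \<iota> \<beta> / emb \<iota> p) / E (- (emb \<iota> \<beta> / emb \<iota> p)))"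
    unfolding E_mult_aux[OF assms] ratio
    by (intro tendsto_mult tendsto_const E_lim(1) tendsto_prod' lim)
  moreover have "(\<Prod>\<beta>\<in>polys_below (degree p). E z - torsion p \<beta>) =
      E z * (\<Prod>\<beta>\<in>polys_below (degree p) - {0}. E z - torsion p \<beta>)"
    by (subst prod.remove[of _ 0]) (auto simp: scalar_linear.\<Phi>_0[OF scalar_linear_torsion])
  ultimately show "(\<lambda>n. E_part (n + degree p) (emb \<iota> p * z)) \<longlonglongrightarrow>
      emb \<iota> p / (\<Prod>\<beta>\<in>polys_below (degree p) - {0}. - torsion p \<beta>) *
      (\<Prod>\<beta>\<in>polys_below (degree p). E z - torsion p \<beta>)"
    by (simp add: ratio_prod mult.assoc)
qed

end

section \<open>Expansions at infinity and Hecke operators\<close>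

lemma lattice_exp_scale:
  fixes c :: "'c::complete_ultrametric_field"
  assumes "c \<noteq> 0"
  shows "lattice_exp ((*) c ` \<Lambda>) (c * z) = c * lattice_exp \<Lambda> z"
proof -
  have inj: "inj_on ((*) c) S" for S
    using assms by (simp add: inj_on_def)
  have "(*) c ` \<Lambda> - {0} = (*) c ` (\<Lambda> - {0})"
    using assms by auto
  then have "Lim (finite_subsets_at_top ((*) c ` \<Lambda> - {0})) (\<lambda>F. \<Prod>\<omega>\<in>F. 1 - c * z / \<omega>) =
      Lim (filtermap ((`) ((*) c)) (finite_subsets_at_top (\<Lambda> - {0}))) (\<lambda>F. \<Prod>\<omega>\<in>F. 1 - c * z / \<omega>)"
    using filtermap_image_finite_subsets_at_top[OF inj] by metis
  also have "\<dots> = Lim (finite_subsets_at_top (\<Lambda> - {0})) (\<lambda>F. \<Prod>\<omega>\<in>F. 1 - z / \<omega>)"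
  proof -
    have "(\<Prod>\<omega>\<in>(*) c ` F. 1 - c * z / \<omega>) = (\<Prod>\<omega>\<in>F. 1 - z / \<omega>)" for F
      using assms by (simp add: prod.reindex[OF inj])
    then show ?thesis
      unfolding Topological_Spaces.Lim_def filterlim_filtermap by simp
  qed
  finally show ?thesis
    by (simp add: lattice_exp_def)
qed

context C_infinity
begin

section \<open>Expansions in 1/E and affine substitutions\<close>

lemma far_mono: "far R z \<Longrightarrow> R' \<le> R \<Longrightarrow> far R' z"
  by (auto simp: far_def intro: order_trans)

lemma far_affine:
  assumes "far R z" "u \<in> range \<iota>" "v \<in> range \<iota>" "u \<noteq> 0"
  shows "far (absval u * R) (u * z + v)"
  unfolding far_def
proof
  fix x assume "x \<in> range \<iota>"
  then have "(x - v) / u \<in> range \<iota>"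
    using assms by (intro range_iota_closed)
  then have "R \<le> absval (z - (x - v) / u)"
    using assms(1) unfolding far_def by blast
  then have "absval u * R \<le> absval (u * (z - (x - v) / u))"
    by (simp add: absval_mult mult_left_mono)
  also have "u * (z - (x - v) / u) = u * z + v - x"
    using assms by (simp add: field_simps)
  finally show "absval u * R \<le> absval (u * z + v - x)" .
qed

text \<open>A common parameter for all cusps: the functions \<open>t_param\<close> arise from 1/E by
  constant factors and a scaling of z.\<close>

definition E_exp :: "('c \<Rightarrow> 'c) \<Rightarrow> (nat \<Rightarrow> 'c) \<Rightarrow> bool" where
  "E_exp g a \<longleftrightarrow> (\<exists>R>0. \<forall>z. far R z \<longrightarrow> (\<lambda>i. a i * (1 / E z) ^ i) sums g z)"

lemma E_exp_add:
  assumes "E_exp g a" "E_exp h b"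
  shows "E_exp (\<lambda>z. g z + h z) (\<lambda>i. a i + b i)"
proof -
  obtain R where R: "R > 0" "\<And>z. far R z \<Longrightarrow> (\<lambda>i. a i * (1 / E z) ^ i) sums g z"
    using assms(1) by (auto simp: E_exp_def)
  obtain S where S: "S > 0" "\<And>z. far S z \<Longrightarrow> (\<lambda>i. b i * (1 / E z) ^ i) sums h z"
    using assms(2) by (auto simp: E_exp_def)
  have "(\<lambda>i. (a i + b i) * (1 / E z) ^ i) sums (g z + h z)" if "far (max R S) z" for z
    using sums_add[OF R(2) S(2)] far_mono[OF that] by (simp add: distrib_right)
  then show ?thesis
    using R(1) unfolding E_exp_def by (intro exI[of _ "max R S"]) auto
qed

lemma E_exp_mult:
  assumes "E_exp g a"
  shows "E_exp (\<lambda>z. c * g z) (\<lambda>i. c * a i)"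
proof -
  obtain R where R: "R > 0" "\<And>z. far R z \<Longrightarrow> (\<lambda>i. a i * (1 / E z) ^ i) sums g z"
    using assms by (auto simp: E_exp_def)
  have "(\<lambda>i. c * a i * (1 / E z) ^ i) sums (c * g z)" if "far R z" for z
    using sums_mult_ultrametric[OF R(2)[OF that], of c] by (simp only: mult.assoc)
  then show ?thesis
    using R(1) unfolding E_exp_def by blast
qed

text \<open>Points with positive distance to \<open>K_\<infinity>\<close> lie in Omega, so arbitrary
  values elsewhere do not matter.\<close>

lemma E_exp_cong:
  assumes "E_exp g a" "\<And>z. z \<notin> range \<iota> \<Longrightarrow> g z = h z"
  shows "E_exp h a"
proof -
  have "z \<notin> range \<iota>" if "far R z" "R > 0" for R z
  proof
    assume "z \<in> range \<iota>"
    then have "R \<le> absval (z - z)"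
      using that(1) unfolding far_def by blast
    then show False
      using that(2) by simp
  qed
  then show ?thesis
    using assms unfolding E_exp_def by metis
qed

text \<open>The terms of a convergent series tend to zero and are therefore bounded; convergence at
  one point already bounds all coefficients.\<close>

lemma absval_coeff_bound:
  assumes "(\<lambda>i. a i * (1 / w) ^ i) sums s" "w \<noteq> 0"
  shows "\<exists>B. \<forall>i. absval (a i) \<le> B * absval w ^ i"
proof -
  have "(\<lambda>i. absval (a i * (1 / w) ^ i)) \<longlonglongrightarrow> 0"
    using sums_imp_tendsto_0[OF assms(1)] by (simp add: tendsto_absval_iff)
  then have "Bseq (\<lambda>i. absval (a i * (1 / w) ^ i))"
    by (intro convergent_imp_Bseq convergentI)
  then obtain B where "\<And>i. absval (a i * (1 / w) ^ i) \<le> B"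
    unfolding Bseq_def by auto
  then have "absval (a i) / absval w ^ i \<le> B" for i
    by (simp add: absval_mult absval_power absval_divide power_divide)
  then have "absval (a i) \<le> B * absval w ^ i" for i
    using assms(2) by (simp add: pos_divide_le_eq)
  then show ?thesis
    by blast
qed

text \<open>Serves both for multiplication by p, where Q has degree at least 2, and for
  translations, where Q is linear and \<open>a 1\<close> must vanish.\<close>

lemma E_exp_subst:
  assumes g: "E_exp g a" "a 0 = 0" "a 1 = 0 \<or> 2 \<le> degree Q"
    and Q: "0 < degree Q" "\<And>z. E (u * z + v) = poly Q (E z)"
    and u: "u \<in> range \<iota>" "v \<in> range \<iota>" "u \<noteq> 0"
  obtains b where "E_exp (\<lambda>z. g (u * z + v)) b" "b 0 = 0" "b 1 = 0"
proof -
  obtain R where R: "R > 0" "\<And>z. far R z \<Longrightarrow> (\<lambda>i. a i * (1 / E z) ^ i) sums g z"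
    using g(1) by (auto simp: E_exp_def)
  have u_pos: "0 < absval u"
    using u by simp
  have far: "far R (u * z + v)" if "far R' z" "R / absval u \<le> R'" for z R'
  proof -
    have "R \<le> absval u * R'"
      using that(2) u_pos by (simp add: field_simps)
    then show ?thesis
      using far_affine[OF that(1) u] far_mono by blast
  qed
  have Ru: "0 < R / absval u"
    using R u_pos by simp
  show ?thesis
  proof (cases "\<exists>w. far R w")
    case False
    \<comment> \<open>The coefficient bound below needs a point where the series converges; with no
      such point any coefficients will do, because the claim is vacuous at a suitable
      radius.\<close>
    then have "E_exp (\<lambda>z. g (u * z + v)) (\<lambda>i. 0)"
      unfolding E_exp_def using far Ru by blast
    then show ?thesis
      by (rule that) auto
  next
    case True
    then obtain w where w: "far R w"
      by blast
    then have "E w \<noteq> 0"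
      using absval_E_ge[of R w] R by auto
    then obtain B where B: "\<And>i. absval (a i) \<le> B * absval (E w) ^ i"
      using absval_coeff_bound[OF R(2)[OF w]] by blast
    obtain b r where b: "0 < r" "b 0 = 0" "b 1 = 0"
      "\<forall>x s. absval x > r \<longrightarrow> (\<lambda>i. a i * (1 / poly Q x) ^ i) sums s \<longrightarrow> (\<lambda>j. b j * (1 / x) ^ j) sums s"
      using sums_subst_inverse_poly[OF B absval_nonneg Q(1) g(2,3)] by blast
    define R' where "R' = max (R / absval u) (r + 1)"
    have R': "R / absval u \<le> R'" "0 < R'"
      using b(1) by (auto simp: R'_def)
    have "(\<lambda>j. b j * (1 / E z) ^ j) sums g (u * z + v)" if "far R' z" for z
    proof (rule b(4)[rule_format])
      show "r < absval (E z)"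
        using absval_E_ge[OF that] R' by (simp add: R'_def)
      show "(\<lambda>i. a i * (1 / poly Q (E z)) ^ i) sums g (u * z + v)"
        using R(2)[OF far[OF that R'(1)]] by (simp add: Q)
    qed
    then have "E_exp (\<lambda>z. g (u * z + v)) b"
      using R'(2) unfolding E_exp_def by blast
    then show ?thesis
      using b(2,3) by (rule that)
  qed
qed

text \<open>By additivity the substitution is x to x + E(v). It is needed for v outside A as well,
  where E(v) does not vanish.\<close>

lemma E_exp_translate:
  assumes "E_exp g a" "a 0 = 0" "a 1 = 0" "v \<in> range \<iota>"
  obtains b where "E_exp (\<lambda>z. g (z + v)) b" "b 0 = 0" "b 1 = 0"
proof (rule E_exp_subst[OF assms(1,2), of "[:E v, 1:]" 1 v])
  show "1 \<in> range \<iota>"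
    using iota_simps(1) by (metis rangeI)
qed (use assms that in \<open>auto simp: E_add add.commute\<close>)

section \<open>The two parts of the Hecke operator at infinity\<close>

context
  fixes p :: "'a poly"
  assumes p: "0 < degree p"
begin

lemma p_nonzero: "p \<noteq> 0"
  using p by auto

lemma E_exp_hecke_1:
  assumes "E_exp g a" "a 0 = 0"
  obtains b where "E_exp (\<lambda>z. g (emb \<iota> p * z)) b" "b 0 = 0" "b 1 = 0"
proof -
  define c where "c = emb \<iota> p / (\<Prod>\<beta>\<in>polys_below (degree p) - {0}. - torsion p \<beta>)"
  define Q where "Q = Polynomial.smult c (\<Prod>\<beta>\<in>polys_below (degree p). [:- torsion p \<beta>, 1:])"
  have "c \<noteq> 0"
    using torsion_neq_0[OF p_nonzero] p_nonzero by (auto simp: c_def)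
  then have "degree Q = CARD('a) ^ degree p"
    unfolding Q_def degree_smult_eq by (subst degree_prod_sum_eq) (auto simp: card_polys_below)
  moreover have "CARD('a) ^ 1 \<le> CARD('a) ^ degree p"
    using p by (intro power_increasing) auto
  ultimately have Q: "2 \<le> degree Q"
    using card_finite_field_gt_1[where 'a = 'a] by simp
  have zero: "0 \<in> range \<iota>"
    using iota_simps(4) by (metis rangeI)
  have "E (emb \<iota> p * z + 0) = poly Q (E z)" for z
    by (simp add: E_mult[OF p_nonzero] Q_def c_def poly_prod)
  from E_exp_subst[OF assms _ _ this emb_in_range zero] show ?thesis
    using Q p_nonzero that by auto
qed

text \<open>The values E((z - b) / p) are the roots E(z / p) - torsion of one additive polynomial,
  so \<open>sums_subst_power_sum\<close> applies with s = P(E(z / p)).\<close>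

lemma E_exp_hecke_2:
  assumes g: "E_exp g a" "a 0 = 0"
  obtains b where "E_exp (\<lambda>z. \<Sum>\<beta> | degree \<beta> < degree p. g ((z + emb \<iota> \<beta>) / emb \<iota> p)) b"
    "b 0 = 0" "b 1 = emb \<iota> p * a 1"
proof -
  define W where "W = (polys_below (degree p) :: 'a poly set)"
  define G where "G z = (\<Sum>\<beta> | degree \<beta> < degree p. g ((z + emb \<iota> \<beta>) / emb \<iota> p))" for z
  \<comment> \<open>The residues are closed under negation; the minus sign matches the roots x -
    torsion.\<close>
  have G: "G z = (\<Sum>\<beta>\<in>W. g ((z - emb \<iota> \<beta>) / emb \<iota> p))" for z
    unfolding G_def W_def polys_below_degree[OF p, symmetric]
    by (rule sum.reindex_bij_witness[of _ uminus uminus]) (auto simp: polys_below_def emb_simps)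
  have emb_p: "emb \<iota> p \<noteq> 0" "0 < absval (emb \<iota> p)"
    using p_nonzero by auto
  obtain R where R: "R > 0" "\<And>z. far R z \<Longrightarrow> (\<lambda>i. a i * (1 / E z) ^ i) sums g z"
    using g(1) by (auto simp: E_exp_def)
  have far: "far R ((z - emb \<iota> \<beta>) / emb \<iota> p)" if "far R' z" "R * absval (emb \<iota> p) \<le> R'" for z R' \<beta>
  proof -
    have one: "1 \<in> range \<iota>"
      using iota_simps(1) by (metis rangeI)
    have "far (absval (1 / emb \<iota> p) * R') (1 / emb \<iota> p * z + (- emb \<iota> \<beta>) / emb \<iota> p)"
      using that emb_p by (intro far_affine range_iota_closed one emb_in_range) auto
    moreover have "R \<le> absval (1 / emb \<iota> p) * R'"
      using that(2) emb_p by (simp add: absval_divide field_simps)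
    ultimately show ?thesis
      using far_mono by (simp add: diff_divide_distrib)
  qed
  have Rp: "0 < R * absval (emb \<iota> p)"
    using R emb_p by simp
  show ?thesis
  proof (cases "\<exists>w. far R w")
    case False
    \<comment> \<open>Vacuous case again, but the chosen sequence must still have the prescribed
      coefficient at index 1.\<close>
    then have "E_exp G (\<lambda>i. if i = 1 then emb \<iota> p * a 1 else 0)"
      unfolding E_exp_def using far Rp by blast
    then show ?thesis
      unfolding G_def by (rule that) auto
  next
    case True
    then obtain w where w: "far R w"
      by blast
    then have "E w \<noteq> 0"
      using absval_E_ge[of R w] R by auto
    then obtain B where B: "\<And>i. absval (a i) \<le> B * absval (E w) ^ i"
      using absval_coeff_bound[OF R(2)[OF w]] by blast
    define P where "P = (\<Prod>\<beta>\<in>W. fps_X - fps_const (torsion p \<beta>))"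
    define c where "c = (\<Prod>\<beta>\<in>W - {0}. - torsion p \<beta>)"
    have "torsion p \<beta> \<noteq> 0" if "\<beta> \<in> W - {0}" for \<beta>
      using torsion_neq_0[OF p_nonzero] that by (auto simp: W_def)
    then have c0: "c \<noteq> 0"
      by (auto simp: c_def W_def)
    note P = fps_linear_prod[OF scalar_linear_torsion[of p], where n = "degree p", folded W_def, folded P_def c_def]
    obtain b r where b: "0 < r" "b 0 = 0" "b 1 = c * a 1" and
      subst: "\<forall>(W :: 'a poly set) y s g. finite W \<longrightarrow> (\<forall>w\<in>W. y w \<noteq> 0) \<longrightarrow>
       (\<Prod>w\<in>W. fps_const (y w) - fps_X) = fps_const s - P \<longrightarrow> absval s > r \<longrightarrow>
       (\<lambda>i. a i * (\<Sum>w\<in>W. 1 / y w ^ i)) sums g \<longrightarrow> (\<lambda>j. b j * (1 / s) ^ j) sums g"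
      by (rule sums_subst_power_sum[OF B absval_nonneg g(2) P(2,3), where ?'b = "'a poly", THEN exE])
        (rule P(4), assumption, elim exE conjE, rule that, assumption+)
    \<comment> \<open>By \<open>E_mult\<close> at z / p, E(z) = d s. Passing from powers of 1 / s to
      powers of 1 / E(z) multiplies the coefficient j by \<open>d ^ j\<close>, and at j = 1 the
      constant c cancels, leaving the eigenvalue p.\<close>
    define d where "d = emb \<iota> p / c"
    have d: "d \<noteq> 0"
      using c0 emb_p by (simp add: d_def)
    define R' where "R' = max (R * absval (emb \<iota> p)) (absval d * (r + 1))"
    have R': "R * absval (emb \<iota> p) \<le> R'" "0 < R'"
      using Rp by (auto simp: R'_def)
    have "(\<lambda>j. (b j * d ^ j) * (1 / E z) ^ j) sums G z" if "far R' z" for z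
    proof -
      define s where "s = (\<Prod>\<beta>\<in>W. E (z / emb \<iota> p) - torsion p \<beta>)"
      have Ez: "E z = d * s"
        using E_mult[OF p_nonzero, of "z / emb \<iota> p"] emb_p by (simp add: d_def c_def s_def W_def)
      have "absval d * (r + 1) \<le> absval d * absval s"
        using absval_E_ge[OF that] R' by (simp add: R'_def Ez absval_mult)
      then have s: "r < absval s"
        using d by simp
      then have "s \<noteq> 0"
        using b(1) by auto
      have y: "E ((z - emb \<iota> \<beta>) / emb \<iota> p) = E (z / emb \<iota> p) - torsion p \<beta>" for \<beta>
        by (simp add: diff_divide_distrib E_diff torsion_def)
      have "(\<lambda>j. b j * (1 / s) ^ j) sums G z"
      proof (rule subst[rule_format])
        show "finite W"
          by (simp add: W_def)
        show "(\<Prod>\<beta>\<in>W. fps_const (E (z / emb \<iota> p) - torsion p \<beta>) - fps_X) = fps_const s - P"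
          unfolding s_def by (rule P(1))
        show "E (z / emb \<iota> p) - torsion p \<beta> \<noteq> 0" if "\<beta> \<in> W" for \<beta>
          using \<open>s \<noteq> 0\<close> that by (auto simp: s_def W_def)
        have "(\<lambda>i. \<Sum>\<beta>\<in>W. a i * (1 / E ((z - emb \<iota> \<beta>) / emb \<iota> p)) ^ i) sums G z"
          unfolding G by (intro sums_sum R(2) far[OF that R'(1)])
        then show "(\<lambda>i. a i * (\<Sum>\<beta>\<in>W. 1 / (E (z / emb \<iota> p) - torsion p \<beta>) ^ i)) sums G z"
          by (simp add: y sum_distrib_left power_one_over)
      qed (rule s)
      moreover have "(b j * d ^ j) * (1 / E z) ^ j = b j * (1 / s) ^ j" for j
        using d by (simp add: Ez power_divide power_mult_distrib)
      ultimately show ?thesis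
        by (simp only:)
    qed
    then have "E_exp G (\<lambda>j. b j * d ^ j)"
      using R'(2) unfolding E_exp_def by blast
    moreover have "b 1 * d ^ 1 = emb \<iota> p * a 1"
      using b c0 by (simp add: d_def)
    ultimately show ?thesis
      unfolding G_def using b(2) by (intro that[of "\<lambda>j. b j * d ^ j"]) auto
  qed
qed

lemma E_exp_hecke:
  assumes "E_exp g a" "a 0 = 0"
  obtains b where "E_exp (\<lambda>z. hecke \<iota> k p g z - emb \<iota> p * g z) b" "b 0 = 0" "b 1 = 0"
proof -
  obtain b1 where b1: "E_exp (\<lambda>z. g (emb \<iota> p * z)) b1" "b1 0 = 0" "b1 1 = 0"
    using E_exp_hecke_1[OF assms] by blast
  obtain b2 where b2: "E_exp (\<lambda>z. \<Sum>\<beta> | degree \<beta> < degree p. g ((z + emb \<iota> \<beta>) / emb \<iota> p)) b2"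
    "b2 0 = 0" "b2 1 = emb \<iota> p * a 1"
    using E_exp_hecke_2[OF assms] by blast
  have "E_exp (\<lambda>z. hecke \<iota> k p g z - emb \<iota> p * g z) (\<lambda>i. emb \<iota> p ^ k * b1 i + b2 i + - emb \<iota> p * a i)"
    using E_exp_add[OF E_exp_add[OF E_exp_mult[OF b1(1), of "emb \<iota> p ^ k"] b2(1)]
        E_exp_mult[OF assms(1), of "- emb \<iota> p"]]
    by (simp add: hecke_def)
  then show ?thesis
    by (rule that) (use b1 b2 assms(2) in simp_all)
qed

end

text \<open>The lattice of the ideal (D) is the multiple c A with
  \<open>c = \<pi> * emb \<iota> D\<close>, and lattice exponentials are homogeneous of degree
  1.\<close>

lemma t_param_conv_E:
  assumes "\<pi> \<noteq> 0" "D \<noteq> 0"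
  shows "t_param \<iota> \<pi> {b. D dvd b} z = 1 / (\<pi> * emb \<iota> D * E (z / emb \<iota> D))"
proof -
  define c where "c = \<pi> * emb \<iota> D"
  have c: "c \<noteq> 0"
    using assms by (simp add: c_def)
  have "(\<lambda>a. \<pi> * emb \<iota> a) ` {b. D dvd b} = (*) c ` range (emb \<iota>)"
  proof -
    have "{b. D dvd b} = range ((*) D)"
      by (auto simp: dvd_def)
    then show ?thesis
      by (simp add: image_image c_def emb_simps mult.assoc)
  qed
  then have "t_param \<iota> \<pi> {b. D dvd b} z = 1 / lattice_exp ((*) c ` range (emb \<iota>)) (c * (z / emb \<iota> D))"
    using assms by (simp add: t_param_def c_def)
  also have "\<dots> = 1 / (c * E (z / emb \<iota> D))"
    by (simp only: lattice_exp_scale[OF c] E_def)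
  finally show ?thesis
    by (simp add: c_def)
qed

text \<open>At D z the parameter of the ideal (D) is a constant multiple of 1 / E(z). Scaling by D
  multiplies the distance to \<open>K_\<infinity>\<close> by the absolute value of D, so the radii
  correspond.\<close>

lemma has_t_expansion_iff_E_exp:
  assumes "\<pi> \<noteq> 0" "D \<noteq> 0"
  shows "has_t_expansion \<iota> \<pi> {b. D dvd b} g a \<longleftrightarrow>
    E_exp (\<lambda>z. g (emb \<iota> D * z)) (\<lambda>i. a i * (1 / (\<pi> * emb \<iota> D)) ^ i)"
proof -
  have D: "emb \<iota> D \<noteq> 0" "0 < absval (emb \<iota> D)"
    using assms by auto
  have zero: "0 \<in> range \<iota>" and one: "1 \<in> range \<iota>"
    using iota_simps(1,4) by (metis rangeI)+
  have summand: "a i * t_param \<iota> \<pi> {b. D dvd b} (emb \<iota> D * z) ^ i =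
      a i * (1 / (\<pi> * emb \<iota> D)) ^ i * (1 / E z) ^ i" for i z
    using D by (simp add: t_param_conv_E[OF assms] power_divide power_mult_distrib)
  have conv: "has_t_expansion \<iota> \<pi> {b. D dvd b} g a \<longleftrightarrow>
      (\<exists>R>0. \<forall>z. far R z \<longrightarrow> (\<lambda>i. a i * t_param \<iota> \<pi> {b. D dvd b} z ^ i) sums g z)"
    by (simp add: has_t_expansion_def far_def)
  show ?thesis
  proof
    assume "has_t_expansion \<iota> \<pi> {b. D dvd b} g a"
    then obtain R where R: "R > 0" "\<And>z. far R z \<Longrightarrow> (\<lambda>i. a i * t_param \<iota> \<pi> {b. D dvd b} z ^ i) sums g z"
      using conv by blast
    have "(\<lambda>i. a i * (1 / (\<pi> * emb \<iota> D)) ^ i * (1 / E z) ^ i) sums g (emb \<iota> D * z)"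
      if "far (R / absval (emb \<iota> D)) z" for z
    proof -
      have "far R (emb \<iota> D * z)"
        using far_affine[OF that emb_in_range[of D] zero] D by simp
      from R(2)[OF this] show ?thesis
        unfolding summand .
    qed
    then show "E_exp (\<lambda>z. g (emb \<iota> D * z)) (\<lambda>i. a i * (1 / (\<pi> * emb \<iota> D)) ^ i)"
      unfolding E_exp_def using R(1) D by (intro exI[of _ "R / absval (emb \<iota> D)"]) auto
  next
    assume E: "E_exp (\<lambda>z. g (emb \<iota> D * z)) (\<lambda>i. a i * (1 / (\<pi> * emb \<iota> D)) ^ i)"
    obtain R where R: "R > 0"
      "\<And>z. far R z \<Longrightarrow> (\<lambda>i. a i * (1 / (\<pi> * emb \<iota> D)) ^ i * (1 / E z) ^ i) sums g (emb \<iota> D * z)"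
      using E by (auto simp: E_exp_def)
    have "(\<lambda>i. a i * t_param \<iota> \<pi> {b. D dvd b} z ^ i) sums g z" if "far (R * absval (emb \<iota> D)) z" for z
    proof -
      have "far R (1 / emb \<iota> D * z)"
        using far_affine[OF that range_iota_closed(4)[OF one emb_in_range[of D]] zero] D
        by (simp add: absval_divide)
      from R(2)[OF this, folded summand] show ?thesis
        using D by simp
    qed
    then show "has_t_expansion \<iota> \<pi> {b. D dvd b} g a"
      unfolding conv using R(1) D by (intro exI[of _ "R * absval (emb \<iota> D)"]) auto
  qed
qed

end

no_notation fps_nth (infixl "$" 75)

section \<open>Modularity and Hecke operators\<close>

definition mat2 :: "'r::zero \<Rightarrow> 'r \<Rightarrow> 'r \<Rightarrow> 'r \<Rightarrow> 'r ^ 2 ^ 2" where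
  "mat2 a b c d = vector [vector [a, b], vector [c, d]]"

lemma mat2_nth [simp]:
  "mat2 a b c d $ 1 $ 1 = a" "mat2 a b c d $ 1 $ 2 = b"
  "mat2 a b c d $ 2 $ 1 = c" "mat2 a b c d $ 2 $ 2 = d"
  by (simp_all add: mat2_def)

lemma translation_nth [simp]:
  "translation b $ 1 $ 1 = 1" "translation b $ 1 $ 2 = b"
  "translation b $ 2 $ 1 = 0" "translation b $ 2 $ 2 = 1"
  by (simp_all add: translation_def)

lemma mat_nth_2 [simp]:
  fixes x :: "'r::zero"
  shows "(mat x :: 'r ^ 2 ^ 2) $ 1 $ 1 = x" "(mat x :: 'r ^ 2 ^ 2) $ 1 $ 2 = 0"
  "(mat x :: 'r ^ 2 ^ 2) $ 2 $ 1 = 0" "(mat x :: 'r ^ 2 ^ 2) $ 2 $ 2 = x"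
  by (simp_all add: mat_def)

lemma matrix_mult_2_nth:
  fixes A B :: "'r::semiring_1 ^ 2 ^ 2"
  shows "(A ** B) $ i $ j = A $ i $ 1 * B $ 1 $ j + A $ i $ 2 * B $ 2 $ j"
  by (simp add: matrix_matrix_mult_def sum_2)

lemma matrix_2_eq_iff:
  "A = (B :: 'r ^ 2 ^ 2) \<longleftrightarrow> A $ 1 $ 1 = B $ 1 $ 1 \<and> A $ 1 $ 2 = B $ 1 $ 2 \<and>
     A $ 2 $ 1 = B $ 2 $ 1 \<and> A $ 2 $ 2 = B $ 2 $ 2"
  by (simp add: vec_eq_iff forall_2)

lemma det_mat2 [simp]: "det (mat2 a b c d) = a * d - b * c"
  by (simp add: det_2)

text \<open>The adjugate, a denominator-free substitute for the inverse: Hecke matrices have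
  determinant p and are not invertible over A.\<close>

definition adj2 :: "'r::comm_ring_1 ^ 2 ^ 2 \<Rightarrow> 'r ^ 2 ^ 2" where
  "adj2 M = mat2 (M $ 2 $ 2) (- M $ 1 $ 2) (- M $ 2 $ 1) (M $ 1 $ 1)"

lemma mult_adj2: "M ** adj2 M = mat (det M)" "adj2 M ** M = mat (det M)"
  by (auto simp: matrix_2_eq_iff matrix_mult_2_nth adj2_def det_2 algebra_simps)

lemma adj2_mult: "adj2 (M ** N) = adj2 N ** adj2 M"
  by (auto simp: matrix_2_eq_iff matrix_mult_2_nth adj2_def algebra_simps)

lemma mat_mult_nth_2:
  fixes M :: "'r::comm_ring_1 ^ 2 ^ 2"
  shows "(mat c ** M) $ i $ j = c * M $ i $ j" "(M ** mat c) $ i $ j = M $ i $ j * c"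
  using exhaust_2[of i] exhaust_2[of j] by (auto simp: matrix_mult_2_nth)

lemma mat_mult_commute_2: "M ** mat c = mat c ** (M :: 'r::comm_ring_1 ^ 2 ^ 2)"
  by (simp add: matrix_2_eq_iff mat_mult_nth_2 mult.commute)

lemma mat_mult_mat_2: "(mat x ** mat y :: 'r::comm_ring_1 ^ 2 ^ 2) = mat (x * y)"
  by (auto simp: matrix_2_eq_iff matrix_mult_2_nth)

lemma GL2_A_iff: "\<delta> \<in> GL2_A \<longleftrightarrow> (\<exists>u\<noteq>0. det \<delta> = [:u:])"
proof
  assume "\<delta> \<in> GL2_A"
  then obtain B where "\<delta> ** B = mat 1"
    by (auto simp: GL2_A_def invertible_def)
  then have "det \<delta> * det B = 1"
    by (metis det_I det_mul)
  then have "det \<delta> dvd 1"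
    by (metis dvd_triv_left)
  then show "\<exists>u\<noteq>0. det \<delta> = [:u:]"
    by (metis degree_eq_zeroE is_unit_iff_degree is_unit_pCons_iff not_is_unit_0 dvd_field_iff)
next
  assume "\<exists>u\<noteq>0. det \<delta> = [:u:]"
  then obtain u where u: "u \<noteq> 0" "det \<delta> = [:u:]"
    by blast
  define B where "B = mat [:inverse u:] ** adj2 \<delta>"
  have "B ** \<delta> = mat 1"
    unfolding B_def matrix_mul_assoc[symmetric] mult_adj2 using u by (simp add: mat_mult_mat_2 one_pCons)
  moreover have "\<delta> ** B = mat 1"
    unfolding B_def matrix_mul_assoc mat_mult_commute_2 
    unfolding matrix_mul_assoc[symmetric] mult_adj2 using u by (simp add: mat_mult_mat_2 one_pCons)
  ultimately show "\<delta> \<in> GL2_A"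
    by (auto simp: GL2_A_def invertible_def)
qed

lemma Gamma0_T_iff: "\<gamma> \<in> Gamma0_T \<longleftrightarrow> (\<exists>u\<noteq>0. det \<gamma> = [:u:]) \<and> [:0, 1:] dvd \<gamma> $ 2 $ 1"
  by (simp add: Gamma0_T_def GL2_A_iff)

section \<open>Cosets of matrices of prime determinant\<close>

lemma prime_elem_T: "prime_elem [:0, 1 :: 'a::field:]"
proof (rule prime_elemI)
  fix a b :: "'a poly"
  assume "[:0, 1:] dvd a * b"
  then have "poly a 0 * poly b 0 = 0"
    using poly_eq_0_iff_dvd[of "a * b" 0] by simp
  then show "[:0, 1:] dvd a \<or> [:0, 1:] dvd b"
    using poly_eq_0_iff_dvd[of a 0] poly_eq_0_iff_dvd[of b 0] by auto
qed (auto simp: is_unit_iff_degree)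

lemma degree_prime_elem_pos:
  fixes p :: "'a::field poly"
  assumes "prime_elem p"
  shows "0 < degree p"
proof -
  have "p \<noteq> 0" "\<not> p dvd 1"
    using assms by auto
  then show ?thesis
    using is_unit_iff_degree[of p] by simp
qed

lemma polys_below_dvd_diff:
  fixes p :: "'a::field poly"
  assumes "x \<in> polys_below (degree p)" "y \<in> polys_below (degree p)" "p dvd x - y"
  shows "x = y"
proof (rule ccontr)
  assume "x \<noteq> y"
  then have "degree p \<le> degree (x - y)"
    using assms(3) by (intro dvd_imp_degree_le) auto
  moreover have "x - y \<in> polys_below (degree p)"
    using assms by (auto simp: polys_below_def)
  ultimately show False
    using \<open>x \<noteq> y\<close> by (auto simp: polys_below_iff)
qed

text \<open>Multiplication by a is injective on the finite set of residues modulo p, hence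
  surjective.\<close>

lemma linear_congruence_prime:
  fixes p :: "'a::{field,finite} poly"
  assumes p: "prime_elem p" and a: "\<not> p dvd a"
  shows "\<exists>\<beta>\<in>polys_below (degree p). p dvd b - a * \<beta>"
proof -
  define W where "W = (polys_below (degree p) :: 'a poly set)"
  define h where "h \<beta> = (a * \<beta>) mod p" for \<beta>
  have p0: "p \<noteq> 0"
    using p by auto
  have mod_W: "x mod p \<in> W" for x
    using degree_mod_less[OF p0, of x] by (auto simp: W_def polys_below_iff)
  have "inj_on h W"
  proof (rule inj_onI)
    fix x y assume xy: "x \<in> W" "y \<in> W" "h x = h y"
    then have "p dvd a * (x - y)"
      by (simp add: h_def mod_eq_dvd_iff right_diff_distrib)
    then have "p dvd x - y"
      using p a by (auto simp: prime_elem_dvd_mult_iff)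
    then show "x = y"
      using xy polys_below_dvd_diff unfolding W_def by blast
  qed
  then have "h ` W = W"
    using mod_W by (intro endo_inj_surj) (auto simp: W_def h_def)
  then have "b mod p \<in> h ` W"
    using mod_W by simp
  then obtain \<beta> where \<beta>: "\<beta> \<in> W" "b mod p = h \<beta>"
    by blast
  from \<beta>(2) have "p dvd b - a * \<beta>"
    unfolding h_def by (simp only: mod_eq_dvd_iff)
  then show ?thesis
    using \<beta>(1) unfolding W_def by blast
qed

text \<open>
  Representatives of \<open>\<Gamma>\<^sub>0(T)\<close>-cosets of matrices of determinant \<open>p\<close>, up to units.
\<close>

definition hecke_index :: "'a::{field,finite} poly \<Rightarrow> 'a poly option set" where
  "hecke_index p = insert None (Some ` polys_below (degree p))"

fun hecke_rep :: "'a::field poly \<Rightarrow> 'a poly option \<Rightarrow> 'a poly ^ 2 ^ 2" where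
  "hecke_rep p None = mat2 p 0 0 1"
| "hecke_rep p (Some \<beta>) = mat2 1 \<beta> 0 p"

lemma finite_hecke_index [simp]: "finite (hecke_index p)"
  by (simp add: hecke_index_def)

lemma det_hecke_rep: "det (hecke_rep p i) = p"
  by (cases i) auto

text \<open>Divisibility by p means that \<open>M_i M_j^(-1)\<close>, the product with the adjugate
  divided by p, is integral; distinct representatives never differ by an integral left
  factor.\<close>

lemma hecke_rep_inj:
  assumes p: "prime_elem p" and ij: "i \<in> hecke_index p" "j \<in> hecke_index p"
    and dvd: "\<And>r s. p dvd (hecke_rep p i ** adj2 (hecke_rep p j)) $ r $ s"
  shows "i = j"
proof -
  have unit: "\<not> p dvd 1"
    using p by auto
  show ?thesis
    using dvd[of 1 1] dvd[of 1 2] dvd[of 2 2] ij unit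
    by (cases i; cases j) (auto simp: matrix_mult_2_nth adj2_def hecke_index_def
        intro: polys_below_dvd_diff[symmetric] dest: polys_below_dvd_diff dvd_diff)
qed

text \<open>Modulo p the matrix M is singular. If its first column vanishes there, the
  representative is \<open>None\<close>; otherwise the second column is a multiple of the first, and
  the multiplier is the index.\<close>

lemma hecke_rep_exists:
  fixes p :: "'a::{field,finite} poly"
  assumes p: "prime_elem p" "\<not> [:0, 1:] dvd p"
    and M: "det M = [:u:] * p" "[:0, 1:] dvd M $ 2 $ 1" and u: "u \<noteq> 0"
  shows "\<exists>j\<in>hecke_index p. \<exists>\<gamma>\<in>Gamma0_T. det \<gamma> = [:u:] \<and> M = \<gamma> ** hecke_rep p j"
proof -
  define a b c d where "a = M $ 1 $ 1" "b = M $ 1 $ 2" "c = M $ 2 $ 1" "d = M $ 2 $ 2"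
  note abcd = this
  have det: "a * d - b * c = [:u:] * p"
    using M(1) by (simp add: det_2 abcd)
  have p0: "p \<noteq> 0"
    using p by auto
  show ?thesis
  proof (cases "p dvd a \<and> p dvd c")
    case True
    then obtain a' c' where a': "a = p * a'" and c': "c = p * c'"
      by (auto simp: dvd_def)
    have "p * (a' * d - b * c') = p * [:u:]"
      using det by (simp add: a' c' algebra_simps)
    then have "a' * d - b * c' = [:u:]"
      using p0 mult_left_cancel by blast
    \<comment> \<open>That T does not divide p keeps the left factor in \<open>Gamma0_T\<close>: the
      prime T divides p c', hence c'.\<close>
    moreover have "[:0, 1:] dvd c'"
      using M(2) p(2) by (auto simp: abcd(3)[symmetric] c' prime_elem_dvd_mult_iff[OF prime_elem_T])
    ultimately show ?thesis
      using u by (intro bexI[of _ None] bexI[of _ "mat2 a' b c' d"])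
        (auto simp: hecke_index_def Gamma0_T_iff matrix_2_eq_iff matrix_mult_2_nth abcd[symmetric] a' c' mult.commute)
  next
    case False
    \<comment> \<open>The multiplier is determined by an entry of the first column that is
      invertible modulo p; the vanishing of the determinant modulo p makes it fit the other
      row.\<close>
    have "\<exists>\<beta>\<in>polys_below (degree p). p dvd b - a * \<beta> \<and> p dvd d - c * \<beta>"
    proof (cases "p dvd a")
      case True
      then obtain \<beta> where \<beta>: "\<beta> \<in> polys_below (degree p)" "p dvd d - c * \<beta>"
        using linear_congruence_prime[OF p(1), of c d] False by blast
      have "b * c = a * d - [:u:] * p"
        using det by (simp add: algebra_simps)
      then have "p dvd b * c"
        using True by (metis dvd_diff dvd_mult2 dvd_triv_right)
      then have "p dvd b"
        using False True p(1) by (auto simp: prime_elem_dvd_mult_iff)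
      then show ?thesis
        using \<beta> True by (intro bexI[of _ \<beta>]) auto
    next
      case False
      then obtain \<beta> where \<beta>: "\<beta> \<in> polys_below (degree p)" "p dvd b - a * \<beta>"
        using linear_congruence_prime[OF p(1), of a b] by blast
      have "a * (d - c * \<beta>) = [:u:] * p + c * (b - a * \<beta>)"
        using det by (simp add: algebra_simps)
      moreover have "p dvd [:u:] * p + c * (b - a * \<beta>)"
        using \<beta>(2) by (intro dvd_add dvd_triv_right dvd_mult)
      ultimately have "p dvd a * (d - c * \<beta>)"
        by (simp only:)
      then have "p dvd d - c * \<beta>"
        using False p(1) prime_elem_dvd_mult_iff by blast
      then show ?thesis
        using \<beta> by blast
    qed
    then obtain \<beta> b' d' where \<beta>: "\<beta> \<in> polys_below (degree p)" "b - a * \<beta> = p * b'" "d - c * \<beta> = p * d'"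
      by (auto simp: dvd_def)
    have "p * (a * d' - b' * c) = a * (d - c * \<beta>) - (b - a * \<beta>) * c"
      unfolding \<beta>(2,3) by (simp add: algebra_simps)
    also have "\<dots> = p * [:u:]"
      using det by (simp add: algebra_simps)
    finally have "a * d' - b' * c = [:u:]"
      using p0 mult_left_cancel by blast
    moreover have "b = a * \<beta> + b' * p" "d = c * \<beta> + d' * p"
      using \<beta>(2,3) by (simp_all add: algebra_simps)
    ultimately show ?thesis
      using u \<beta>(1) M(2) by (intro bexI[of _ "Some \<beta>"] bexI[of _ "mat2 a b' c d'"])
        (auto simp: hecke_index_def Gamma0_T_iff matrix_2_eq_iff matrix_mult_2_nth abcd)
  qed
qed

section \<open>The weight k action and sums over representatives\<close>

context C_infinity
begin

text \<open>Type 0 drops the determinant factor. The action is then used for all matrices of nonzero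
  determinant, and the determinants p and T introduce no extra powers.\<close>

abbreviation act :: "nat \<Rightarrow> ('c \<Rightarrow> 'c) \<Rightarrow> 'a poly ^ 2 ^ 2 \<Rightarrow> 'c \<Rightarrow> 'c" where
  "act k \<equiv> slash \<iota> k 0"

lemma slash_1_conv_act: "slash \<iota> k 1 f \<delta> z = emb \<iota> (det \<delta>) * act k f \<delta> z"
  by (simp add: slash_def)

definition den :: "'a poly ^ 2 ^ 2 \<Rightarrow> 'c \<Rightarrow> 'c" where
  "den M z = emb \<iota> (M $ 2 $ 1) * z + emb \<iota> (M $ 2 $ 2)"

lemma act_eq: "act k f M z = f (moebius \<iota> M z) / den M z ^ k"
  by (simp add: slash_def den_def)

lemma den_nonzero:
  assumes "z \<notin> range \<iota>" "det M \<noteq> 0"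
  shows "den M z \<noteq> 0"
proof
  assume 0: "den M z = 0"
  show False
  proof (cases "M $ 2 $ 1 = 0")
    case True
    then have "M $ 2 $ 2 = 0"
      using 0 by (simp add: den_def emb_simps)
    then show False
      using True assms(2) by (simp add: det_2)
  next
    case False
    then have "z = - emb \<iota> (M $ 2 $ 2) / emb \<iota> (M $ 2 $ 1)"
      using 0 by (simp add: den_def field_simps eq_neg_iff_add_eq_0)
    then show False
      using assms(1) range_iota_closed(4,5) emb_in_range by metis
  qed
qed

lemma moebius_notin_range:
  assumes z: "z \<notin> range \<iota>" and M: "det M \<noteq> 0"
  shows "moebius \<iota> M z \<notin> range \<iota>"
proof
  define w where "w = moebius \<iota> M z"
  assume w: "moebius \<iota> M z \<in> range \<iota>"
  let ?a = "emb \<iota> (M $ 1 $ 1)" and ?b = "emb \<iota> (M $ 1 $ 2)"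
    and ?c = "emb \<iota> (M $ 2 $ 1)" and ?d = "emb \<iota> (M $ 2 $ 2)"
  have "?a * z + ?b = w * (?c * z + ?d)"
    using den_nonzero[OF z M] by (simp add: w_def moebius_def den_def)
  then have eq: "(?a - w * ?c) * z = w * ?d - ?b"
    by (simp add: algebra_simps)
  show False
  proof (cases "?a - w * ?c = 0")
    case True
    then have "?a = w * ?c" "?b = w * ?d"
      using eq by simp_all
    then have "emb \<iota> (det M) = 0"
      by (simp add: det_2 emb_simps)
    then show False
      using M by simp
  next
    case False
    then have "z = (w * ?d - ?b) / (?a - w * ?c)"
      using eq by (simp add: field_simps)
    moreover have "\<dots> \<in> range \<iota>"
      using w unfolding w_def by (intro range_iota_closed emb_in_range)
    ultimately show False
      using z by simp
  qed
qed

lemma den_mult: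
  assumes "z \<notin> range \<iota>" "det N \<noteq> 0"
  shows "den (M ** N) z = den M (moebius \<iota> N z) * den N z"
proof -
  have "den M (moebius \<iota> N z) * den N z =
      emb \<iota> (M $ 2 $ 1) * (emb \<iota> (N $ 1 $ 1) * z + emb \<iota> (N $ 1 $ 2)) + emb \<iota> (M $ 2 $ 2) * den N z"
    using den_nonzero[OF assms] unfolding den_def moebius_def by (simp add: distrib_right)
  then show ?thesis
    by (simp add: den_def matrix_mult_2_nth emb_simps algebra_simps)
qed

lemma moebius_mult:
  assumes z: "z \<notin> range \<iota>" and N: "det N \<noteq> 0"
  shows "moebius \<iota> (M ** N) z = moebius \<iota> M (moebius \<iota> N z)"
proof -
  define num where "num M z = emb \<iota> (M $ 1 $ 1) * z + emb \<iota> (M $ 1 $ 2)" for M :: "'a poly ^ 2 ^ 2" and z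
  have conv: "moebius \<iota> M z = num M z / den M z" for M z
    by (simp add: moebius_def num_def den_def)
  have "num (M ** N) z = num M (moebius \<iota> N z) * den N z"
  proof -
    have "num M (moebius \<iota> N z) * den N z =
        emb \<iota> (M $ 1 $ 1) * (emb \<iota> (N $ 1 $ 1) * z + emb \<iota> (N $ 1 $ 2)) + emb \<iota> (M $ 1 $ 2) * den N z"
      using den_nonzero[OF z N] unfolding den_def num_def moebius_def by (simp add: distrib_right)
    then show ?thesis
      by (simp add: den_def num_def matrix_mult_2_nth emb_simps algebra_simps)
  qed
  then show ?thesis
    using den_nonzero[OF z N] unfolding conv[of "M ** N"] conv[of M] by (simp add: den_mult[OF z N])
qed

lemma act_mult:
  assumes "z \<notin> range \<iota>" "det N \<noteq> 0"
  shows "act k f (M ** N) z = act k (act k f M) N z"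
  by (simp add: act_eq moebius_mult[OF assms] den_mult[OF assms] power_mult_distrib)

lemma act_cong:
  assumes "z \<notin> range \<iota>" "det M \<noteq> 0" "\<And>w. w \<notin> range \<iota> \<Longrightarrow> f w = g w"
  shows "act k f M z = act k g M z"
  by (simp add: act_eq assms moebius_notin_range)

text \<open>Type 1 expressed through \<open>act\<close>: the determinant factor moves to the
  right-hand side.\<close>

definition invariant :: "nat \<Rightarrow> ('c \<Rightarrow> 'c) \<Rightarrow> bool" where
  "invariant k f \<longleftrightarrow> (\<forall>\<gamma>\<in>Gamma0_T. \<forall>z. z \<notin> range \<iota> \<longrightarrow> act k f \<gamma> z = f z / emb \<iota> (det \<gamma>))"

lemma invariant_iff_slash:
  "invariant k f \<longleftrightarrow> (\<forall>\<gamma>\<in>Gamma0_T. \<forall>z\<in>Omega \<iota>. slash \<iota> k 1 f \<gamma> z = f z)"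
proof -
  have "act k f \<gamma> z = f z / emb \<iota> (det \<gamma>) \<longleftrightarrow> slash \<iota> k 1 f \<gamma> z = f z" if "\<gamma> \<in> Gamma0_T" for \<gamma> z
  proof -
    have "emb \<iota> (det \<gamma>) \<noteq> 0"
      using that by (auto simp: Gamma0_T_iff)
    then show ?thesis
      by (auto simp: slash_1_conv_act[unfolded One_nat_def] field_simps)
  qed
  then show ?thesis
    by (auto simp: invariant_def Omega_def)
qed

text \<open>The representatives \<open>Some \<beta>\<close> have automorphy denominator p, which
  cancels \<open>p ^ k\<close>; for \<open>None\<close> the denominator is 1 and the factor
  remains.\<close>

lemma hecke_conv_act:
  assumes "prime_elem p"
  shows "hecke \<iota> k p f z = emb \<iota> p ^ k * (\<Sum>i\<in>hecke_index p. act k f (hecke_rep p i) z)"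
proof -
  have p: "p \<noteq> 0" "0 < degree p"
    using assms degree_prime_elem_pos by auto
  have None: "act k f (hecke_rep p None) z = f (emb \<iota> p * z)"
    by (simp add: act_eq moebius_def den_def emb_simps)
  have Some: "emb \<iota> p ^ k * act k f (hecke_rep p (Some \<beta>)) z = f ((z + emb \<iota> \<beta>) / emb \<iota> p)" for \<beta>
    using p by (simp add: act_eq moebius_def den_def emb_simps)
  have "(\<Sum>i\<in>hecke_index p. act k f (hecke_rep p i) z) =
      act k f (hecke_rep p None) z + (\<Sum>\<beta>\<in>polys_below (degree p). act k f (hecke_rep p (Some \<beta>)) z)"
    unfolding hecke_index_def by (subst sum.insert) (auto simp: sum.reindex)
  then show ?thesis
    by (simp add: hecke_def None Some distrib_left sum_distrib_left polys_below_degree[OF p(2)]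
        del: hecke_rep.simps)
qed

text \<open>Each \<open>h i\<close> lies in the coset of some representative
  \<open>\<sigma> i\<close>. Distinct cosets make \<open>\<sigma>\<close> injective on a finite set,
  hence a permutation, so the sum only changes by the unit from the type.\<close>

lemma sum_act_reps:
  assumes p: "prime_elem p" "\<not> [:0, 1:] dvd p" and f: "invariant k f" and z: "z \<notin> range \<iota>"
    and u: "u \<noteq> 0"
    and h: "\<And>i. i \<in> hecke_index p \<Longrightarrow> det (h i) = [:u:] * p"
      "\<And>i. i \<in> hecke_index p \<Longrightarrow> [:0, 1:] dvd h i $ 2 $ 1"
    and inj: "\<And>i j. i \<in> hecke_index p \<Longrightarrow> j \<in> hecke_index p \<Longrightarrow>
      (\<And>r s. p dvd (h i ** adj2 (h j)) $ r $ s) \<Longrightarrow> i = j"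
  shows "(\<Sum>i\<in>hecke_index p. act k f (h i) z) = (\<Sum>i\<in>hecke_index p. act k f (hecke_rep p i) z) / \<kappa> u"
proof -
  have "\<forall>i\<in>hecke_index p. \<exists>j. j \<in> hecke_index p \<and> (\<exists>\<gamma>\<in>Gamma0_T. det \<gamma> = [:u:] \<and> h i = \<gamma> ** hecke_rep p j)"
    using hecke_rep_exists[OF p h(1,2) u] by blast
  then obtain \<sigma> where \<sigma>: "\<And>i. i \<in> hecke_index p \<Longrightarrow> \<sigma> i \<in> hecke_index p"
    "\<And>i. i \<in> hecke_index p \<Longrightarrow> \<exists>\<gamma>\<in>Gamma0_T. det \<gamma> = [:u:] \<and> h i = \<gamma> ** hecke_rep p (\<sigma> i)"
    by metis
  have "inj_on \<sigma> (hecke_index p)"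
  proof (rule inj_onI)
    fix i j assume ij: "i \<in> hecke_index p" "j \<in> hecke_index p" "\<sigma> i = \<sigma> j"
    obtain \<gamma> \<gamma>' where "h i = \<gamma> ** hecke_rep p (\<sigma> i)" "h j = \<gamma>' ** hecke_rep p (\<sigma> i)"
      using \<sigma>(2)[OF ij(1)] \<sigma>(2)[OF ij(2)] ij(3) by metis
    then have "h i ** adj2 (h j) = \<gamma> ** (hecke_rep p (\<sigma> i) ** adj2 (hecke_rep p (\<sigma> i))) ** adj2 \<gamma>'"
      by (simp add: adj2_mult matrix_mul_assoc)
    \<comment> \<open>With a common representative the middle factors collapse to the scalar matrix
      p, which contradicts distinctness unless i = j.\<close>
    then have "h i ** adj2 (h j) = (\<gamma> ** mat p) ** adj2 \<gamma>'"
      by (simp add: mult_adj2 det_hecke_rep)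
    then have "p dvd (h i ** adj2 (h j)) $ r $ s" for r s
      by (simp add: matrix_mult_2_nth[of "\<gamma> ** mat p"] mat_mult_nth_2)
    then show "i = j"
      using inj[OF ij(1,2)] by blast
  qed
  then have bij: "bij_betw \<sigma> (hecke_index p) (hecke_index p)"
    unfolding bij_betw_def using \<sigma>(1) by (intro conjI endo_inj_surj) auto
  have "act k f (h i) z = act k f (hecke_rep p (\<sigma> i)) z / \<kappa> u" if i: "i \<in> hecke_index p" for i
  proof -
    obtain \<gamma> where \<gamma>: "\<gamma> \<in> Gamma0_T" "det \<gamma> = [:u:]" "h i = \<gamma> ** hecke_rep p (\<sigma> i)"
      using \<sigma>(2)[OF i] by blast
    have det: "det (hecke_rep p (\<sigma> i)) \<noteq> 0"
      using p by (auto simp: det_hecke_rep)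
    have "act k f (h i) z = act k (act k f \<gamma>) (hecke_rep p (\<sigma> i)) z"
      unfolding \<gamma>(3) by (rule act_mult[OF z det])
    also have "\<dots> = act k (\<lambda>w. f w / \<kappa> u) (hecke_rep p (\<sigma> i)) z"
      using f \<gamma> by (intro act_cong[OF z det]) (auto simp: invariant_def)
    finally show ?thesis
      by (simp add: act_eq)
  qed
  then have "(\<Sum>i\<in>hecke_index p. act k f (h i) z) =
      (\<Sum>i\<in>hecke_index p. act k f (hecke_rep p (\<sigma> i)) z / \<kappa> u)"
    by (intro sum.cong) auto
  also have "\<dots> = (\<Sum>i\<in>hecke_index p. act k f (hecke_rep p i) z / \<kappa> u)"
    by (rule sum.reindex_bij_betw[OF bij])
  finally show ?thesis
    by (simp add: sum_divide_distrib)
qed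

lemma act_hecke:
  assumes p: "prime_elem p" and z: "z \<notin> range \<iota>" and N: "det N \<noteq> 0"
  shows "act k (hecke \<iota> k p f) N z =
    emb \<iota> p ^ k * (\<Sum>i\<in>hecke_index p. act k f (hecke_rep p i ** N) z)"
proof -
  have "act k (hecke \<iota> k p f) N z =
      emb \<iota> p ^ k * (\<Sum>i\<in>hecke_index p. act k (act k f (hecke_rep p i)) N z)"
    by (simp add: act_eq[of k "hecke \<iota> k p f"] act_eq[of k "act k f M" for M] hecke_conv_act[OF p]
        flip: sum_divide_distrib)
  then show ?thesis
    by (simp only: act_mult[OF z N])
qed

text \<open>Right multiplication by an element of the group turns the representatives into another
  system of distinct cosets.\<close>

lemma invariant_hecke:
  assumes p: "prime_elem p" "\<not> [:0, 1:] dvd p" and f: "invariant k f"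
  shows "invariant k (hecke \<iota> k p f)"
  unfolding invariant_def
proof (intro ballI allI impI)
  fix \<gamma> :: "'a poly ^ 2 ^ 2" and z assume \<gamma>: "\<gamma> \<in> Gamma0_T" and z: "z \<notin> range \<iota>"
  obtain u where u: "u \<noteq> 0" "det \<gamma> = [:u:]" and T: "[:0, 1:] dvd \<gamma> $ 2 $ 1"
    using \<gamma> by (auto simp: Gamma0_T_iff)
  have "(\<Sum>i\<in>hecke_index p. act k f (hecke_rep p i ** \<gamma>) z) =
      (\<Sum>i\<in>hecke_index p. act k f (hecke_rep p i) z) / \<kappa> u"
  proof (rule sum_act_reps[OF p f z u(1)])
    show "det (hecke_rep p i ** \<gamma>) = [:u:] * p" for i
      using u by (simp add: det_mul det_hecke_rep)
    show "[:0, 1:] dvd (hecke_rep p i ** \<gamma>) $ 2 $ 1" for i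
      using T by (cases i) (auto simp: matrix_mult_2_nth simp del: dvd_smult_iff)
    fix i j assume ij: "i \<in> hecke_index p" "j \<in> hecke_index p"
      and dvd: "\<And>r s. p dvd ((hecke_rep p i ** \<gamma>) ** adj2 (hecke_rep p j ** \<gamma>)) $ r $ s"
    have "(hecke_rep p i ** \<gamma>) ** adj2 (hecke_rep p j ** \<gamma>) =
        hecke_rep p i ** (\<gamma> ** adj2 \<gamma>) ** adj2 (hecke_rep p j)"
      by (simp add: adj2_mult matrix_mul_assoc)
    then have "((hecke_rep p i ** \<gamma>) ** adj2 (hecke_rep p j ** \<gamma>)) $ r $ s =
        [:u:] * (hecke_rep p i ** adj2 (hecke_rep p j)) $ r $ s" for r s
      using u by (simp add: mult_adj2 matrix_mult_2_nth[of "_ ** mat _"] mat_mult_nth_2 matrix_mult_2_nth[of "hecke_rep p i"]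
          smult_add_right)
    then show "i = j"
      using dvd u by (intro hecke_rep_inj[OF p(1) ij]) (simp add: dvd_smult_iff)
  qed
  then show "act k (hecke \<iota> k p f) \<gamma> z = hecke \<iota> k p f z / emb \<iota> (det \<gamma>)"
    using u by (simp add: act_hecke[OF p(1) z] hecke_conv_act[OF p(1)])
qed

text \<open>The Fricke (Atkin-Lehner) matrix of level T.\<close>

definition W_T :: "'a poly ^ 2 ^ 2" where
  "W_T = mat2 0 (- 1) [:0, 1:] 0"

lemma det_W_T [simp]: "det W_T = [:0, 1:]"
  by (simp add: W_T_def)

text \<open>Conjugation by \<open>W_T\<close> carries the representatives to other integral matrices
  of determinant p with lower left entry divisible by T, and these again represent distinct
  cosets.\<close>

lemma hecke_act_W_T:
  assumes p: "prime_elem p" "\<not> [:0, 1:] dvd p" and f: "invariant k f" and z: "z \<notin> range \<iota>"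
  shows "hecke \<iota> k p (act k f W_T) z = act k (hecke \<iota> k p f) W_T z"
proof -
  \<comment> \<open>These are the conjugates of \<open>hecke_rep p i\<close> by \<open>W_T\<close>,
    written without denominators.\<close>
  define h where "h i = (case i of None \<Rightarrow> mat2 1 0 0 p | Some \<beta> \<Rightarrow> mat2 p 0 (- ([:0, 1:] * \<beta>)) 1)" for i
  define w where "w = moebius \<iota> W_T z"
  have w: "w \<notin> range \<iota>"
    using z by (simp add: w_def moebius_notin_range)
  have comm: "W_T ** hecke_rep p i = h i ** W_T" for i
    by (cases i) (simp_all add: matrix_2_eq_iff matrix_mult_2_nth W_T_def h_def)
  have det: "det (hecke_rep p i) \<noteq> 0" for i
    using p by (auto simp: det_hecke_rep)
  have "act k (act k f W_T) (hecke_rep p i) z = act k f (h i) w / den W_T z ^ k" for i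
  proof -
    have "act k (act k f W_T) (hecke_rep p i) z = act k (act k f (h i)) W_T z"
      using z by (simp add: act_mult[symmetric] det comm del: hecke_rep.simps)
    then show ?thesis
      by (simp add: act_eq[of k "act k f (h i)"] w_def)
  qed
  then have "hecke \<iota> k p (act k f W_T) z =
      emb \<iota> p ^ k * (\<Sum>i\<in>hecke_index p. act k f (h i) w) / den W_T z ^ k"
    by (simp add: hecke_conv_act[OF p(1)] flip: sum_divide_distrib)
  also have "(\<Sum>i\<in>hecke_index p. act k f (h i) w) =
      (\<Sum>i\<in>hecke_index p. act k f (hecke_rep p i) w) / \<kappa> 1"
  proof (rule sum_act_reps[OF p f w])
    show "det (h i) = [:1:] * p" for i
      by (cases i) (auto simp: h_def)
    show "[:0, 1:] dvd h i $ 2 $ 1" for i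
      by (cases i) (simp_all only: h_def option.case mat2_nth dvd_minus_iff dvd_triv_left dvd_0_right)
    fix i j assume ij: "i \<in> hecke_index p" "j \<in> hecke_index p"
      and dvd: "\<And>r s. p dvd (h i ** adj2 (h j)) $ r $ s"
    have unit: "\<not> p dvd 1"
      using p by auto
    \<comment> \<open>If T = p v, then the prime T divides v, and degrees leave no room for p. This
      cancels the factor T in the lower left entries below.\<close>
    have T: "\<not> p dvd [:0, 1:]"
    proof
      assume "p dvd [:0, 1:]"
      then obtain v where v: "[:0, 1:] = p * v"
        by (auto simp: dvd_def)
      then have "[:0, 1:] dvd v"
        using p(2) prime_elem_dvd_mult_iff[OF prime_elem_T, of p v] by auto
      moreover have "v \<noteq> 0"
        using v by auto
      ultimately have "1 \<le> degree v"
        using dvd_imp_degree_le[of "[:0, 1:]" v] by simp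
      moreover have "degree [:0, 1 :: 'a:] = degree p + degree v"
        unfolding v using \<open>v \<noteq> 0\<close> p by (intro degree_mult_eq) auto
      ultimately show False
        using degree_prime_elem_pos[OF p(1)] by simp
    qed
    show "i = j"
    proof (cases i)
      case None
      then show ?thesis
        using dvd[of 1 1] unit by (cases j) (auto simp: h_def adj2_def matrix_mult_2_nth)
    next
      case (Some \<beta>)
      show ?thesis
      proof (cases j)
        case None
        then show ?thesis
          using Some dvd[of 2 2] unit by (auto simp: h_def adj2_def matrix_mult_2_nth)
      next
        case (Some \<beta>')
        have "(h i ** adj2 (h j)) $ 2 $ 1 = [:0, 1:] * (\<beta>' - \<beta>)"
          unfolding \<open>i = Some \<beta>\<close> \<open>j = Some \<beta>'\<close> h_def adj2_def matrix_mult_2_nth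
          by (simp add: algebra_simps)
        then have "p dvd [:0, 1:] * (\<beta>' - \<beta>)"
          using dvd by metis
        then have "p dvd \<beta>' - \<beta>"
          using T p(1) prime_elem_dvd_mult_iff by blast
        then show ?thesis
          using ij \<open>i = Some \<beta>\<close> \<open>j = Some \<beta>'\<close> polys_below_dvd_diff[of \<beta>' p \<beta>]
          by (auto simp: hecke_index_def)
      qed
    qed
  qed simp
  also have "\<kappa> 1 = 1"
    by (simp add: emb_simps flip: one_pCons)
  finally show ?thesis
    by (simp add: act_eq[of k "hecke \<iota> k p f"] hecke_conv_act[OF p(1)] w_def)
qed

end

section \<open>Quotients of function spaces\<close>

text \<open>Zorn's lemma in arbitrary dimension: a linear dependence involves finitely many vectors,
  so it would already occur in one member of a chain.\<close>

lemma (in vectorspace) basis_exists: "\<exists>B. basis B"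
proof -
  define \<A> where "\<A> = {A. A \<subseteq> carrier V \<and> lin_indpt A}"
  have "\<exists>M\<in>\<A>. \<forall>X\<in>\<A>. M \<subseteq> X \<longrightarrow> X = M"
  proof (rule subset_Zorn')
    fix C assume C: "subset.chain \<A> C"
    then have sub: "C \<subseteq> \<A>"
      by (auto simp: subset_chain_def)
    have "lin_indpt (\<Union>C)"
    proof
      assume "lin_dep (\<Union>C)"
      then obtain A a v where A: "finite A" "A \<subseteq> \<Union>C" "a \<in> A \<rightarrow> carrier K"
        "lincomb a A = \<zero>\<^bsub>V\<^esub>" "v \<in> A" "a v \<noteq> \<zero>\<^bsub>K\<^esub>"
        unfolding lin_dep_def by blast
      have "C \<noteq> {}"
        using A by auto
      then obtain B where "B \<in> C" "A \<subseteq> B"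
        using finite_subset_Union_chain[OF A(1,2) _ C] by blast
      then have "lin_dep B"
        unfolding lin_dep_def using A by blast
      then show False
        using \<open>B \<in> C\<close> sub by (auto simp: \<A>_def)
    qed
    then show "\<Union>C \<in> \<A>"
      using sub by (auto simp: \<A>_def)
  qed
  then obtain M where M: "M \<subseteq> carrier V" "lin_indpt M"
    and max: "\<And>X. X \<subseteq> carrier V \<Longrightarrow> lin_indpt X \<Longrightarrow> M \<subseteq> X \<Longrightarrow> X = M"
    unfolding \<A>_def by auto
  have "v \<in> span M" if v: "v \<in> carrier V" for v
  proof (rule ccontr)
    assume nin: "v \<notin> span M"
    then have "v \<notin> M"
      using in_own_span[OF M(1)] by blast
    then have "lin_indpt (M \<union> {v})"
      using lin_dep_iff_in_span[OF M v] nin by blast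
    then have "M \<union> {v} = M"
      using M v by (intro max) auto
    then show False
      using \<open>v \<notin> M\<close> by blast
  qed
  then have "span M = carrier V"
    using span_is_subset2[OF M(1)] by blast
  then show ?thesis
    using M unfolding basis_def by (intro exI[of _ M]) auto
qed

lemma cring_scalar_field: "cring (scalar_field :: 'c::field ring)"
proof (rule cringI)
  show "abelian_group (scalar_field :: 'c ring)"
  proof (rule abelian_groupI)
    fix x :: 'c
    show "\<exists>y\<in>carrier scalar_field. y \<oplus>\<^bsub>scalar_field\<^esub> x = \<zero>\<^bsub>scalar_field\<^esub>"
      by (intro bexI[of _ "- x"]) (auto simp: scalar_field_def)
  qed (auto simp: scalar_field_def)
  show "Group.comm_monoid (scalar_field :: 'c ring)"
    by unfold_locales (auto simp: scalar_field_def)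
qed (auto simp: scalar_field_def distrib_right)

lemma field_scalar_field: "Ring.field (scalar_field :: 'c::field ring)"
  using cring_scalar_field
proof (rule cring.cring_fieldI2)
  fix a :: 'c assume "a \<noteq> \<zero>\<^bsub>scalar_field\<^esub>"
  then show "\<exists>b\<in>carrier scalar_field. a \<otimes>\<^bsub>scalar_field\<^esub> b = \<one>\<^bsub>scalar_field\<^esub>"
    by (intro bexI[of _ "inverse a"]) (auto simp: scalar_field_def)
qed (simp add: scalar_field_def)

locale function_quotient =
  fixes S W :: "('c::field \<Rightarrow> 'c) set"
  assumes S: "(\<lambda>z. 0) \<in> S" "\<And>f g. f \<in> S \<Longrightarrow> g \<in> S \<Longrightarrow> (\<lambda>z. f z + g z) \<in> S"
      "\<And>c f. f \<in> S \<Longrightarrow> (\<lambda>z. c * f z) \<in> S"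
    and W: "(\<lambda>z. 0) \<in> W" "\<And>f g. f \<in> W \<Longrightarrow> g \<in> W \<Longrightarrow> (\<lambda>z. f z + g z) \<in> W"
      "\<And>c f. f \<in> W \<Longrightarrow> (\<lambda>z. c * f z) \<in> W"
    and W_subset: "W \<subseteq> S"
begin

abbreviation "V \<equiv> function_space S"
abbreviation "Q \<equiv> quotient_space V W"

definition coset :: "('c \<Rightarrow> 'c) \<Rightarrow> ('c \<Rightarrow> 'c) set" where
  "coset f = {g. (\<lambda>z. g z - f z) \<in> W}"

lemma W_diff: "f \<in> W \<Longrightarrow> g \<in> W \<Longrightarrow> (\<lambda>z. f z - g z) \<in> W"
  using W(2)[of f "\<lambda>z. - 1 * g z"] W(3)[of g "- 1"] by simp

lemma W_minus: "(\<lambda>z. f z - g z) \<in> W \<Longrightarrow> (\<lambda>z. g z - f z) \<in> W"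
  using W(3)[of "\<lambda>z. f z - g z" "- 1"] by simp

lemma r_coset_eq: "W +>\<^bsub>V\<^esub> f = coset f"
proof -
  have "W +>\<^bsub>V\<^esub> f = (\<lambda>h z. h z + f z) ` W"
    by (auto simp: a_r_coset_def r_coset_def function_space_def)
  also have "\<dots> = coset f"
  proof (intro Set.set_eqI iffI)
    fix g assume "g \<in> coset f"
    then show "g \<in> (\<lambda>h z. h z + f z) ` W"
      by (intro image_eqI[of _ _ "\<lambda>z. g z - f z"]) (auto simp: coset_def)
  qed (auto simp: coset_def)
  finally show ?thesis .
qed

lemma coset_eq: "(\<lambda>z. g z - f z) \<in> W \<Longrightarrow> coset g = coset f"
proof -
  have sub: "coset f \<subseteq> coset g" if "(\<lambda>z. g z - f z) \<in> W" for f g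
  proof
    fix h assume "h \<in> coset f"
    then show "h \<in> coset g"
      using W_diff[of "\<lambda>z. h z - f z" "\<lambda>z. g z - f z"] that by (simp add: coset_def)
  qed
  assume "(\<lambda>z. g z - f z) \<in> W"
  from sub[OF W_minus[OF this]] sub[OF this] show ?thesis
    by (rule equalityI)
qed

lemma self_in_coset [simp]: "f \<in> coset f"
  using W(1) by (simp add: coset_def)

lemma coset_zero: "coset (\<lambda>z. 0) = W"
  by (simp add: coset_def)

lemma carrier_Q: "carrier Q = coset ` S"
proof -
  have "carrier Q = (\<Union>f\<in>S. {W +>\<^bsub>V\<^esub> f})"
    by (simp add: quotient_space_def A_RCOSETS_def RCOSETS_def a_r_coset_def function_space_def)
  then show ?thesis
    by (auto simp: r_coset_eq)
qed

lemma zero_Q: "\<zero>\<^bsub>Q\<^esub> = coset (\<lambda>z. 0)"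
  by (simp add: quotient_space_def coset_zero)

lemma add_Q: "coset f \<oplus>\<^bsub>Q\<^esub> coset g = coset (\<lambda>z. f z + g z)"
proof -
  have "coset f \<oplus>\<^bsub>Q\<^esub> coset g = (\<Union>h\<in>coset f. \<Union>k\<in>coset g. {\<lambda>z. h z + k z})"
    by (simp add: quotient_space_def set_add_def set_mult_def function_space_def)
  also have "\<dots> = coset (\<lambda>z. f z + g z)"
  proof (intro Set.set_eqI iffI)
    fix h assume "h \<in> (\<Union>h\<in>coset f. \<Union>k\<in>coset g. {\<lambda>z. h z + k z})"
    then obtain h1 h2 where "h1 \<in> coset f" "h2 \<in> coset g" "h = (\<lambda>z. h1 z + h2 z)"
      by blast
    then show "h \<in> coset (\<lambda>z. f z + g z)"
      using W(2)[of "\<lambda>z. h1 z - f z" "\<lambda>z. h2 z - g z"] by (simp add: coset_def algebra_simps)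
  next
    fix h assume "h \<in> coset (\<lambda>z. f z + g z)"
    then have "(\<lambda>z. h z - g z) \<in> coset f"
      by (simp add: coset_def algebra_simps)
    moreover have "h = (\<lambda>z. (h z - g z) + g z)"
      by simp
    ultimately show "h \<in> (\<Union>h\<in>coset f. \<Union>k\<in>coset g. {\<lambda>z. h z + k z})"
      using self_in_coset[of g] by blast
  qed
  finally show ?thesis .
qed

text \<open>Closure of W under scalars makes all cosets in the defining union equal.\<close>

lemma smult_Q: "c \<odot>\<^bsub>Q\<^esub> coset f = coset (\<lambda>z. c * f z)"
proof -
  have "c \<odot>\<^bsub>Q\<^esub> coset f = (\<Union>g\<in>coset f. coset (\<lambda>z. c * g z))"
    by (simp add: quotient_space_def r_coset_eq) (simp add: function_space_def)
  also have "\<dots> = (\<Union>g\<in>coset f. coset (\<lambda>z. c * f z))"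
  proof (intro SUP_cong refl coset_eq)
    fix g assume "g \<in> coset f"
    then show "(\<lambda>z. c * g z - c * f z) \<in> W"
      using W(3)[of "\<lambda>z. g z - f z" c] by (simp add: coset_def right_diff_distrib)
  qed
  also have "\<dots> = coset (\<lambda>z. c * f z)"
    using self_in_coset[of f] by blast
  finally show ?thesis .
qed

lemma vectorspace_Q: "vectorspace scalar_field Q"
proof -
  have "abelian_group Q"
  proof (rule abelian_groupI)
    fix x assume "x \<in> carrier Q"
    then obtain f where f: "f \<in> S" "x = coset f"
      by (auto simp: carrier_Q)
    then show "\<exists>y\<in>carrier Q. y \<oplus>\<^bsub>Q\<^esub> x = \<zero>\<^bsub>Q\<^esub>"
      using S(3)[of f "- 1"] by (intro bexI[of _ "coset (\<lambda>z. - 1 * f z)"]) (auto simp: carrier_Q add_Q zero_Q)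
  qed (auto simp: carrier_Q add_Q zero_Q S ac_simps intro!: imageI)
  then have "module scalar_field Q"
    by (intro moduleI cring_scalar_field)
      (auto simp: carrier_Q add_Q smult_Q S scalar_field_def distrib_left distrib_right mult.assoc intro!: imageI)
  then show ?thesis
    using field_scalar_field by (simp add: vectorspace_def)
qed

text \<open>For every representative g the cosets of T g and c g agree, so the union defining the
  quotient map is literally the union defining scalar multiplication by c.\<close>

lemma eigenvector_Q:
  assumes T: "\<And>f. f \<in> S \<Longrightarrow> (\<lambda>z. T f z - c * f z) \<in> W"
    and v: "v \<in> carrier Q" "v \<noteq> \<zero>\<^bsub>Q\<^esub>"
  shows "is_eigenvector Q (quotient_map V W T) c v"
proof -
  obtain f where f: "f \<in> S" "v = coset f"
    using v by (auto simp: carrier_Q)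
  have "g \<in> S" if "g \<in> v" for g
    using S(2)[OF f(1), of "\<lambda>z. g z - f z"] that W_subset by (auto simp: f coset_def)
  then have "coset (T g) = coset (\<lambda>z. c * g z)" if "g \<in> v" for g
    using that T by (intro coset_eq) auto
  then have "quotient_map V W T v = (\<Union>g\<in>v. coset (\<lambda>z. c * g z))"
    by (simp add: quotient_map_def r_coset_eq)
  also have "\<dots> = c \<odot>\<^bsub>Q\<^esub> v"
    by (simp add: quotient_space_def r_coset_eq) (simp add: function_space_def)
  finally show ?thesis
    using v by (simp add: is_eigenvector_def)
qed

end

section \<open>Rigid analyticity under linear operations and affine substitutions\<close>

context C_infinity
begin

lemma rigid_analytic_zero: "rigid_analytic \<iota> (\<lambda>z. 0)"
  unfolding rigid_analytic_def by (intro allI impI exI[of _ 0] exI[of _ 1]) auto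

lemma rigid_analytic_add:
  assumes "rigid_analytic \<iota> f" "rigid_analytic \<iota> g"
  shows "rigid_analytic \<iota> (\<lambda>z. f z + g z)"
  unfolding rigid_analytic_def
proof (intro allI impI)
  fix n and \<epsilon> :: real assume "0 < \<epsilon>"
  then obtain P Q P' Q' where
    1: "\<forall>z\<in>Omega_affinoid \<iota> n. poly Q z \<noteq> 0 \<and> absval (f z - poly P z / poly Q z) < \<epsilon>" and
    2: "\<forall>z\<in>Omega_affinoid \<iota> n. poly Q' z \<noteq> 0 \<and> absval (g z - poly P' z / poly Q' z) < \<epsilon>"
    using assms unfolding rigid_analytic_def by metis
  have "poly (Q * Q') z \<noteq> 0 \<and> absval (f z + g z - poly (P * Q' + P' * Q) z / poly (Q * Q') z) < \<epsilon>"
    if "z \<in> Omega_affinoid \<iota> n" for z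
  proof -
    have nz: "poly Q z \<noteq> 0" "poly Q' z \<noteq> 0"
      using 1 2 that by auto
    then have eq: "f z + g z - poly (P * Q' + P' * Q) z / poly (Q * Q') z =
        (f z - poly P z / poly Q z) + (g z - poly P' z / poly Q' z)"
      by (simp add: add_divide_distrib)
    have "absval (f z + g z - poly (P * Q' + P' * Q) z / poly (Q * Q') z) < \<epsilon>"
      unfolding eq using 1 2 that by (intro le_less_trans[OF absval_add]) simp
    then show ?thesis
      using nz by simp
  qed
  then show "\<exists>P Q. \<forall>z\<in>Omega_affinoid \<iota> n. poly Q z \<noteq> 0 \<and> absval (f z + g z - poly P z / poly Q z) < \<epsilon>"
    by blast
qed

lemma rigid_analytic_mult:
  assumes "rigid_analytic \<iota> f"
  shows "rigid_analytic \<iota> (\<lambda>z. c * f z)"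
proof (cases "c = 0")
  case False
  show ?thesis
    unfolding rigid_analytic_def
  proof (intro allI impI)
    fix n and \<epsilon> :: real assume "0 < \<epsilon>"
    then have "0 < \<epsilon> / absval c"
      using False by simp
    then obtain P Q where
      1: "\<forall>z\<in>Omega_affinoid \<iota> n. poly Q z \<noteq> 0 \<and> absval (f z - poly P z / poly Q z) < \<epsilon> / absval c"
      using assms unfolding rigid_analytic_def by metis
    have "poly Q z \<noteq> 0 \<and> absval (c * f z - poly (Polynomial.smult c P) z / poly Q z) < \<epsilon>"
      if "z \<in> Omega_affinoid \<iota> n" for z
    proof -
      have "c * f z - poly (Polynomial.smult c P) z / poly Q z = c * (f z - poly P z / poly Q z)"
        by (simp add: right_diff_distrib)
      then show ?thesis
        using 1 that False by (simp add: absval_mult pos_less_divide_eq mult.commute)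
    qed
    then show "\<exists>P Q. \<forall>z\<in>Omega_affinoid \<iota> n. poly Q z \<noteq> 0 \<and> absval (c * f z - poly P z / poly Q z) < \<epsilon>"
      by blast
  qed
qed (use rigid_analytic_zero in simp)

lemma rigid_analytic_sum:
  assumes "\<And>i. i \<in> I \<Longrightarrow> rigid_analytic \<iota> (f i)"
  shows "rigid_analytic \<iota> (\<lambda>z. \<Sum>i\<in>I. f i z)"
  using assms
  by (induction I rule: infinite_finite_induct) (auto intro: rigid_analytic_zero rigid_analytic_add)

lemma Omega_affinoid_iff: "z \<in> Omega_affinoid \<iota> n \<longleftrightarrow> absval z \<le> q ^ n \<and> far (1 / q ^ n) z"
  by (simp add: Omega_affinoid_def far_def q_def)

text \<open>An affine map over \<open>K_\<infinity>\<close> scales both the size of z and its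
  distance to \<open>K_\<infinity>\<close> in a controlled way; m is chosen to cover both.\<close>

lemma Omega_affinoid_affine:
  assumes u: "u \<in> range \<iota>" "v \<in> range \<iota>" "u \<noteq> 0"
  shows "\<exists>m. \<forall>z\<in>Omega_affinoid \<iota> n. u * z + v \<in> Omega_affinoid \<iota> m"
proof -
  have u_pos: "0 < absval u" and q_pos: "0 < q ^ n" for n
    using u q_gt_1 by auto
  obtain m where m: "max (max (absval u * q ^ n) (absval v)) (q ^ n / absval u) < q ^ m"
    using exists_power_gt by blast
  have "u * z + v \<in> Omega_affinoid \<iota> m" if z: "z \<in> Omega_affinoid \<iota> n" for z
  proof -
    have "absval (u * z) \<le> absval u * q ^ n"
      using z by (simp add: Omega_affinoid_iff absval_mult mult_left_mono)
    then have "absval (u * z + v) \<le> q ^ m"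
      using absval_add[of "u * z" v] m by auto
    moreover have "far (absval u * (1 / q ^ n)) (u * z + v)"
      using z by (intro far_affine u) (simp add: Omega_affinoid_iff)
    then have "far (1 / q ^ m) (u * z + v)"
    proof (rule far_mono)
      have "q ^ n < q ^ m * absval u"
        using m u_pos by (simp add: pos_divide_less_eq)
      then show "1 / q ^ m \<le> absval u * (1 / q ^ n)"
        using q_pos by (simp add: field_simps less_imp_le)
    qed
    ultimately show ?thesis
      by (simp add: Omega_affinoid_iff)
  qed
  then show ?thesis
    by blast
qed

lemma rigid_analytic_affine:
  assumes f: "rigid_analytic \<iota> f" and u: "u \<in> range \<iota>" "v \<in> range \<iota>" "u \<noteq> 0"
  shows "rigid_analytic \<iota> (\<lambda>z. f (u * z + v))"
  unfolding rigid_analytic_def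
proof (intro allI impI)
  fix n and \<epsilon> :: real assume "0 < \<epsilon>"
  obtain m where m: "\<forall>z\<in>Omega_affinoid \<iota> n. u * z + v \<in> Omega_affinoid \<iota> m"
    using Omega_affinoid_affine[OF u] by blast
  obtain P Q where PQ: "\<forall>z\<in>Omega_affinoid \<iota> m. poly Q z \<noteq> 0 \<and> absval (f z - poly P z / poly Q z) < \<epsilon>"
    using f \<open>0 < \<epsilon>\<close> unfolding rigid_analytic_def by metis
  have "poly (pcompose R [:v, u:]) z = poly R (u * z + v)" for R z
    by (simp add: poly_pcompose algebra_simps)
  then have "\<forall>z\<in>Omega_affinoid \<iota> n. poly (pcompose Q [:v, u:]) z \<noteq> 0 \<and>
      absval (f (u * z + v) - poly (pcompose P [:v, u:]) z / poly (pcompose Q [:v, u:]) z) < \<epsilon>"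
    using PQ m by simp
  then show "\<exists>P Q. \<forall>z\<in>Omega_affinoid \<iota> n. poly Q z \<noteq> 0 \<and>
      absval (f (u * z + v) - poly P z / poly Q z) < \<epsilon>"
    by blast
qed

lemma rigid_analytic_hecke:
  assumes "rigid_analytic \<iota> f" "p \<noteq> 0"
  shows "rigid_analytic \<iota> (hecke \<iota> k p f)"
proof -
  have zero: "0 \<in> range \<iota>" and one: "1 \<in> range \<iota>"
    using iota_simps(1,4) by (metis rangeI)+
  have "rigid_analytic \<iota> (\<lambda>z. f ((z + emb \<iota> \<beta>) / emb \<iota> p))" for \<beta>
    using rigid_analytic_affine[OF assms(1) range_iota_closed(4)[OF one emb_in_range[of p]]
        range_iota_closed(4)[OF emb_in_range[of \<beta>] emb_in_range[of p]]] assms(2)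
    by (simp add: add_divide_distrib)
  moreover have "rigid_analytic \<iota> (\<lambda>z. f (emb \<iota> p * z))"
    using rigid_analytic_affine[OF assms(1) emb_in_range[of p] zero] assms(2) by simp
  ultimately show ?thesis
    unfolding hecke_def[abs_def]
    by (intro rigid_analytic_add rigid_analytic_mult rigid_analytic_sum)
qed

end

declare One_nat_def [simp del]

section \<open>Expansions at the cusps\<close>

lemma matrix_inv_GL2:
  assumes "\<delta> \<in> GL2_A"
  shows "\<delta> ** matrix_inv \<delta> = mat 1" "matrix_inv \<delta> ** \<delta> = mat 1"
proof -
  have "\<exists>B. \<delta> ** B = mat 1 \<and> B ** \<delta> = mat 1"
    using assms by (simp add: GL2_A_def invertible_def)
  then have "\<delta> ** matrix_inv \<delta> = mat 1 \<and> matrix_inv \<delta> ** \<delta> = mat 1"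
    unfolding matrix_inv_def by (rule someI_ex)
  then show "\<delta> ** matrix_inv \<delta> = mat 1" "matrix_inv \<delta> ** \<delta> = mat 1"
    by auto
qed

text \<open>Up to a unit, the lower left entry of the conjugated translation is c^2 b with c the
  lower left entry of \<open>\<delta>\<close>. Since T is prime, the ideal is A if T divides c, and
  (T) otherwise.\<close>

lemma mem_cusp_ideal_iff:
  assumes \<delta>: "\<delta> \<in> GL2_A"
  shows "b \<in> cusp_ideal Gamma0_T \<delta> \<longleftrightarrow> [:0, 1:] dvd \<delta> $ 2 $ 1 \<or> [:0, 1:] dvd b"
proof -
  define V where "V = matrix_inv \<delta>"
  note inv = matrix_inv_GL2[OF \<delta>, folded V_def]
  define X where "X = \<delta> ** translation b ** V"
  obtain u where u: "u \<noteq> 0" "det \<delta> = [:u:]"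
    using \<delta> by (auto simp: GL2_A_iff)
  have "b \<in> cusp_ideal Gamma0_T \<delta> \<longleftrightarrow> X \<in> Gamma0_T"
  proof
    assume "b \<in> cusp_ideal Gamma0_T \<delta>"
    then obtain \<gamma> where \<gamma>: "\<gamma> \<in> Gamma0_T" "translation b = V ** \<gamma> ** \<delta>"
      by (auto simp: cusp_ideal_def V_def)
    have "X = (\<delta> ** V) ** \<gamma> ** (\<delta> ** V)"
      by (simp add: X_def \<gamma> matrix_mul_assoc)
    then show "X \<in> Gamma0_T"
      using \<gamma> by (simp add: inv)
  next
    assume X: "X \<in> Gamma0_T"
    have "V ** X ** \<delta> = (V ** \<delta>) ** translation b ** (V ** \<delta>)"
      by (simp add: X_def matrix_mul_assoc)
    then have "translation b = V ** X ** \<delta>"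
      by (simp add: inv)
    then show "b \<in> cusp_ideal Gamma0_T \<delta>"
      using X by (auto simp: cusp_ideal_def V_def)
  qed
  also have "\<dots> \<longleftrightarrow> [:0, 1:] dvd X $ 2 $ 1"
  proof -
    have "det \<delta> * det V = 1"
      using inv(1) by (metis det_I det_mul)
    then have "det X = 1"
      by (simp add: X_def det_mul det_2[of "translation b"])
    then show ?thesis
      by (auto simp: Gamma0_T_iff one_pCons)
  qed
  \<comment> \<open>Multiplication by the unit determinant replaces the inverse by the adjugate,
    whose entries are explicit.\<close>
  also have "\<dots> \<longleftrightarrow> [:0, 1:] dvd X $ 2 $ 1 * [:u:]"
    using u by (simp add: dvd_smult_iff)
  also have "X $ 2 $ 1 * [:u:] = - (\<delta> $ 2 $ 1 * \<delta> $ 2 $ 1 * b)"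
  proof -
    have "X ** mat [:u:] = \<delta> ** translation b ** (V ** \<delta>) ** adj2 \<delta>"
      by (simp add: X_def matrix_mul_assoc flip: u(2) mult_adj2(1))
    then have "X ** mat [:u:] = \<delta> ** translation b ** adj2 \<delta>"
      by (simp add: inv)
    then have "(X ** mat [:u:]) $ 2 $ 1 = (\<delta> ** translation b ** adj2 \<delta>) $ 2 $ 1"
      by simp
    then have "X $ 2 $ 1 * [:u:] = (\<delta> ** translation b ** adj2 \<delta>) $ 2 $ 1"
      by (simp only: mat_mult_nth_2)
    also have "\<dots> = - (\<delta> $ 2 $ 1 * \<delta> $ 2 $ 1 * b)"
      by (simp add: matrix_mult_2_nth adj2_def algebra_simps)
    finally show ?thesis .
  qed
  also have "[:0, 1:] dvd - (\<delta> $ 2 $ 1 * \<delta> $ 2 $ 1 * b) \<longleftrightarrow> [:0, 1:] dvd \<delta> $ 2 $ 1 \<or> [:0, 1:] dvd b"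
    by (simp only: dvd_minus_iff prime_elem_dvd_mult_iff[OF prime_elem_T]) blast
  finally show ?thesis .
qed

definition S_mat :: "'a::field poly ^ 2 ^ 2" where
  "S_mat = mat2 0 (- 1) 1 0"

text \<open>Together with \<open>Gamma0_T\<close> itself this accounts for the two cusps: up to
  translation, every other matrix lies in the coset of \<open>S_mat\<close>.\<close>

lemma GL2_A_decomposition:
  fixes \<delta> :: "'a::{field,finite} poly ^ 2 ^ 2"
  assumes \<delta>: "\<delta> \<in> GL2_A" "\<not> [:0, 1:] dvd \<delta> $ 2 $ 1"
  obtains \<gamma> \<beta> where "\<gamma> \<in> Gamma0_T" "\<delta> = \<gamma> ** (S_mat ** translation \<beta>)"
proof -
  \<comment> \<open>The congruence makes the lower left entry of
    \<open>\<delta> (S_mat translation)^(-1)\<close> divisible by T.\<close>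
  obtain \<beta> where \<beta>: "[:0, 1:] dvd \<delta> $ 2 $ 2 - \<delta> $ 2 $ 1 * \<beta>"
    using linear_congruence_prime[OF prime_elem_T \<delta>(2)] by blast
  define \<gamma> where "\<gamma> = mat2 (\<delta> $ 1 $ 1 * \<beta> - \<delta> $ 1 $ 2) (\<delta> $ 1 $ 1) (\<delta> $ 2 $ 1 * \<beta> - \<delta> $ 2 $ 2) (\<delta> $ 2 $ 1)"
  have "det \<gamma> = det \<delta>"
    by (simp add: \<gamma>_def det_2 algebra_simps)
  moreover have "[:0, 1:] dvd \<gamma> $ 2 $ 1"
    using \<beta> unfolding \<gamma>_def mat2_nth by (subst dvd_minus_iff[symmetric]) (simp only: minus_diff_eq)
  ultimately have "\<gamma> \<in> Gamma0_T"
    using \<delta>(1) by (simp add: Gamma0_T_iff GL2_A_iff)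
  moreover have "\<delta> = \<gamma> ** (S_mat ** translation \<beta>)"
    by (simp add: matrix_2_eq_iff matrix_mult_2_nth \<gamma>_def S_mat_def)
  ultimately show ?thesis
    by (rule that)
qed

lemma S_mat_in_GL2_A: "S_mat \<in> GL2_A"
  by (simp add: GL2_A_iff S_mat_def one_pCons)

context C_infinity
begin

lemma has_t_expansion_cusp_infinity:
  assumes \<pi>: "\<pi> \<noteq> 0" and F: "invariant k F" and \<gamma>: "\<gamma> \<in> Gamma0_T"
  shows "has_t_expansion \<iota> \<pi> (cusp_ideal Gamma0_T \<gamma>) (slash \<iota> k 1 F \<gamma>) a \<longleftrightarrow>
    E_exp F (\<lambda>i. a i * (1 / \<pi>) ^ i)"
proof -
  have ideal: "cusp_ideal Gamma0_T \<gamma> = {b. 1 dvd b}"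
    using \<gamma> mem_cusp_ideal_iff[of \<gamma>] by (auto simp: Gamma0_T_def)
  have eq: "slash \<iota> k 1 F \<gamma> z = F z" if "z \<notin> range \<iota>" for z
    using F \<gamma> that by (simp add: invariant_iff_slash Omega_def)
  have "has_t_expansion \<iota> \<pi> (cusp_ideal Gamma0_T \<gamma>) (slash \<iota> k 1 F \<gamma>) a \<longleftrightarrow>
      E_exp (slash \<iota> k 1 F \<gamma>) (\<lambda>i. a i * (1 / \<pi>) ^ i)"
    unfolding ideal has_t_expansion_iff_E_exp[OF \<pi> one_neq_zero]
    by (simp only: emb_simps(1) mult_1_left mult_1_right)
  also have "\<dots> \<longleftrightarrow> E_exp F (\<lambda>i. a i * (1 / \<pi>) ^ i)"
    using eq by (intro iffI) (erule E_exp_cong; simp)+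
  finally show ?thesis .
qed

text \<open>The ideal is (T), so the expansion is taken at T z, and \<open>S_mat\<close> times the
  diagonal matrix (T, 1) is \<open>W_T\<close>. In this scaling the translation by
  \<open>\<beta>\<close> becomes one by \<open>\<beta> / T\<close>.\<close>

lemma has_t_expansion_cusp_zero:
  assumes \<pi>: "\<pi> \<noteq> 0" and F: "invariant k F" and \<gamma>: "\<gamma> \<in> Gamma0_T"
    and \<delta>: "\<delta> = \<gamma> ** (S_mat ** translation \<beta>)"
  shows "has_t_expansion \<iota> \<pi> (cusp_ideal Gamma0_T \<delta>) (slash \<iota> k 1 F \<delta>) a \<longleftrightarrow>
    E_exp (\<lambda>z. act k F W_T (z + emb \<iota> \<beta> / emb \<iota> [:0, 1:])) (\<lambda>i. a i * (1 / (\<pi> * emb \<iota> [:0, 1:])) ^ i)"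
proof -
  define T where "T = emb \<iota> [:0, 1:]"
  have T: "T \<noteq> 0" "T \<in> range \<iota>"
    by (simp_all add: T_def)
  have det_tr: "det (translation \<beta>) = 1"
    by (simp add: det_2)
  have det_S: "det (S_mat :: 'a poly ^ 2 ^ 2) = 1"
    by (simp add: S_mat_def)
  have det: "det \<delta> = det \<gamma>"
    by (simp add: \<delta> det_mul det_tr det_S)
  have \<delta>_GL: "\<delta> \<in> GL2_A"
    using \<gamma> by (simp add: GL2_A_iff det Gamma0_T_iff)
  have "\<not> [:0, 1:] dvd \<delta> $ 2 $ 1"
  proof
    assume "[:0, 1:] dvd \<delta> $ 2 $ 1"
    then have 1: "[:0, 1:] dvd \<gamma> $ 2 $ 2"
      by (simp add: \<delta> matrix_mult_2_nth S_mat_def)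
    obtain u where u: "u \<noteq> 0" "det \<gamma> = [:u:]"
      using \<gamma> by (auto simp: Gamma0_T_iff)
    have "[:0, 1:] dvd \<gamma> $ 1 $ 1 * \<gamma> $ 2 $ 2 - \<gamma> $ 1 $ 2 * \<gamma> $ 2 $ 1"
      using 1 \<gamma> by (intro dvd_diff dvd_mult) (auto simp: Gamma0_T_iff)
    then have "[:0, 1:] dvd [:u:]"
      using u by (simp add: det_2)
    then show False
      using u by (auto dest!: dvd_imp_degree_le)
  qed
  then have ideal: "cusp_ideal Gamma0_T \<delta> = {b. [:0, 1:] dvd b}"
    using mem_cusp_ideal_iff[OF \<delta>_GL] by auto
  have "slash \<iota> k 1 F \<delta> (T * z) = act k F W_T (z + emb \<iota> \<beta> / T)" if z: "z \<notin> range \<iota>" for z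
  proof -
    have Tz: "T * z \<notin> range \<iota>"
    proof
      assume "T * z \<in> range \<iota>"
      from range_iota_closed(4)[OF this T(2)] have "T * z / T \<in> range \<iota>" .
      moreover have "T * z / T = z"
        using T by simp
      ultimately show False
        using z by simp
    qed
    define y where "y = z + emb \<iota> \<beta> / T"
    have y: "y \<notin> range \<iota>"
    proof
      assume "y \<in> range \<iota>"
      then have "y - emb \<iota> \<beta> / T \<in> range \<iota>"
        using T by (intro range_iota_closed emb_in_range)
      then show False
        using z by (simp add: y_def)
    qed
    have Ty: "T * y = T * z + emb \<iota> \<beta>"
      using T by (simp add: y_def distrib_left)
    have nz: "det \<gamma> \<noteq> 0"
      using \<gamma> by (auto simp: Gamma0_T_iff)
    have "slash \<iota> k 1 F \<delta> (T * z) = emb \<iota> (det \<gamma>) * act k (act k F \<gamma>) (S_mat ** translation \<beta>) (T * z)"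
      unfolding slash_1_conv_act det unfolding \<delta>
      by (subst act_mult[OF Tz]) (simp_all add: det_mul det_tr det_S)
    also have "act k (act k F \<gamma>) (S_mat ** translation \<beta>) (T * z) =
        act k (\<lambda>w. F w / emb \<iota> (det \<gamma>)) (S_mat ** translation \<beta>) (T * z)"
      using F \<gamma> by (intro act_cong[OF Tz]) (auto simp: invariant_def det_mul det_tr det_S)
    also have "emb \<iota> (det \<gamma>) * \<dots> = act k F (S_mat ** translation \<beta>) (T * z)"
      using nz by (simp add: act_eq)
    also have "\<dots> = act k (act k F S_mat) (translation \<beta>) (T * z)"
      by (rule act_mult[OF Tz]) (simp add: det_tr)
    also have "\<dots> = act k F S_mat (T * y)"
      by (simp add: act_eq[of k "act k F S_mat"] Ty moebius_def den_def emb_simps)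
    also have "\<dots> = act k (act k F S_mat) (mat2 [:0, 1:] 0 0 1) y"
      by (simp add: act_eq[of k "act k F S_mat"] moebius_def den_def emb_simps T_def)
    also have "\<dots> = act k F (S_mat ** mat2 [:0, 1:] 0 0 1) y"
      by (rule act_mult[OF y, symmetric]) simp
    also have "S_mat ** mat2 [:0, 1:] 0 0 1 = W_T"
      by (simp add: matrix_2_eq_iff matrix_mult_2_nth S_mat_def W_T_def)
    finally show ?thesis
      by (simp add: y_def)
  qed
  then have eq: "E_exp (\<lambda>z. slash \<iota> k 1 F \<delta> (T * z)) c \<longleftrightarrow> E_exp (\<lambda>z. act k F W_T (z + emb \<iota> \<beta> / T)) c" for c
    by (intro iffI) (erule E_exp_cong; simp)+
  show ?thesis
    unfolding ideal using has_t_expansion_iff_E_exp[OF \<pi>, of "[:0, 1:]"] eq by (simp add: T_def)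
qed

text \<open>The part of the definition of a form that is independent of the cusps; expansions are
  added separately.\<close>

definition weak_form :: "nat \<Rightarrow> ('c \<Rightarrow> 'c) \<Rightarrow> bool" where
  "weak_form k f \<longleftrightarrow> (\<forall>z. z \<notin> Omega \<iota> \<longrightarrow> f z = 0) \<and> rigid_analytic \<iota> f \<and> invariant k f"

lemma modular_forms_iff:
  "f \<in> modular_forms \<iota> \<pi> Gamma0_T k 1 \<longleftrightarrow> weak_form k f \<and>
    (\<forall>\<delta>\<in>GL2_A. \<exists>a. has_t_expansion \<iota> \<pi> (cusp_ideal Gamma0_T \<delta>) (slash \<iota> k 1 f \<delta>) a)"
  by (simp add: modular_forms_def weak_form_def invariant_iff_slash)

lemma cusp_forms_iff:
  "f \<in> cusp_forms \<iota> \<pi> Gamma0_T k 1 \<longleftrightarrow> weak_form k f \<and>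
    (\<forall>\<delta>\<in>GL2_A. \<exists>a. has_t_expansion \<iota> \<pi> (cusp_ideal Gamma0_T \<delta>) (slash \<iota> k 1 f \<delta>) a \<and> a 0 = 0)"
  unfolding cusp_forms_def mem_Collect_eq modular_forms_iff by blast

lemma double_cusp_forms_iff:
  "f \<in> double_cusp_forms \<iota> \<pi> Gamma0_T k 1 \<longleftrightarrow> weak_form k f \<and>
    (\<forall>\<delta>\<in>GL2_A. \<exists>a. has_t_expansion \<iota> \<pi> (cusp_ideal Gamma0_T \<delta>) (slash \<iota> k 1 f \<delta>) a \<and> a 0 = 0 \<and> a 1 = 0)"
  unfolding double_cusp_forms_def mem_Collect_eq modular_forms_iff by blast

section \<open>Closure of the spaces of forms under linear operations and Hecke operators\<close>

lemma weak_form_zero: "weak_form k (\<lambda>z. 0)"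
  by (simp add: weak_form_def rigid_analytic_zero invariant_def act_eq)

lemma weak_form_add: "weak_form k f \<Longrightarrow> weak_form k g \<Longrightarrow> weak_form k (\<lambda>z. f z + g z)"
  by (simp add: weak_form_def rigid_analytic_add invariant_def act_eq add_divide_distrib)

lemma weak_form_mult: "weak_form k f \<Longrightarrow> weak_form k (\<lambda>z. c * f z)"
  by (simp add: weak_form_def rigid_analytic_mult invariant_def act_eq flip: times_divide_eq_right)

lemma weak_form_hecke:
  assumes p: "prime_elem p" "\<not> [:0, 1:] dvd p" and f: "weak_form k f"
  shows "weak_form k (hecke \<iota> k p f)"
  unfolding weak_form_def
proof (intro conjI allI impI)
  have p0: "p \<noteq> 0"
    using p by auto
  have f0: "f z = 0" if "z \<in> range \<iota>" for z
    using f that by (auto simp: weak_form_def Omega_def)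
  show "hecke \<iota> k p f z = 0" if "z \<notin> Omega \<iota>" for z
  proof -
    have z: "z \<in> range \<iota>"
      using that by (simp add: Omega_def)
    have "f (emb \<iota> p * z) = 0"
      by (intro f0 range_iota_closed emb_in_range z)
    moreover have "f ((z + emb \<iota> \<beta>) / emb \<iota> p) = 0" for \<beta>
      by (intro f0 range_iota_closed emb_in_range z)
    ultimately show ?thesis
      by (simp add: hecke_def)
  qed
  show "rigid_analytic \<iota> (hecke \<iota> k p f)"
    using f p0 by (intro rigid_analytic_hecke) (auto simp: weak_form_def)
  show "invariant k (hecke \<iota> k p f)"
    using f by (intro invariant_hecke p) (auto simp: weak_form_def)
qed

lemma slash_add: "slash \<iota> k m (\<lambda>z. f z + g z) \<delta> = (\<lambda>z. slash \<iota> k m f \<delta> z + slash \<iota> k m g \<delta> z)"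
  by (simp add: slash_def distrib_left fun_eq_iff)

lemma slash_mult: "slash \<iota> k m (\<lambda>z. c * f z) \<delta> = (\<lambda>z. c * slash \<iota> k m f \<delta> z)"
  by (simp add: slash_def fun_eq_iff mult.left_commute)

lemma slash_zero: "slash \<iota> k m (\<lambda>z. 0) \<delta> = (\<lambda>z. 0)"
  by (simp add: slash_def fun_eq_iff)

lemma has_t_expansion_add:
  assumes "has_t_expansion \<iota> \<pi> I f a" "has_t_expansion \<iota> \<pi> I g b"
  shows "has_t_expansion \<iota> \<pi> I (\<lambda>z. f z + g z) (\<lambda>i. a i + b i)"
proof -
  obtain R S where R: "R > 0" "\<forall>z. far R z \<longrightarrow> (\<lambda>i. a i * t_param \<iota> \<pi> I z ^ i) sums f z"
    and S: "S > 0" "\<forall>z. far S z \<longrightarrow> (\<lambda>i. b i * t_param \<iota> \<pi> I z ^ i) sums g z"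
    using assms unfolding has_t_expansion_def far_def[symmetric] by metis
  have "(\<lambda>i. (a i + b i) * t_param \<iota> \<pi> I z ^ i) sums (f z + g z)" if "far (max R S) z" for z
    using sums_add[OF R(2)[rule_format] S(2)[rule_format]] far_mono[OF that] by (simp add: distrib_right)
  then show ?thesis
    using R(1) unfolding has_t_expansion_def far_def[symmetric] by (intro exI[of _ "max R S"]) auto
qed

lemma has_t_expansion_mult:
  assumes "has_t_expansion \<iota> \<pi> I f a"
  shows "has_t_expansion \<iota> \<pi> I (\<lambda>z. c * f z) (\<lambda>i. c * a i)"
proof -
  obtain R where R: "R > 0" "\<forall>z. far R z \<longrightarrow> (\<lambda>i. a i * t_param \<iota> \<pi> I z ^ i) sums f z"
    using assms unfolding has_t_expansion_def far_def[symmetric] by metis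
  then have "(\<lambda>i. c * a i * t_param \<iota> \<pi> I z ^ i) sums (c * f z)" if "far R z" for z
    using sums_mult_ultrametric[of "\<lambda>i. a i * t_param \<iota> \<pi> I z ^ i"] that by (simp only: mult.assoc)
  then show ?thesis
    using R(1) unfolding has_t_expansion_def far_def[symmetric] by blast
qed

lemma has_t_expansion_zero: "has_t_expansion \<iota> \<pi> I (\<lambda>z. 0) (\<lambda>i. 0)"
  by (auto simp: has_t_expansion_def intro: exI[of _ 1])

lemma function_quotient_cusp_forms:
  "function_quotient (cusp_forms \<iota> \<pi> Gamma0_T k 1) (double_cusp_forms \<iota> \<pi> Gamma0_T k 1)"
proof
  let ?H = "\<lambda>\<delta> f. has_t_expansion \<iota> \<pi> (cusp_ideal Gamma0_T \<delta>) (slash \<iota> k 1 f \<delta>)"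
  have zero: "?H \<delta> (\<lambda>z. 0) (\<lambda>i. 0)" for \<delta>
    unfolding slash_zero by (rule has_t_expansion_zero)
  have add: "?H \<delta> (\<lambda>z. f z + g z) (\<lambda>i. a i + b i)" if "?H \<delta> f a" "?H \<delta> g b" for \<delta> f g a b
    unfolding slash_add using that by (rule has_t_expansion_add)
  have mult: "?H \<delta> (\<lambda>z. c * f z) (\<lambda>i. c * a i)" if "?H \<delta> f a" for \<delta> f a c
    unfolding slash_mult using that by (rule has_t_expansion_mult)
  show "(\<lambda>z. 0) \<in> cusp_forms \<iota> \<pi> Gamma0_T k 1" "(\<lambda>z. 0) \<in> double_cusp_forms \<iota> \<pi> Gamma0_T k 1"
    unfolding cusp_forms_iff double_cusp_forms_iff using weak_form_zero zero by blast+
  show "(\<lambda>z. f z + g z) \<in> cusp_forms \<iota> \<pi> Gamma0_T k 1"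
    if f: "f \<in> cusp_forms \<iota> \<pi> Gamma0_T k 1" "g \<in> cusp_forms \<iota> \<pi> Gamma0_T k 1" for f g
    unfolding cusp_forms_iff
  proof (intro conjI ballI)
    show "weak_form k (\<lambda>z. f z + g z)"
      using f by (simp add: cusp_forms_iff weak_form_add)
    fix \<delta> :: "'a poly ^ 2 ^ 2" assume "\<delta> \<in> GL2_A"
    then obtain a b where "?H \<delta> f a" "a 0 = 0" "?H \<delta> g b" "b 0 = 0"
      using f unfolding cusp_forms_iff by metis
    then show "\<exists>a. ?H \<delta> (\<lambda>z. f z + g z) a \<and> a 0 = 0"
      using add by (intro exI[of _ "\<lambda>i. a i + b i"]) simp
  qed
  show "(\<lambda>z. f z + g z) \<in> double_cusp_forms \<iota> \<pi> Gamma0_T k 1"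
    if f: "f \<in> double_cusp_forms \<iota> \<pi> Gamma0_T k 1" "g \<in> double_cusp_forms \<iota> \<pi> Gamma0_T k 1" for f g
    unfolding double_cusp_forms_iff
  proof (intro conjI ballI)
    show "weak_form k (\<lambda>z. f z + g z)"
      using f by (simp add: double_cusp_forms_iff weak_form_add)
    fix \<delta> :: "'a poly ^ 2 ^ 2" assume "\<delta> \<in> GL2_A"
    then obtain a b where "?H \<delta> f a" "a 0 = 0" "a 1 = 0" "?H \<delta> g b" "b 0 = 0" "b 1 = 0"
      using f unfolding double_cusp_forms_iff by metis
    then show "\<exists>a. ?H \<delta> (\<lambda>z. f z + g z) a \<and> a 0 = 0 \<and> a 1 = 0"
      using add by (intro exI[of _ "\<lambda>i. a i + b i"]) simp
  qed
  show "(\<lambda>z. c * f z) \<in> cusp_forms \<iota> \<pi> Gamma0_T k 1"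
    if f: "f \<in> cusp_forms \<iota> \<pi> Gamma0_T k 1" for c f
    unfolding cusp_forms_iff
  proof (intro conjI ballI)
    show "weak_form k (\<lambda>z. c * f z)"
      using f by (simp add: cusp_forms_iff weak_form_mult)
    fix \<delta> :: "'a poly ^ 2 ^ 2" assume "\<delta> \<in> GL2_A"
    then obtain a where "?H \<delta> f a" "a 0 = 0"
      using f unfolding cusp_forms_iff by metis
    then show "\<exists>a. ?H \<delta> (\<lambda>z. c * f z) a \<and> a 0 = 0"
      using mult by (intro exI[of _ "\<lambda>i. c * a i"]) simp
  qed
  show "(\<lambda>z. c * f z) \<in> double_cusp_forms \<iota> \<pi> Gamma0_T k 1"
    if f: "f \<in> double_cusp_forms \<iota> \<pi> Gamma0_T k 1" for c f
    unfolding double_cusp_forms_iff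
  proof (intro conjI ballI)
    show "weak_form k (\<lambda>z. c * f z)"
      using f by (simp add: double_cusp_forms_iff weak_form_mult)
    fix \<delta> :: "'a poly ^ 2 ^ 2" assume "\<delta> \<in> GL2_A"
    then obtain a where "?H \<delta> f a" "a 0 = 0" "a 1 = 0"
      using f unfolding double_cusp_forms_iff by metis
    then show "\<exists>a. ?H \<delta> (\<lambda>z. c * f z) a \<and> a 0 = 0 \<and> a 1 = 0"
      using mult by (intro exI[of _ "\<lambda>i. c * a i"]) simp
  qed
  show "double_cusp_forms \<iota> \<pi> Gamma0_T k 1 \<subseteq> cusp_forms \<iota> \<pi> Gamma0_T k 1"
    unfolding cusp_forms_iff double_cusp_forms_iff subset_iff by blast
qed

section \<open>Reduction to the two cusps and the congruence modulo double cusp forms\<close>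

lemma rescale_coeff:
  assumes "(c :: 'c) \<noteq> 0"
  shows "(\<lambda>i. (b i * c ^ i) * (1 / c) ^ i) = b"
  using assms by (simp add: fun_eq_iff power_one_over)

text \<open>
  The form \<open>f | W_T\<close> carries the expansion at the cusp \<open>0\<close>, in the same parameter as at \<open>\<infinity>\<close>.
\<close>

lemma cusp_form_E_exp:
  assumes \<pi>: "\<pi> \<noteq> 0" and f: "f \<in> cusp_forms \<iota> \<pi> Gamma0_T k 1"
  shows "\<exists>a. E_exp f a \<and> a 0 = 0" "\<exists>a. E_exp (act k f W_T) a \<and> a 0 = 0"
proof -
  have inv: "invariant k f"
    using f by (simp add: cusp_forms_iff weak_form_def)
  have one: "mat 1 \<in> (Gamma0_T :: ('a poly ^ 2 ^ 2) set)"
    by (simp add: Gamma0_T_iff det_2 one_pCons)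
  then have "(mat 1 :: 'a poly ^ 2 ^ 2) \<in> GL2_A"
    by (simp add: Gamma0_T_def)
  then obtain a where
    "has_t_expansion \<iota> \<pi> (cusp_ideal Gamma0_T (mat 1)) (slash \<iota> k 1 f (mat 1)) a" "a 0 = 0"
    using f unfolding cusp_forms_iff by metis
  then have "E_exp f (\<lambda>i. a i * (1 / \<pi>) ^ i)" "a 0 * (1 / \<pi>) ^ 0 = 0"
    using has_t_expansion_cusp_infinity[OF \<pi> inv one] by auto
  then show "\<exists>a. E_exp f a \<and> a 0 = 0"
    by blast
  obtain a where
    "has_t_expansion \<iota> \<pi> (cusp_ideal Gamma0_T S_mat) (slash \<iota> k 1 f S_mat) a" "a 0 = 0"
    using f S_mat_in_GL2_A unfolding cusp_forms_iff by metis
  moreover have "S_mat = mat 1 ** (S_mat ** translation (0 :: 'a poly))"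
    by (simp add: matrix_2_eq_iff matrix_mult_2_nth)
  ultimately have "E_exp (act k f W_T) (\<lambda>i. a i * (1 / (\<pi> * emb \<iota> [:0, 1:])) ^ i)"
      "a 0 * (1 / (\<pi> * emb \<iota> [:0, 1:])) ^ 0 = 0"
    using has_t_expansion_cusp_zero[OF \<pi> inv one, of S_mat 0] by (auto simp: emb_simps)
  then show "\<exists>a. E_exp (act k f W_T) a \<and> a 0 = 0"
    by blast
qed

text \<open>Two expansions control all \<open>\<delta>\<close>: a matrix in \<open>Gamma0_T\<close>
  leads to F itself, any other one to a translate of \<open>F | W_T\<close>.\<close>

lemma double_cusp_formI:
  assumes \<pi>: "\<pi> \<noteq> 0" and F: "weak_form k F"
    and a: "E_exp F a" "a 0 = 0" "a 1 = 0"
    and b: "E_exp (act k F W_T) b" "b 0 = 0" "b 1 = 0"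
  shows "F \<in> double_cusp_forms \<iota> \<pi> Gamma0_T k 1"
  unfolding double_cusp_forms_iff
proof (intro conjI ballI)
  have inv: "invariant k F"
    using F by (simp add: weak_form_def)
  fix \<delta> :: "'a poly ^ 2 ^ 2" assume \<delta>: "\<delta> \<in> GL2_A"
  show "\<exists>a. has_t_expansion \<iota> \<pi> (cusp_ideal Gamma0_T \<delta>) (slash \<iota> k 1 F \<delta>) a \<and> a 0 = 0 \<and> a 1 = 0"
  proof (cases "[:0, 1:] dvd \<delta> $ 2 $ 1")
    case True
    then have "\<delta> \<in> Gamma0_T"
      using \<delta> by (simp add: Gamma0_T_def)
    then show ?thesis
      using has_t_expansion_cusp_infinity[OF \<pi> inv, of \<delta> "\<lambda>i. a i * \<pi> ^ i"] a \<pi>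
      by (intro exI[of _ "\<lambda>i. a i * \<pi> ^ i"]) (simp add: rescale_coeff)
  next
    case False
    define c where "c = \<pi> * emb \<iota> [:0, 1:]"
    have c: "c \<noteq> 0"
      using \<pi> by (simp add: c_def)
    obtain \<gamma> \<beta> where \<gamma>: "\<gamma> \<in> Gamma0_T" "\<delta> = \<gamma> ** (S_mat ** translation \<beta>)"
      using GL2_A_decomposition[OF \<delta> False] by blast
    \<comment> \<open>The translation by \<open>\<beta> / T\<close> changes the parameter but
      preserves the vanishing of the first two coefficients.\<close>
    have "emb \<iota> \<beta> / emb \<iota> [:0, 1:] \<in> range \<iota>"
      by (intro range_iota_closed emb_in_range)
    from E_exp_translate[OF b this] obtain b' where
      "E_exp (\<lambda>z. act k F W_T (z + emb \<iota> \<beta> / emb \<iota> [:0, 1:])) b'" "b' 0 = 0" "b' 1 = 0"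
      by blast
    then show ?thesis
      using has_t_expansion_cusp_zero[OF \<pi> inv \<gamma>, of "\<lambda>i. b' i * c ^ i"] rescale_coeff[OF c, of b']
      by (intro exI[of _ "\<lambda>i. b' i * c ^ i"]) (simp add: c_def)
  qed
qed (rule F)

lemma hecke_minus_double_cusp_form:
  assumes \<pi>: "\<pi> \<noteq> 0" and p: "prime_elem p" "\<not> [:0, 1:] dvd p"
    and f: "f \<in> cusp_forms \<iota> \<pi> Gamma0_T k 1"
  shows "(\<lambda>z. hecke \<iota> k p f z - emb \<iota> p * f z) \<in> double_cusp_forms \<iota> \<pi> Gamma0_T k 1"
proof -
  have deg: "0 < degree p"
    by (rule degree_prime_elem_pos[OF p(1)])
  have f_weak: "weak_form k f"
    using f by (simp add: cusp_forms_iff)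
  have weak: "weak_form k (\<lambda>z. hecke \<iota> k p f z - emb \<iota> p * f z)"
    using weak_form_add[OF weak_form_hecke[OF p f_weak] weak_form_mult[OF f_weak, of "- emb \<iota> p"]]
    by simp
  obtain a where "E_exp f a" "a 0 = 0"
    using cusp_form_E_exp(1)[OF \<pi> f] by blast
  then obtain a' where a': "E_exp (\<lambda>z. hecke \<iota> k p f z - emb \<iota> p * f z) a'" "a' 0 = 0" "a' 1 = 0"
    using E_exp_hecke[OF deg] by blast
  define G where "G = act k f W_T"
  obtain b where "E_exp G b" "b 0 = 0"
    using cusp_form_E_exp(2)[OF \<pi> f] by (auto simp: G_def)
  then obtain b' where b': "E_exp (\<lambda>z. hecke \<iota> k p G z - emb \<iota> p * G z) b'" "b' 0 = 0" "b' 1 = 0"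
    using E_exp_hecke[OF deg] by blast
  \<comment> \<open>\<open>E_exp_hecke\<close> concerns expansions alone and so applied to G
    directly; commutation with \<open>W_T\<close> identifies the result as the expansion at the cusp
    0.\<close>
  have "hecke \<iota> k p G z - emb \<iota> p * G z = act k (\<lambda>z. hecke \<iota> k p f z - emb \<iota> p * f z) W_T z"
    if "z \<notin> range \<iota>" for z
    using hecke_act_W_T[OF p _ that, of k f] f_weak
    by (simp add: weak_form_def G_def act_eq diff_divide_distrib)
  from E_exp_cong[OF b'(1) this]
  have "E_exp (act k (\<lambda>z. hecke \<iota> k p f z - emb \<iota> p * f z) W_T) b'" .
  from double_cusp_formI[OF \<pi> weak a' this b'(2,3)] show ?thesis .
qed

end

text \<open>A prime divisible by T is a constant multiple of T, and being monic it is T.\<close>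

lemma T_not_dvd_prime:
  fixes p :: "'a::field poly"
  assumes "prime_elem p" "lead_coeff p = 1" "p \<noteq> [:0, 1:]"
  shows "\<not> [:0, 1:] dvd p"
proof
  assume "[:0, 1:] dvd p"
  then obtain v where v: "p = [:0, 1:] * v"
    by (auto simp: dvd_def)
  then have "[:0, 1 :: 'a:] dvd 1 \<or> v dvd 1"
    using prime_elem_imp_irreducible[OF assms(1)] irreducibleD by blast
  then have "v dvd 1"
    by (simp add: is_unit_iff_degree)
  then obtain c where "v = [:c:]"
    by (metis is_unit_polyE)
  then show False
    using assms(2,3) v by (cases "c = 0") (auto simp: coeff_pCons split: nat.splits)
qed

theorem theorem3p4:
  fixes \<iota> :: "'a::{field,finite} fls \<Rightarrow> 'c::complete_ultrametric_field"
    and \<pi> :: 'c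
    and k :: nat
  assumes "is_C_infinity \<iota>"
    and "carlitz_period \<iota> \<pi>"
    and "k > 0"
  shows "vectorspace scalar_field (cusp_quotient \<iota> \<pi> Gamma0_T k 1) \<and>
    (\<exists>B. vectorspace.basis scalar_field (cusp_quotient \<iota> \<pi> Gamma0_T k 1) B \<and>
      (\<forall>v \<in> B. \<forall>p. prime_elem p \<and> lead_coeff p = 1 \<and> p \<noteq> [:0, 1:] \<longrightarrow>
        is_eigenvector (cusp_quotient \<iota> \<pi> Gamma0_T k 1)
          (hecke_quotient \<iota> \<pi> Gamma0_T k 1 p) (emb \<iota> p) v))"
proof -
  interpret C_infinity \<iota> "real CARD('a)"
    by unfold_locales (fact assms(1))
  have \<pi>: "\<pi> \<noteq> 0"
    using assms(2) by (simp add: carlitz_period_def)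
  let ?S = "cusp_forms \<iota> \<pi> Gamma0_T k 1" and ?W = "double_cusp_forms \<iota> \<pi> Gamma0_T k 1"
  interpret FQ: function_quotient ?S ?W
    by (rule function_quotient_cusp_forms)
  have Q: "cusp_quotient \<iota> \<pi> Gamma0_T k 1 = quotient_space (function_space ?S) ?W"
    by (simp add: cusp_quotient_def)
  interpret VS: vectorspace scalar_field "cusp_quotient \<iota> \<pi> Gamma0_T k 1"
    unfolding Q by (rule FQ.vectorspace_Q)
  obtain B where B: "VS.basis B"
    using VS.basis_exists by blast
  then have B_carrier: "B \<subseteq> carrier (cusp_quotient \<iota> \<pi> Gamma0_T k 1)" and "VS.lin_indpt B"
    unfolding VS.basis_def by auto
  \<comment> \<open>An eigenvector must be nonzero, which linear independence of the basis
    provides.\<close>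
  then have B_zero: "\<zero>\<^bsub>cusp_quotient \<iota> \<pi> Gamma0_T k 1\<^esub> \<notin> B"
    by (rule VS.vs_zero_lin_dep)
  have "is_eigenvector (cusp_quotient \<iota> \<pi> Gamma0_T k 1)
      (hecke_quotient \<iota> \<pi> Gamma0_T k 1 p) (emb \<iota> p) v"
    if v: "v \<in> B" and p: "prime_elem p" "lead_coeff p = 1" "p \<noteq> [:0, 1:]" for v p
    unfolding hecke_quotient_def Q
  proof (rule FQ.eigenvector_Q)
    show "(\<lambda>z. hecke \<iota> k p f z - emb \<iota> p * f z) \<in> ?W" if "f \<in> ?S" for f
      using hecke_minus_double_cusp_form[OF \<pi> p(1) T_not_dvd_prime[OF p] that] .
    show "v \<in> carrier (quotient_space (function_space ?S) ?W)"
      using B_carrier v unfolding Q by blast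
    show "v \<noteq> \<zero>\<^bsub>quotient_space (function_space ?S) ?W\<^esub>"
      using B_zero v unfolding Q by blast
  qed
  then show ?thesis
    using VS.vectorspace_axioms B by blast
qed

end
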